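(* Let $h(t)=(t+r)^{-q}e^{-\alpha t}$, $t>0$, where $r\ge 0$ is arbitrary and either $\alpha>0$, $q\ge 1$, or $\alpha=0$, $q>0$. Consider the quadratic form $$\int_0^\infty\!\!\int_0^\infty \overline{f(t)}\,f(s)\,(t+s+r)^{-q}e^{-\alpha(t+s)}\,dt\,ds=\frac{e^{\alpha r}}{\Gamma(q)}\int_{-\infty}^\infty(\lambda-\alpha)_+^{q-1}e^{-r\lambda}\,|(\mathsf L f)(\lambda)|^2\,d\lambda$$ defined on the set of functions $f\in C_0^\infty(\mathbb R_+)$. This form admits the closure in the space $L^2(\mathbb R_+)$, and it is closed on the set of all $f\in L^2(\mathbb R_+)$ such that the integral in the right-hand side is finite (that is, the closure is given by the right-hand side on this set). The self-adjoint operator in $L^2(\mathbb R_+)$ corresponding to this closed form (the Hankel operator with kernel $h$) is strictly positive.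
   Context: $\mathbb R_+=(0,\infty)$. $\mathsf L$ is the Laplace transform $(\mathsf L f)(\lambda)=\int_0^\infty e^{-t\lambda}f(t)\,dt$; for $f\in L^2(\mathbb R_+)$ it is defined for all $\lambda>0$. $\Gamma(\cdot)$ is the gamma function. For $q>0$, $\mu_+^{q-1}=\mu^{q-1}$ for $\mu>0$ and $\mu_+^{q-1}=0$ for $\mu\le 0$. A Hankel operator with kernel $h$ is formally $(Hf)(t)=\int_0^\infty h(t+s)f(s)\,ds$ in $L^2(\mathbb R_+)$. "Strictly positive" ($H>0$) means that $H\ge 0$ and $0$ is not an eigenvalue of $H$. *)

theory Defs
  imports "HOL-Analysis.Analysis"
begin

section \<open>The Hilbert space L2(M)\<close>

text \<open>
  Elements of \<open>L\<^sup>2(M)\<close> are handled through representatives: functions that agree almost everywhere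
  denote the same vector. Scalar products are linear in the first argument.
\<close>

definition L2 :: "'a measure \<Rightarrow> ('a \<Rightarrow> complex) set" where
  "L2 M = {f \<in> borel_measurable M. integrable M (\<lambda>x. (cmod (f x))\<^sup>2)}"

definition l2_inner :: "'a measure \<Rightarrow> ('a \<Rightarrow> complex) \<Rightarrow> ('a \<Rightarrow> complex) \<Rightarrow> complex" where
  "l2_inner M f g = (LINT x|M. f x * cnj (g x))"

definition l2_norm :: "'a measure \<Rightarrow> ('a \<Rightarrow> complex) \<Rightarrow> real" where
  "l2_norm M f = sqrt (LINT x|M. (cmod (f x))\<^sup>2)"

definition l2_dense :: "'a measure \<Rightarrow> ('a \<Rightarrow> complex) set \<Rightarrow> bool" where
  "l2_dense M D \<longleftrightarrow>
     D \<subseteq> L2 M \<and> (\<forall>f\<in>L2 M. \<forall>e>0. \<exists>g\<in>D. l2_norm M (\<lambda>x. f x - g x) < e)"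

definition l2_subspace :: "'a measure \<Rightarrow> ('a \<Rightarrow> complex) set \<Rightarrow> bool" where
  "l2_subspace M D \<longleftrightarrow>
     D \<subseteq> L2 M \<and> (\<lambda>x. 0) \<in> D \<and>
     (\<forall>f\<in>D. \<forall>g\<in>D. (\<lambda>x. f x + g x) \<in> D) \<and> (\<forall>c. \<forall>f\<in>D. (\<lambda>x. c * f x) \<in> D)"


section \<open>Nonnegative quadratic forms in L2(M)\<close>

definition sesquilinear_on ::
  "('a \<Rightarrow> complex) set \<Rightarrow> (('a \<Rightarrow> complex) \<Rightarrow> ('a \<Rightarrow> complex) \<Rightarrow> complex) \<Rightarrow> bool" where
  "sesquilinear_on D B \<longleftrightarrow>
     (\<forall>u\<in>D. \<forall>v\<in>D. \<forall>w\<in>D. B (\<lambda>x. u x + v x) w = B u w + B v w \<and>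
                            B w (\<lambda>x. u x + v x) = B w u + B w v) \<and>
     (\<forall>c. \<forall>u\<in>D. \<forall>v\<in>D. B (\<lambda>x. c * u x) v = c * B u v \<and>
                         B u (\<lambda>x. c * v x) = cnj c * B u v)"

text \<open>The last conjunct says that the form is well defined on almost-everywhere classes.\<close>

definition nonneg_form ::
  "'a measure \<Rightarrow> ('a \<Rightarrow> complex) set \<Rightarrow> (('a \<Rightarrow> complex) \<Rightarrow> complex) \<Rightarrow> bool" where
  "nonneg_form M D Q \<longleftrightarrow>
     l2_subspace M D \<and>
     (\<exists>B. sesquilinear_on D B \<and> (\<forall>u\<in>D. Q u = B u u)) \<and>
     (\<forall>u\<in>D. Q u \<in> \<real> \<and> 0 \<le> Re (Q u)) \<and>
     (\<forall>u\<in>D. \<forall>v\<in>D. (AE x in M. u x = v x) \<longrightarrow> Q u = Q v)"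

text \<open>Convergence of \<open>u\<close> to \<open>f\<close> with respect to the form: \<open>L\<^sup>2\<close>-convergence of elements of the domain that
  are in addition Cauchy for the form (no assumption that \<open>f\<close> lies in the domain).\<close>

definition form_converges ::
  "'a measure \<Rightarrow> ('a \<Rightarrow> complex) set \<Rightarrow> (('a \<Rightarrow> complex) \<Rightarrow> complex)
     \<Rightarrow> (nat \<Rightarrow> 'a \<Rightarrow> complex) \<Rightarrow> ('a \<Rightarrow> complex) \<Rightarrow> bool" where
  "form_converges M D Q u f \<longleftrightarrow>
     (\<forall>n. u n \<in> D) \<and> f \<in> L2 M \<and>
     (\<lambda>n. l2_norm M (\<lambda>x. u n x - f x)) \<longlonglongrightarrow> 0 \<and>
     (\<forall>e>0. \<exists>N. \<forall>m\<ge>N. \<forall>n\<ge>N. cmod (Q (\<lambda>x. u m x - u n x)) < e)"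

definition closable_form ::
  "'a measure \<Rightarrow> ('a \<Rightarrow> complex) set \<Rightarrow> (('a \<Rightarrow> complex) \<Rightarrow> complex) \<Rightarrow> bool" where
  "closable_form M D Q \<longleftrightarrow>
     nonneg_form M D Q \<and>
     (\<forall>u. form_converges M D Q u (\<lambda>x. 0) \<longrightarrow> (\<lambda>n. Q (u n)) \<longlonglongrightarrow> 0)"

definition closed_form ::
  "'a measure \<Rightarrow> ('a \<Rightarrow> complex) set \<Rightarrow> (('a \<Rightarrow> complex) \<Rightarrow> complex) \<Rightarrow> bool" where
  "closed_form M D Q \<longleftrightarrow>
     nonneg_form M D Q \<and>
     (\<forall>u f. form_converges M D Q u f \<longrightarrow>
        f \<in> D \<and> (\<lambda>n. Q (\<lambda>x. u n x - f x)) \<longlonglongrightarrow> 0)"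

text \<open>\<open>(D', Q')\<close> is the closure of the closable form \<open>(D, Q)\<close>.\<close>

definition is_form_closure ::
  "'a measure \<Rightarrow> ('a \<Rightarrow> complex) set \<Rightarrow> (('a \<Rightarrow> complex) \<Rightarrow> complex)
     \<Rightarrow> ('a \<Rightarrow> complex) set \<Rightarrow> (('a \<Rightarrow> complex) \<Rightarrow> complex) \<Rightarrow> bool" where
  "is_form_closure M D Q D' Q' \<longleftrightarrow>
     closable_form M D Q \<and>
     D' = {f. \<exists>u. form_converges M D Q u f} \<and>
     (\<forall>u f. form_converges M D Q u f \<longrightarrow> (\<lambda>n. Q (u n)) \<longlonglongrightarrow> Q' f)"

text \<open>Polarization: recovers the sesquilinear form, linear in the first argument.\<close>

definition form_polar ::
  "(('a \<Rightarrow> complex) \<Rightarrow> complex) \<Rightarrow> ('a \<Rightarrow> complex) \<Rightarrow> ('a \<Rightarrow> complex) \<Rightarrow> complex" where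
  "form_polar Q u v =
     (Q (\<lambda>x. u x + v x) - Q (\<lambda>x. u x - v x)
       + \<i> * Q (\<lambda>x. u x + \<i> * v x) - \<i> * Q (\<lambda>x. u x - \<i> * v x)) / 4"


section \<open>Operators in L2(M)\<close>

text \<open>
  An operator is given by its graph. Since vectors are represented by functions, the graphs below
  contain all representatives of a pair of vectors, so they are single valued only up to
  almost-everywhere equality.

  \<open>form_operator M D Q\<close> is the operator \<open>A\<close> that the representation theorem assigns to a densely
  defined closed form: \<open>u\<close> belongs to the domain of \<open>A\<close> and \<open>A u = w\<close> iff
  \<open>Q[u,v] = (w,v)\<close> for all \<open>v\<close> in the form domain.
\<close>

definition form_operator ::
  "'a measure \<Rightarrow> ('a \<Rightarrow> complex) set \<Rightarrow> (('a \<Rightarrow> complex) \<Rightarrow> complex)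
     \<Rightarrow> (('a \<Rightarrow> complex) \<times> ('a \<Rightarrow> complex)) set" where
  "form_operator M D Q =
     {(u, w). u \<in> D \<and> w \<in> L2 M \<and> (\<forall>v\<in>D. form_polar Q u v = l2_inner M w v)}"

definition l2_adjoint ::
  "'a measure \<Rightarrow> (('a \<Rightarrow> complex) \<times> ('a \<Rightarrow> complex)) set
     \<Rightarrow> (('a \<Rightarrow> complex) \<times> ('a \<Rightarrow> complex)) set" where
  "l2_adjoint M T =
     {(v, z). v \<in> L2 M \<and> z \<in> L2 M \<and> (\<forall>(u, w)\<in>T. l2_inner M w v = l2_inner M u z)}"

text \<open>Linearity and single-valuedness (up to null sets) follow from \<open>T = T\<^sup>*\<close> and density.\<close>

definition l2_self_adjoint ::
  "'a measure \<Rightarrow> (('a \<Rightarrow> complex) \<times> ('a \<Rightarrow> complex)) set \<Rightarrow> bool" where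
  "l2_self_adjoint M T \<longleftrightarrow> l2_dense M (Domain T) \<and> l2_adjoint M T = T"

definition l2_strictly_positive ::
  "'a measure \<Rightarrow> (('a \<Rightarrow> complex) \<times> ('a \<Rightarrow> complex)) set \<Rightarrow> bool" where
  "l2_strictly_positive M T \<longleftrightarrow>
     (\<forall>(u, w)\<in>T. l2_inner M w u \<in> \<real> \<and> 0 \<le> Re (l2_inner M w u)) \<and>
     (\<forall>(u, w)\<in>T. (AE x in M. w x = 0) \<longrightarrow> (AE x in M. u x = 0))"


section \<open>Quasi-Carleman Hankel forms on the half-line\<close>

text \<open>Borel functions suffice: every Lebesgue measurable function is almost everywhere equal to one.\<close>

definition Rplus :: "real measure" where
  "Rplus = restrict_space lborel {0<..}"

text \<open>\<open>C\<^sub>0\<^sup>\<infinity>(0,\<infinity>)\<close>, the test functions being extended by zero to the whole line.\<close>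

definition C0_infinity_Rplus :: "(real \<Rightarrow> complex) set" where
  "C0_infinity_Rplus =
     {f. (\<forall>n x. ((\<lambda>g y. vector_derivative g (at y)) ^^ n) f differentiable (at x)) \<and>
         compact (closure {x. f x \<noteq> 0}) \<and> closure {x. f x \<noteq> 0} \<subseteq> {0<..}}"

definition laplace :: "(real \<Rightarrow> complex) \<Rightarrow> real \<Rightarrow> complex" where
  "laplace f \<xi> = (LINT t|Rplus. complex_of_real (exp (- t * \<xi>)) * f t)"

definition pos_power :: "real \<Rightarrow> real \<Rightarrow> real" where
  "pos_power \<mu> p = (if 0 < \<mu> then \<mu> powr p else 0)"

definition qc_kernel :: "real \<Rightarrow> real \<Rightarrow> real \<Rightarrow> real \<Rightarrow> real" where
  "qc_kernel r q \<alpha> t = (t + r) powr (- q) * exp (- \<alpha> * t)"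

definition hankel_integrand :: "(real \<Rightarrow> real) \<Rightarrow> (real \<Rightarrow> complex) \<Rightarrow> real \<times> real \<Rightarrow> complex" where
  "hankel_integrand h f = (\<lambda>(t, s). cnj (f t) * f s * complex_of_real (h (t + s)))"

definition hankel_form :: "(real \<Rightarrow> real) \<Rightarrow> (real \<Rightarrow> complex) \<Rightarrow> complex" where
  "hankel_form h f = (LINT p|(Rplus \<Otimes>\<^sub>M Rplus). hankel_integrand h f p)"

text \<open>For \<open>\<alpha> = 0\<close> and \<open>\<xi> \<le> 0\<close> the Laplace transform need not exist, but there the weight vanishes.\<close>

definition laplace_integrand ::
  "real \<Rightarrow> real \<Rightarrow> real \<Rightarrow> (real \<Rightarrow> complex) \<Rightarrow> real \<Rightarrow> real" where
  "laplace_integrand r q \<alpha> f \<xi> =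
     pos_power (\<xi> - \<alpha>) (q - 1) * exp (- r * \<xi>) * (cmod (laplace f \<xi>))\<^sup>2"

definition laplace_form ::
  "real \<Rightarrow> real \<Rightarrow> real \<Rightarrow> (real \<Rightarrow> complex) \<Rightarrow> complex" where
  "laplace_form r q \<alpha> f =
     complex_of_real (exp (\<alpha> * r) / Gamma q * (LINT \<xi>|lborel. laplace_integrand r q \<alpha> f \<xi>))"

definition laplace_form_domain :: "real \<Rightarrow> real \<Rightarrow> real \<Rightarrow> (real \<Rightarrow> complex) set" where
  "laplace_form_domain r q \<alpha> =
     {f \<in> L2 Rplus. integrable lborel (laplace_integrand r q \<alpha> f)}"

text \<open>The Hankel operator with kernel \<open>qc_kernel r q \<alpha>\<close>, defined through the closed form.\<close>

definition qc_hankel_operator ::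
  "real \<Rightarrow> real \<Rightarrow> real \<Rightarrow> ((real \<Rightarrow> complex) \<times> (real \<Rightarrow> complex)) set" where
  "qc_hankel_operator r q \<alpha> =
     form_operator Rplus (laplace_form_domain r q \<alpha>) (laplace_form r q \<alpha>)"

end

theory Submission
  imports Defs
begin

text \<open>
  The kernel is a superposition of rank one kernels: by Euler's integral, \<open>(t + s + r)\<^sup>-\<^sup>q exp (- \<alpha> (t + s))\<close>
  is a constant times the integral of \<open>w(\<xi>) exp (- t \<xi>) exp (- s \<xi>)\<close> with the weight
  \<open>w(\<xi>) = (\<xi> - \<alpha>)\<^sub>+\<^sup>q\<^sup>-\<^sup>1 exp (- r \<xi>)\<close>. Fubini's theorem therefore identifies the Hankel form on test
  functions with the squared norm of \<open>W f = w\<^sup>1\<^sup>/\<^sup>2 L f\<close> (\<open>hankel_form_eq_laplace_form\<close>). Everything else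
  concerns the operator \<open>W\<close> from \<open>L\<^sup>2\<close> of the half-line to \<open>L\<^sup>2\<close> of the line.

  On its maximal domain the form is closed: if \<open>u\<^sub>n\<close> tends to \<open>f\<close> in \<open>L\<^sup>2\<close>, then \<open>W u\<^sub>n\<close> tends to \<open>W f\<close> pointwise,
  and Fatou's lemma turns a Cauchy condition on \<open>W u\<^sub>n\<close> into convergence to \<open>W f\<close> (\<open>form_converges_Dom\<close>).
  Closability on test functions follows.

  The main point is that the closure has the maximal domain, that is, that test functions are dense
  there in the form norm (\<open>C0_infinity_core\<close>). An integrable function that vanishes near the origin is
  approximated by test functions in \<open>L\<^sup>1\<close>, and there the form is continuous in \<open>L\<^sup>1\<close>
  (\<open>L1_away_from_0_Dom\<close>). So it suffices to approximate \<open>f\<close> by such functions. The candidates are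
  \<open>exp (- s t) f(t - \<epsilon>)\<close> with small \<open>s\<close> and \<open>\<epsilon>\<close>, whose transforms are \<open>exp (- \<epsilon> (\<xi> + s)) (L f)(\<xi> + s)\<close>. They
  converge pointwise to \<open>L f\<close>, so only a bound for their weighted norms by that of \<open>W f\<close> is missing
  (\<open>L2_close_of_pointwise_and_norm\<close>). The shift in the argument of \<open>L f\<close> amounts to replacing \<open>w(\<xi>)\<close> by
  \<open>w(\<xi> - s)\<close>. For \<open>q < 1\<close> this moves the singularity of \<open>w\<close> and may be bad for individual \<open>s\<close>, but the
  mean of \<open>w(\<xi> - s)\<close> over \<open>0 < s < \<delta>\<close> is at most a constant times \<open>w(\<xi>)\<close> and tends to \<open>w(\<xi>)\<close>, so good
  values of \<open>s\<close> exist (\<open>good_translation\<close>).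

  The operator of a densely defined closed form is self-adjoint by the representation theorem, which is
  proved here by minimisation (\<open>closed_form_resolvent\<close>, \<open>form_operator_self_adjoint\<close>). Its kernel
  consists of functions with \<open>L f = 0\<close> on \<open>(\<alpha>, \<infinity>)\<close>, and these vanish by uniqueness of the Laplace transform
  (\<open>laplace_injective\<close>).
\<close>

section \<open>Norm, scalar product and completeness of L2\<close>

lemma L2_measurable: "f \<in> L2 M \<Longrightarrow> f \<in> borel_measurable M"
  by (simp add: L2_def)

lemma L2_integrable: "f \<in> L2 M \<Longrightarrow> integrable M (\<lambda>x. (cmod (f x))\<^sup>2)"
  by (simp add: L2_def)

lemma L2_dominated:
  assumes "f \<in> borel_measurable M" "integrable M g" "\<And>x. x \<in> space M \<Longrightarrow> (cmod (f x))\<^sup>2 \<le> g x"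
  shows "f \<in> L2 M"
proof -
  have "integrable M (\<lambda>x. (cmod (f x))\<^sup>2)"
  proof (rule Bochner_Integration.integrable_bound[OF assms(2)])
    show "(\<lambda>x. (cmod (f x))\<^sup>2) \<in> borel_measurable M" using assms(1) by simp
    show "AE x in M. norm ((cmod (f x))\<^sup>2) \<le> norm (g x)"
    proof (rule AE_I2)
      fix x assume "x \<in> space M"
      from assms(3)[OF this] show "norm ((cmod (f x))\<^sup>2) \<le> norm (g x)"
        by (simp add: order_trans[OF _ abs_ge_self])
    qed
  qed
  then show ?thesis using assms(1) by (simp add: L2_def)
qed

lemma cmod_add_squared_le: "(cmod (a + b))\<^sup>2 \<le> 2 * (cmod a)\<^sup>2 + 2 * (cmod b)\<^sup>2"
proof -
  have "(cmod (a + b))\<^sup>2 \<le> (cmod a + cmod b)\<^sup>2"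
    by (intro power_mono norm_triangle_ineq) simp
  also have "\<dots> \<le> 2 * (cmod a)\<^sup>2 + 2 * (cmod b)\<^sup>2"
    using sum_squares_bound[of "cmod a" "cmod b"] by (simp add: power2_sum)
  finally show ?thesis .
qed

lemma L2_add: assumes "f \<in> L2 M" "g \<in> L2 M" shows "(\<lambda>x. f x + g x) \<in> L2 M"
  using L2_measurable[OF assms(1)] L2_measurable[OF assms(2)]
  by (intro L2_dominated[where g = "\<lambda>x. 2 * (cmod (f x))\<^sup>2 + 2 * (cmod (g x))\<^sup>2"])
     (auto intro!: cmod_add_squared_le Bochner_Integration.integrable_add integrable_mult_right
       L2_integrable assms)

lemma L2_cmult: assumes "f \<in> L2 M" shows "(\<lambda>x. c * f x) \<in> L2 M"
  using L2_measurable[OF assms]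
  by (intro L2_dominated[where g = "\<lambda>x. (cmod c)\<^sup>2 * (cmod (f x))\<^sup>2"])
     (auto simp: norm_mult power_mult_distrib intro!: integrable_mult_right L2_integrable assms)

lemma l2_subspace_L2: "l2_subspace M (L2 M)"
  unfolding l2_subspace_def
  by (intro conjI ballI allI subset_refl L2_add L2_cmult) (simp_all add: L2_def)

lemma l2_subspaceD:
  assumes "l2_subspace M D"
  shows l2_subspace_imp_L2: "f \<in> D \<Longrightarrow> f \<in> L2 M"
    and l2_subspace_zero: "(\<lambda>x. 0) \<in> D"
    and l2_subspace_add: "f \<in> D \<Longrightarrow> g \<in> D \<Longrightarrow> (\<lambda>x. f x + g x) \<in> D"
    and l2_subspace_mult: "f \<in> D \<Longrightarrow> (\<lambda>x. c * f x) \<in> D"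
  using assms unfolding l2_subspace_def by (simp_all add: subset_iff)

lemma l2_subspace_add_mult:
  "l2_subspace M D \<Longrightarrow> f \<in> D \<Longrightarrow> g \<in> D \<Longrightarrow> (\<lambda>x. f x + c * g x) \<in> D"
  by (intro l2_subspace_add l2_subspace_mult)

lemma l2_subspace_diff:
  "l2_subspace M D \<Longrightarrow> f \<in> D \<Longrightarrow> g \<in> D \<Longrightarrow> (\<lambda>x. f x - g x) \<in> D"
  using l2_subspace_add_mult[of M D f g "-1"] by simp

lemma L2_diff: "f \<in> L2 M \<Longrightarrow> g \<in> L2 M \<Longrightarrow> (\<lambda>x. f x - g x) \<in> L2 M"
  by (rule l2_subspace_diff[OF l2_subspace_L2])

lemma borel_measurable_cnj [measurable (raw)]:
  "f \<in> borel_measurable M \<Longrightarrow> (\<lambda>x. cnj (f x)) \<in> borel_measurable M"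
  by (rule measurable_compose[OF _ borel_measurable_continuous_onI]) (auto intro!: continuous_intros)

lemma L2_prod_integrable:
  assumes "f \<in> L2 M" "g \<in> L2 M" shows "integrable M (\<lambda>x. f x * cnj (g x))"
proof (rule Bochner_Integration.integrable_bound)
  show "integrable M (\<lambda>x. (cmod (f x))\<^sup>2 + (cmod (g x))\<^sup>2)"
    by (intro Bochner_Integration.integrable_add L2_integrable assms)
  show "(\<lambda>x. f x * cnj (g x)) \<in> borel_measurable M"
    using L2_measurable[OF assms(1)] L2_measurable[OF assms(2)] by measurable
  show "AE x in M. norm (f x * cnj (g x)) \<le> norm ((cmod (f x))\<^sup>2 + (cmod (g x))\<^sup>2)"
  proof (rule AE_I2)
    fix x show "norm (f x * cnj (g x)) \<le> norm ((cmod (f x))\<^sup>2 + (cmod (g x))\<^sup>2)"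
      using sum_squares_bound[of "cmod (f x)" "cmod (g x)"]
        mult_nonneg_nonneg[OF norm_ge_zero[of "f x"] norm_ge_zero[of "g x"]]
      unfolding norm_mult complex_mod_cnj real_norm_def by linarith
  qed
qed

lemma sesquilinear_on_l2_inner: "sesquilinear_on (L2 M) (l2_inner M)"
proof -
  have 1: "l2_inner M (\<lambda>x. u x + v x) w = l2_inner M u w + l2_inner M v w"
    if "u \<in> L2 M" "v \<in> L2 M" "w \<in> L2 M" for u v w
    unfolding l2_inner_def ring_distribs
    by (intro Bochner_Integration.integral_add L2_prod_integrable that)
  have 2: "l2_inner M w (\<lambda>x. u x + v x) = l2_inner M w u + l2_inner M w v"
    if "u \<in> L2 M" "v \<in> L2 M" "w \<in> L2 M" for u v w
    unfolding l2_inner_def ring_distribs complex_cnj_add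
    by (intro Bochner_Integration.integral_add L2_prod_integrable that)
  have 3: "l2_inner M (\<lambda>x. c * u x) v = c * l2_inner M u v" for c u v
    unfolding l2_inner_def mult.assoc by (rule integral_mult_right_zero)
  have 4: "l2_inner M u (\<lambda>x. c * v x) = cnj c * l2_inner M u v" for c u v
    unfolding l2_inner_def complex_cnj_mult mult.left_commute[of _ "cnj c"]
    by (rule integral_mult_right_zero)
  show ?thesis unfolding sesquilinear_on_def by (intro conjI ballI allI 1 2 3 4)
qed

lemma sesquilinear_on_subset: "sesquilinear_on D B \<Longrightarrow> D' \<subseteq> D \<Longrightarrow> sesquilinear_on D' B"
  unfolding sesquilinear_on_def by (simp add: subset_iff)

lemma l2_norm_squared: "(l2_norm M f)\<^sup>2 = (LINT x|M. (cmod (f x))\<^sup>2)"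
  by (simp add: l2_norm_def integral_nonneg_AE)

lemma l2_norm_nonneg: "0 \<le> l2_norm M f"
  by (simp add: l2_norm_def)

lemma l2_norm_tendsto_0I:
  assumes "(\<lambda>n. (l2_norm M (g n))\<^sup>2) \<longlonglongrightarrow> 0" shows "(\<lambda>n. l2_norm M (g n)) \<longlonglongrightarrow> 0"
  using tendsto_real_sqrt[OF assms] by (simp add: l2_norm_nonneg)

lemma l2_inner_self: "l2_inner M f f = of_real ((l2_norm M f)\<^sup>2)"
  unfolding l2_norm_squared l2_inner_def complex_norm_square[symmetric] of_real_power[symmetric]
  by (rule integral_complex_of_real)

lemma l2_inner_cnj: "cnj (l2_inner M f g) = l2_inner M g f"
  unfolding l2_inner_def Bochner_Integration.integral_cnj[symmetric] by (simp add: mult.commute)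

lemma l2_norm_eq_0_imp_AE:
  assumes "f \<in> L2 M" "l2_norm M f = 0" shows "AE x in M. f x = 0"
proof -
  have "(LINT x|M. (cmod (f x))\<^sup>2) = 0" using assms(2) l2_norm_squared[of M f] by simp
  then have "AE x in M. (cmod (f x))\<^sup>2 = 0"
    using integral_nonneg_eq_0_iff_AE[OF L2_integrable[OF assms(1)]] by simp
  then show ?thesis by simp
qed

lemma l2_inner_cong_AE:
  assumes "f \<in> L2 M" "f' \<in> L2 M" "g \<in> L2 M" "g' \<in> L2 M"
    "AE x in M. f x = f' x" "AE x in M. g x = g' x"
  shows "l2_inner M f g = l2_inner M f' g'"
  unfolding l2_inner_def
proof (rule integral_cong_AE)
  show "(\<lambda>x. f x * cnj (g x)) \<in> borel_measurable M"
    by (rule borel_measurable_integrable, rule L2_prod_integrable; fact)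
  show "(\<lambda>x. f' x * cnj (g' x)) \<in> borel_measurable M"
    by (rule borel_measurable_integrable, rule L2_prod_integrable; fact)
  show "AE x in M. f x * cnj (g x) = f' x * cnj (g' x)"
    using assms(5,6) by eventually_elim simp
qed

lemma l2_norm_cong_AE:
  assumes "f \<in> L2 M" "f' \<in> L2 M" "AE x in M. f x = f' x"
  shows "l2_norm M f = l2_norm M f'"
proof -
  have "(l2_norm M f)\<^sup>2 = (l2_norm M f')\<^sup>2"
    using l2_inner_cong_AE[OF assms(1,2,1,2,3,3)] unfolding l2_inner_self of_real_eq_iff .
  then show ?thesis by (rule power2_eq_imp_eq) (rule l2_norm_nonneg)+
qed

lemma l2_norm_add_squared_le:
  assumes "f \<in> L2 M" "g \<in> L2 M"
  shows "(l2_norm M (\<lambda>x. f x + g x))\<^sup>2 \<le> 2 * (l2_norm M f)\<^sup>2 + 2 * (l2_norm M g)\<^sup>2"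
proof -
  have "(LINT x|M. (cmod (f x + g x))\<^sup>2) \<le> (LINT x|M. 2 * (cmod (f x))\<^sup>2 + 2 * (cmod (g x))\<^sup>2)"
    using L2_integrable[OF assms(1)] L2_integrable[OF assms(2)] L2_integrable[OF L2_add[OF assms]]
    by (intro integral_mono cmod_add_squared_le) auto
  also have "\<dots> = 2 * (LINT x|M. (cmod (f x))\<^sup>2) + 2 * (LINT x|M. (cmod (g x))\<^sup>2)"
    using L2_integrable[OF assms(1)] L2_integrable[OF assms(2)] by simp
  finally show ?thesis by (simp add: l2_norm_squared)
qed

text \<open>
  Fatou's lemma for Bochner integrals: it carries norm estimates over to limits that are only known
  pointwise.
\<close>

lemma Fatou_integral_bound:
  fixes g :: "nat \<Rightarrow> 'a \<Rightarrow> real"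
  assumes int: "\<And>j. integrable M (g j)" and nn: "\<And>j x. 0 \<le> g j x"
    and G: "G \<in> borel_measurable M" and lim: "AE x in M. (\<lambda>j. g j x) \<longlonglongrightarrow> G x"
    and bd: "eventually (\<lambda>j. (LINT x|M. g j x) \<le> e) sequentially"
  shows "integrable M G" "(LINT x|M. G x) \<le> e"
proof -
  have Gnn: "AE x in M. (0::real) \<le> G x"
    using lim by eventually_elim (rule LIMSEQ_le_const, assumption, simp add: nn)
  obtain j where "(LINT x|M. g j x) \<le> e" using eventually_happens[OF bd] by auto
  then have e: "0 \<le> e" using integral_nonneg_AE[OF AE_I2, of M "g j", OF nn] by linarith
  have "(\<integral>\<^sup>+x. ennreal (G x) \<partial>M) = (\<integral>\<^sup>+x. liminf (\<lambda>j. ennreal (g j x)) \<partial>M)"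
  proof (rule nn_integral_cong_AE)
    show "AE x in M. ennreal (G x) = liminf (\<lambda>j. ennreal (g j x))"
      using lim
    proof eventually_elim
      case (elim x)
      then have "(\<lambda>j. ennreal (g j x)) \<longlonglongrightarrow> ennreal (G x)" by (rule tendsto_ennrealI)
      then show ?case by (intro lim_imp_Liminf[symmetric]) auto
    qed
  qed
  also have "\<dots> \<le> liminf (\<lambda>j. \<integral>\<^sup>+x. ennreal (g j x) \<partial>M)"
    using borel_measurable_integrable[OF int] by (intro nn_integral_liminf) measurable
  also have "\<dots> = liminf (\<lambda>j. ennreal (LINT x|M. g j x))"
    by (subst nn_integral_eq_integral[OF int]) (auto simp: nn)
  also have "\<dots> \<le> limsup (\<lambda>j. ennreal (LINT x|M. g j x))"
    by (rule Liminf_le_Limsup) simp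
  also have "\<dots> \<le> ennreal e"
    by (rule Limsup_bounded) (use bd in \<open>auto elim!: eventually_mono intro: ennreal_leI\<close>)
  finally have *: "(\<integral>\<^sup>+x. ennreal (G x) \<partial>M) \<le> ennreal e" .
  show 1: "integrable M G"
    by (rule integrableI_nonneg[OF G Gnn]) (use * in \<open>auto simp: top_unique less_top intro: le_less_trans\<close>)
  show "(LINT x|M. G x) \<le> e"
    using * nn_integral_eq_integral[OF 1 Gnn] e by simp
qed

text \<open>
  A subsequence whose increments decay geometrically in norm converges almost everywhere; by Fatou's
  lemma its pointwise limit is the limit of the whole sequence in norm.
\<close>

lemma L2_complete:
  assumes u: "\<And>n. u n \<in> L2 M"
    and cauchy: "\<And>e. e > 0 \<Longrightarrow> \<exists>N. \<forall>m\<ge>N. \<forall>n\<ge>N. (l2_norm M (\<lambda>x. u m x - u n x))\<^sup>2 < e"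
  obtains f where "f \<in> L2 M" "(\<lambda>n. l2_norm M (\<lambda>x. u n x - f x)) \<longlonglongrightarrow> 0"
proof -
  have "\<exists>N. \<forall>m\<ge>N. \<forall>n\<ge>N. (l2_norm M (\<lambda>x. u m x - u n x))\<^sup>2 < (1/8)^j" for j :: nat
    by (rule cauchy) simp
  then obtain N where N: "\<And>j m n. m \<ge> N j \<Longrightarrow> n \<ge> N j \<Longrightarrow> (l2_norm M (\<lambda>x. u m x - u n x))\<^sup>2 < (1/8)^j"
    by metis
  define K where "K j = j + (\<Sum>i\<le>j. N i)" for j
  have KN: "N j \<le> K j" for j
    unfolding K_def by (rule trans_le_add2, rule member_le_sum) auto
  have Kmono: "K j \<le> K (Suc j)" for j by (simp add: K_def)
  define w where "w j = u (K j)" for j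
  have w: "w j \<in> L2 M" for j by (simp add: w_def u)
  have wm[measurable]: "w j \<in> borel_measurable M" for j using w by (rule L2_measurable)
  have um[measurable]: "u j \<in> borel_measurable M" for j using u by (rule L2_measurable)
  define a where "a j x = (cmod (w (Suc j) x - w j x))\<^sup>2" for j x
  have am[measurable]: "a j \<in> borel_measurable M" for j unfolding a_def by measurable
  have aint: "integrable M (a j)" for j unfolding a_def by (rule L2_integrable[OF L2_diff[OF w w]])
  have ann: "0 \<le> a j x" for j x by (simp add: a_def)
  have abd: "(LINT x|M. a j x) \<le> (1/8)^j" for j
    using N[of j "K (Suc j)" "K j"] KN[of j] Kmono[of j]
    unfolding a_def w_def l2_norm_squared by linarith
  \<comment> \<open>The weights \<open>2^j\<close> turn square summability of the increments into absolute summability.\<close>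
  have "(\<integral>\<^sup>+x. (\<Sum>j. ennreal (2^j * a j x)) \<partial>M) = (\<Sum>j. \<integral>\<^sup>+x. ennreal (2^j * a j x) \<partial>M)"
    by (intro nn_integral_suminf) measurable
  also have "\<dots> \<le> (\<Sum>j. ennreal ((1/4)^j))"
  proof (intro suminf_le)
    fix j
    have "(\<integral>\<^sup>+x. ennreal (2^j * a j x) \<partial>M) = ennreal (LINT x|M. 2^j * a j x)"
      by (rule nn_integral_eq_integral) (auto simp: ann aint)
    also have "\<dots> \<le> ennreal ((1/4)^j)"
    proof (rule ennreal_leI)
      have "2^j * (LINT x|M. a j x) \<le> 2^j * (1/8)^j" using abd[of j] by simp
      also have "\<dots> = (1/4)^j" by (simp flip: power_mult_distrib)
      finally show "(LINT x|M. 2^j * a j x) \<le> (1/4)^j" by simp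
    qed
    finally show "(\<integral>\<^sup>+x. ennreal (2^j * a j x) \<partial>M) \<le> ennreal ((1/4)^j)" .
  qed auto
  also have "\<dots> = ennreal (\<Sum>j. (1/4)^j)"
    by (rule suminf_ennreal2) (auto intro!: summable_geometric)
  also have "\<dots> < \<infinity>" by simp
  finally have "AE x in M. (\<Sum>j. ennreal (2^j * a j x)) \<noteq> \<infinity>"
    by (intro nn_integral_PInf_AE) auto
  then have conv: "AE x in M. convergent (\<lambda>j. w j x)"
  proof eventually_elim
    case (elim x)
    have s1: "summable (\<lambda>j. 2^j * a j x)"
      by (rule summable_suminf_not_top) (use elim ann in auto)
    have s2: "summable (\<lambda>j. (1/2::real)^j)" by (rule summable_geometric) simp
    have "summable (\<lambda>j. w (Suc j) x - w j x)"
    proof (rule summable_comparison_test')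
      show "summable (\<lambda>j. (1/2::real)^j + 2^j * a j x)" by (rule summable_add[OF s2 s1])
      fix j :: nat
      define b where "b = cmod (w (Suc j) x - w j x)"
      define p where "p = (2::real)^j"
      have p: "p > 0" by (simp add: p_def)
      have "0 \<le> (1 - p * b)\<^sup>2" by simp
      then have "2 * p * b \<le> 1 + p\<^sup>2 * b\<^sup>2" by (simp add: power2_diff power_mult_distrib)
      then have "2 * b \<le> 1 / p + p * b\<^sup>2"
        using p by (simp add: field_simps power2_eq_square)
      moreover have "0 \<le> b" by (simp add: b_def)
      ultimately have "b \<le> 1/p + p * b\<^sup>2" by linarith
      then show "norm (w (Suc j) x - w j x) \<le> (1/2)^j + 2^j * a j x"
        by (simp add: a_def b_def p_def power_one_over)
    qed
    then have "convergent (\<lambda>n. \<Sum>j<n. w (Suc j) x - w j x)" by (simp add: summable_iff_convergent)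
    then have "convergent (\<lambda>n. w n x - w 0 x)" by (simp only: sum_lessThan_telescope[of "\<lambda>j. w j x"])
    then show ?case by (simp add: convergent_diff_const_right_iff)
  qed
  define f where "f x = lim (\<lambda>j. w j x)" for x
  have fm[measurable]: "f \<in> borel_measurable M" unfolding f_def by measurable
  have lim: "AE x in M. (\<lambda>j. w j x) \<longlonglongrightarrow> f x"
    using conv by eventually_elim (simp add: f_def convergent_LIMSEQ_iff)
  have bound: "integrable M (\<lambda>x. (cmod (u n x - f x))\<^sup>2)" "(LINT x|M. (cmod (u n x - f x))\<^sup>2) \<le> e"
    if "\<forall>m\<ge>n0. (l2_norm M (\<lambda>x. u n x - u m x))\<^sup>2 < e" for n n0 e
  proof -
    have i: "integrable M (\<lambda>x. (cmod (u n x - w j x))\<^sup>2)" for j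
      by (rule L2_integrable[OF L2_diff[OF u w]])
    have l: "AE x in M. (\<lambda>j. (cmod (u n x - w j x))\<^sup>2) \<longlonglongrightarrow> (cmod (u n x - f x))\<^sup>2"
      using lim by eventually_elim (intro tendsto_intros)
    have "eventually (\<lambda>j. (LINT x|M. (cmod (u n x - w j x))\<^sup>2) \<le> e) sequentially"
    proof (rule eventually_sequentiallyI)
      fix j assume "n0 \<le> j"
      then have "n0 \<le> K j" by (simp add: K_def)
      then show "(LINT x|M. (cmod (u n x - w j x))\<^sup>2) \<le> e"
        using that unfolding w_def l2_norm_squared by force
    qed
    from Fatou_integral_bound[OF i _ _ l this]
    show "integrable M (\<lambda>x. (cmod (u n x - f x))\<^sup>2)" "(LINT x|M. (cmod (u n x - f x))\<^sup>2) \<le> e" by auto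
  qed
  obtain n0 where n0: "\<forall>m\<ge>n0. \<forall>n\<ge>n0. (l2_norm M (\<lambda>x. u m x - u n x))\<^sup>2 < 1"
    using cauchy[of 1] by auto
  then have "(\<lambda>x. u n0 x - f x) \<in> L2 M"
    using bound(1)[of n0 n0 1] by (simp add: L2_def)
  then have "(\<lambda>x. u n0 x - (u n0 x - f x)) \<in> L2 M" by (rule L2_diff[OF u])
  then have fL: "f \<in> L2 M" by simp
  have "(\<lambda>n. (l2_norm M (\<lambda>x. u n x - f x))\<^sup>2) \<longlonglongrightarrow> 0"
  proof (rule LIMSEQ_I)
    fix e :: real assume "e > 0"
    then obtain N0 where "\<forall>m\<ge>N0. \<forall>n\<ge>N0. (l2_norm M (\<lambda>x. u m x - u n x))\<^sup>2 < e / 2"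
      using cauchy[of "e/2"] by auto
    then have "\<forall>n\<ge>N0. (LINT x|M. (cmod (u n x - f x))\<^sup>2) \<le> e/2" using bound(2) by blast
    then show "\<exists>no. \<forall>n\<ge>no. norm ((l2_norm M (\<lambda>x. u n x - f x))\<^sup>2 - 0) < e"
      using \<open>e > 0\<close> unfolding l2_norm_squared[symmetric]
      by (intro exI[of _ N0] allI impI) (simp add: order.strict_trans1[where b = "e/2"])
  qed
  then have "(\<lambda>n. l2_norm M (\<lambda>x. u n x - f x)) \<longlonglongrightarrow> 0"
    by (rule l2_norm_tendsto_0I)
  with fL show ?thesis by (rule that)
qed

section \<open>Nonnegative sesquilinear forms\<close>

text \<open>
  Positive semidefinite forms on a subspace: both a given form and its sum with a multiple of the
  scalar product are of this kind.
\<close>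

definition semi_inner ::
  "'a measure \<Rightarrow> ('a \<Rightarrow> complex) set \<Rightarrow> (('a \<Rightarrow> complex) \<Rightarrow> ('a \<Rightarrow> complex) \<Rightarrow> complex) \<Rightarrow> bool" where
  "semi_inner M D B \<longleftrightarrow>
     l2_subspace M D \<and> sesquilinear_on D B \<and> (\<forall>u\<in>D. B u u \<in> \<real> \<and> 0 \<le> Re (B u u))"

lemma semi_innerD:
  assumes "semi_inner M D B"
  shows semi_inner_subspace: "l2_subspace M D"
    and semi_inner_sesquilinear: "sesquilinear_on D B"
    and semi_inner_real: "u \<in> D \<Longrightarrow> B u u \<in> \<real>"
    and semi_inner_nonneg: "u \<in> D \<Longrightarrow> 0 \<le> Re (B u u)"
  using assms by (auto simp: semi_inner_def)

lemma sesquilinear_onD: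
  assumes "sesquilinear_on D B"
  shows sesquilinear_add_left: "u \<in> D \<Longrightarrow> v \<in> D \<Longrightarrow> w \<in> D \<Longrightarrow> B (\<lambda>x. u x + v x) w = B u w + B v w"
    and sesquilinear_add_right: "u \<in> D \<Longrightarrow> v \<in> D \<Longrightarrow> w \<in> D \<Longrightarrow> B w (\<lambda>x. u x + v x) = B w u + B w v"
    and sesquilinear_mult_left: "u \<in> D \<Longrightarrow> v \<in> D \<Longrightarrow> B (\<lambda>x. c * u x) v = c * B u v"
    and sesquilinear_mult_right: "u \<in> D \<Longrightarrow> v \<in> D \<Longrightarrow> B u (\<lambda>x. c * v x) = cnj c * B u v"
  using assms unfolding sesquilinear_on_def by simp_all

lemma sesquilinear_add_mult_left:
  assumes "sesquilinear_on D B" "l2_subspace M D" "u \<in> D" "v \<in> D" "w \<in> D"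
  shows "B (\<lambda>x. u x + c * v x) w = B u w + c * B v w"
  using sesquilinear_add_left[OF assms(1,3) l2_subspace_mult[OF assms(2,4)] assms(5)]
    sesquilinear_mult_left[OF assms(1,4,5)] by simp

lemma sesquilinear_add_mult_right:
  assumes "sesquilinear_on D B" "l2_subspace M D" "u \<in> D" "v \<in> D" "w \<in> D"
  shows "B w (\<lambda>x. u x + c * v x) = B w u + cnj c * B w v"
  using sesquilinear_add_right[OF assms(1,3) l2_subspace_mult[OF assms(2,4)] assms(5)]
    sesquilinear_mult_right[OF assms(1,5,4)] by simp

lemma sesquilinear_diff_left:
  assumes "sesquilinear_on D B" "l2_subspace M D" "u \<in> D" "v \<in> D" "w \<in> D"
  shows "B (\<lambda>x. u x - v x) w = B u w - B v w"
  using sesquilinear_add_mult_left[OF assms, of "-1"] by simp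

lemma sesquilinear_diff_right:
  assumes "sesquilinear_on D B" "l2_subspace M D" "u \<in> D" "v \<in> D" "w \<in> D"
  shows "B w (\<lambda>x. u x - v x) = B w u - B w v"
  using sesquilinear_add_mult_right[OF assms, of "-1"] by simp

lemma sesquilinear_expand:
  assumes "sesquilinear_on D B" "l2_subspace M D" "u \<in> D" "v \<in> D"
  shows "B (\<lambda>x. u x + c * v x) (\<lambda>x. u x + c * v x)
    = B u u + c * B v u + cnj c * B u v + c * cnj c * B v v"
  using sesquilinear_add_mult_left[OF assms l2_subspace_add_mult[OF assms(2-4), of c], of c]
    sesquilinear_add_mult_right[OF assms assms(3), of c]
    sesquilinear_add_mult_right[OF assms assms(4), of c]
  by (simp add: algebra_simps)

text \<open>
  Since \<open>B w w\<close> is real for \<open>w = u + c v\<close>, so is \<open>c B v u + cnj c B u v\<close>; take \<open>c = 1\<close> and \<open>c = \<i>\<close>.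
\<close>

lemma semi_inner_hermitian:
  assumes "semi_inner M D B" "u \<in> D" "v \<in> D"
  shows "B v u = cnj (B u v)"
proof -
  note D = semi_innerD[OF assms(1)]
  have real: "c * B v u + cnj c * B u v \<in> \<real>" for c
  proof -
    have "B (\<lambda>x. u x + c * v x) (\<lambda>x. u x + c * v x) \<in> \<real>"
      by (intro D(3) l2_subspace_add_mult[OF D(1)] assms)
    moreover have "c * cnj c * B v v \<in> \<real>"
      using D(3)[OF assms(3)] by (metis Reals_mult Reals_of_real complex_norm_square)
    ultimately have "B (\<lambda>x. u x + c * v x) (\<lambda>x. u x + c * v x) - B u u - c * cnj c * B v v \<in> \<real>"
      by (intro Reals_diff D(3)[OF assms(2)])
    then show ?thesis unfolding sesquilinear_expand[OF D(2,1) assms(2,3)] by simp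
  qed
  show ?thesis using real[of 1] real[of \<i>]
    by (simp add: complex_is_Real_iff complex_eq_iff)
qed

text \<open>Insert the minimiser \<open>z = - b / d\<close>; if \<open>d = 0\<close>, a large multiple of \<open>- b\<close> shows \<open>b = 0\<close>.\<close>

lemma nonneg_quadratic_imp_discriminant:
  fixes b :: complex and a d :: real
  assumes nonneg: "\<And>z. 0 \<le> a + 2 * Re (cnj z * b) + (cmod z)\<^sup>2 * d" and "0 \<le> d"
  shows "(cmod b)\<^sup>2 \<le> a * d"
proof -
  have q: "0 \<le> a - 2 * t * (cmod b)\<^sup>2 + t\<^sup>2 * (cmod b)\<^sup>2 * d" for t :: real
  proof -
    have "Re (cnj (- of_real t * b) * b) = - t * (cmod b)\<^sup>2"
      unfolding cmod_power2 by (simp add: power2_eq_square algebra_simps)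
    then show ?thesis using nonneg[of "- of_real t * b"]
      by (simp add: norm_mult power_mult_distrib)
  qed
  show ?thesis
  proof (cases "d = 0")
    case True
    have "cmod b = 0"
    proof (rule ccontr)
      assume "cmod b \<noteq> 0"
      then show False using q[of "(a + 1) / (2 * (cmod b)\<^sup>2)"] True by (simp add: field_simps)
    qed
    then show ?thesis using True by simp
  next
    case False
    then have "0 \<le> a - (cmod b)\<^sup>2 / d"
      using q[of "1 / d"] by (simp add: power2_eq_square field_simps)
    then show ?thesis using False \<open>0 \<le> d\<close> by (simp add: field_simps)
  qed
qed

lemma semi_inner_add_mult_Re:
  assumes "semi_inner M D B" "u \<in> D" "v \<in> D"
  shows "Re (B (\<lambda>x. u x + c * v x) (\<lambda>x. u x + c * v x))
    = Re (B u u) + 2 * Re (cnj c * B u v) + (cmod c)\<^sup>2 * Re (B v v)"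
proof -
  note D = semi_innerD[OF assms(1)]
  have "Re (c * cnj c * B v v) = (cmod c)\<^sup>2 * Re (B v v)"
    unfolding complex_norm_square[symmetric] by (simp flip: of_real_power)
  moreover have "Re (c * B v u) = Re (cnj c * B u v)"
    using semi_inner_hermitian[OF assms] by simp
  ultimately show ?thesis unfolding sesquilinear_expand[OF D(2,1) assms(2,3)] by simp
qed

lemma semi_inner_Cauchy_Schwarz:
  assumes "semi_inner M D B" "u \<in> D" "v \<in> D"
  shows "(cmod (B u v))\<^sup>2 \<le> Re (B u u) * Re (B v v)"
proof (rule nonneg_quadratic_imp_discriminant)
  note D = semi_innerD[OF assms(1)]
  show "0 \<le> Re (B v v)" by (intro D(4) assms)
  fix z show "0 \<le> Re (B u u) + 2 * Re (cnj z * B u v) + (cmod z)\<^sup>2 * Re (B v v)"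
    unfolding semi_inner_add_mult_Re[OF assms, symmetric]
    by (intro D(4) l2_subspace_add_mult[OF D(1)] assms)
qed

lemma semi_inner_eq_complex_Re: "semi_inner M D B \<Longrightarrow> u \<in> D \<Longrightarrow> B u u = of_real (Re (B u u))"
  by (simp add: semi_inner_real of_real_Re)

lemma semi_inner_l2_inner: "semi_inner M (L2 M) (l2_inner M)"
  unfolding semi_inner_def
  by (simp add: l2_subspace_L2 sesquilinear_on_l2_inner l2_inner_self del: of_real_power)

lemma semi_inner_subset:
  "semi_inner M D B \<Longrightarrow> l2_subspace M D' \<Longrightarrow> D' \<subseteq> D \<Longrightarrow> semi_inner M D' B"
  unfolding semi_inner_def by (auto intro: sesquilinear_on_subset)

lemma semi_inner_add_mult:
  assumes "semi_inner M D B" "semi_inner M D B'" "0 \<le> c"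
  shows "semi_inner M D (\<lambda>u v. B u v + complex_of_real c * B' u v)"
proof -
  note D = semi_innerD[OF assms(1)] and D' = semi_innerD[OF assms(2)]
  have "sesquilinear_on D (\<lambda>u v. B u v + complex_of_real c * B' u v)"
    unfolding sesquilinear_on_def
    by (simp add: sesquilinear_onD[OF D(2)] sesquilinear_onD[OF D'(2)] algebra_simps)
  then show ?thesis
    unfolding semi_inner_def using D D' assms(3) by (auto intro!: Reals_add Reals_mult)
qed

lemma L2_Cauchy_Schwarz:
  assumes "f \<in> L2 M" "g \<in> L2 M"
  shows "cmod (l2_inner M f g) \<le> l2_norm M f * l2_norm M g"
proof (rule power2_le_imp_le)
  show "(cmod (l2_inner M f g))\<^sup>2 \<le> (l2_norm M f * l2_norm M g)\<^sup>2"
    using semi_inner_Cauchy_Schwarz[OF semi_inner_l2_inner assms]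
    by (simp add: l2_inner_self power_mult_distrib del: of_real_power)
  show "0 \<le> l2_norm M f * l2_norm M g" by (intro mult_nonneg_nonneg l2_norm_nonneg)
qed

lemma l2_norm_sub_commute: "l2_norm M (\<lambda>x. f x - g x) = l2_norm M (\<lambda>x. g x - f x)"
  unfolding l2_norm_def by (simp add: norm_minus_commute)

lemma semi_inner_zero:
  assumes "semi_inner M D B" shows "B (\<lambda>x. 0) (\<lambda>x. 0) = 0"
proof -
  note z = l2_subspace_zero[OF semi_inner_subspace[OF assms]]
  show ?thesis using sesquilinear_mult_left[OF semi_inner_sesquilinear[OF assms] z z, of 0] by simp
qed

lemma nonneg_form_obtain_semi_inner:
  assumes "nonneg_form M D Q"
  obtains B where "semi_inner M D B" "\<forall>u\<in>D. Q u = B u u"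
  using assms unfolding nonneg_form_def semi_inner_def by metis

lemma nonneg_form_cong_AE:
  assumes "nonneg_form M D Q" "u \<in> D" "v \<in> D" "AE x in M. u x = v x"
  shows "Q u = Q v"
proof -
  have "\<forall>u\<in>D. \<forall>v\<in>D. (AE x in M. u x = v x) \<longrightarrow> Q u = Q v"
    using assms(1) unfolding nonneg_form_def by (elim conjE)
  from this[rule_format, OF assms(2-4)] show ?thesis .
qed

lemma form_polar_eq:
  assumes "semi_inner M D B" "\<forall>u\<in>D. Q u = B u u" "u \<in> D" "v \<in> D"
  shows "form_polar Q u v = B u v"
proof -
  note D = semi_innerD[OF assms(1)]
  have Q: "Q (\<lambda>x. u x + c * v x) = B u u + c * B v u + cnj c * B u v + c * cnj c * B v v" for c
    using sesquilinear_expand[OF D(2,1) assms(3,4)] assms(2)[rule_format, OF l2_subspace_add_mult[OF D(1) assms(3,4)]]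
    by simp
  have *: "Q (\<lambda>x. u x + v x) = B u u + B v u + B u v + B v v"
    "Q (\<lambda>x. u x - v x) = B u u - B v u - B u v + B v v"
    "Q (\<lambda>x. u x + \<i> * v x) = B u u + \<i> * B v u - \<i> * B u v + B v v"
    "Q (\<lambda>x. u x - \<i> * v x) = B u u - \<i> * B v u + \<i> * B u v + B v v"
    using Q[of 1] Q[of "-1"] Q[of \<i>] Q[of "-\<i>"] by simp_all
  show ?thesis unfolding form_polar_def * by (simp add: algebra_simps)
qed

section \<open>The self-adjoint operator of a closed form\<close>

text \<open>
  The functional \<open>J w = E[w] - 2 Re (g, w)\<close> is bounded below. By the parallelogram law a minimising
  sequence is Cauchy for \<open>E\<close>, and its limit satisfies the Euler-Lagrange equation. The equation holds
  approximately along the sequence already, because \<open>J\<close> restricted to a line is a quadratic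
  polynomial whose discriminant is controlled by the distance to the infimum.
\<close>

lemma closed_form_resolvent:
  assumes closed: "closed_form M D Q" and B: "semi_inner M D B" "\<forall>u\<in>D. Q u = B u u"
    and c: "0 < c" and g: "g \<in> L2 M"
  obtains u where "u \<in> D" "\<And>v. v \<in> D \<Longrightarrow> B u v + complex_of_real c * l2_inner M u v = l2_inner M g v"
proof -
  note D = semi_innerD[OF B(1)]
  have DL: "D \<subseteq> L2 M" using D(1) by (simp add: l2_subspace_def)
  have IP: "semi_inner M D (l2_inner M)" by (rule semi_inner_subset[OF semi_inner_l2_inner D(1) DL])
  define E where "E u v = B u v + complex_of_real c * l2_inner M u v" for u v
  have SE: "semi_inner M D E"
    unfolding E_def by (rule semi_inner_add_mult[OF B(1) IP]) (use c in simp)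
  have E_eq: "Re (E u u) = Re (B u u) + c * (l2_norm M u)\<^sup>2" for u
    unfolding E_def l2_inner_self by simp
  have EB: "Re (B u u) \<le> Re (E u u)" for u using c by (simp add: E_eq)
  have EL: "c * (l2_norm M u)\<^sup>2 \<le> Re (E u u)" if "u \<in> D" for u using D(4)[OF that] by (simp add: E_eq)
  define J where "J w = Re (E w w) - 2 * Re (l2_inner M g w)" for w
  have J_expand: "J (\<lambda>x. u x + z * v x)
     = J u + 2 * Re (cnj z * (E u v - l2_inner M g v)) + (cmod z)\<^sup>2 * Re (E v v)"
    if "u \<in> D" "v \<in> D" for u v z
    unfolding J_def semi_inner_add_mult_Re[OF SE that]
      sesquilinear_add_mult_right[OF sesquilinear_on_l2_inner l2_subspace_L2 subsetD[OF DL that(1)] subsetD[OF DL that(2)] g]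
    by (simp add: algebra_simps)
  have J_bdd: "- (l2_norm M g)\<^sup>2 / c \<le> J w" if "w \<in> D" for w
  proof -
    have "0 \<le> Re (l2_inner M (\<lambda>x. g x + (- of_real c) * w x) (\<lambda>x. g x + (- of_real c) * w x))"
      unfolding l2_inner_self by simp
    also have "\<dots> = (l2_norm M g)\<^sup>2 - 2 * c * Re (l2_inner M g w) + c\<^sup>2 * (l2_norm M w)\<^sup>2"
      unfolding semi_inner_add_mult_Re[OF semi_inner_l2_inner g subsetD[OF DL that]]
      by (simp add: l2_inner_self)
    also have "\<dots> \<le> (l2_norm M g)\<^sup>2 + c * J w"
      using EL[OF that] c by (simp add: J_def algebra_simps power2_eq_square)
    finally show ?thesis using c by (simp add: field_simps)
  qed
  define I where "I = Inf (J ` D)"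
  have bdd: "bdd_below (J ` D)" using J_bdd by (auto intro!: bdd_belowI)
  have ne: "J ` D \<noteq> {}" using l2_subspace_zero[OF D(1)] by blast
  have I: "I \<le> J w" if "w \<in> D" for w unfolding I_def by (rule cInf_lower[OF _ bdd]) (use that in blast)
  have "\<exists>u\<in>D. J u < I + 1 / real (Suc n)" for n
    using cInf_lessD[OF ne, of "I + 1 / real (Suc n)"] by (auto simp: I_def)
  then obtain u where u: "\<And>n. u n \<in> D" and Ju: "\<And>n. J (u n) < I + 1 / real (Suc n)" by metis
  have diffD: "(\<lambda>x. a x - b x) \<in> D" if "a \<in> D" "b \<in> D" for a b
    by (rule l2_subspace_diff[OF D(1) that])
  have par: "Re (E (\<lambda>x. u m x - u n x) (\<lambda>x. u m x - u n x)) \<le> 2 / real (Suc m) + 2 / real (Suc n)" for m n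
  proof -
    define v where "v = (\<lambda>x. u m x - u n x)"
    have v: "v \<in> D" unfolding v_def by (rule diffD[OF u u])
    have "J (\<lambda>x. u n x + 1 * v x) = J (u m)" by (simp add: v_def)
    then have 1: "J (u m) = J (u n) + 2 * Re (E (u n) v - l2_inner M g v) + Re (E v v)"
      using J_expand[OF u v, of n 1] by simp
    have "J (\<lambda>x. u n x + 1/2 * v x) = J (u n) + Re (E (u n) v - l2_inner M g v) + Re (E v v) / 4"
      using J_expand[OF u v, of n "1/2"] by (simp add: power2_eq_square norm_divide)
    moreover have "I \<le> J (\<lambda>x. u n x + 1/2 * v x)" by (intro I l2_subspace_add_mult[OF D(1)] u v)
    ultimately have "Re (E v v) \<le> 2 * (J (u m) - I) + 2 * (J (u n) - I)" using 1 by simp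
    moreover have "2 / real (Suc k) = 2 * (1 / real (Suc k))" for k by simp
    ultimately show ?thesis using Ju[of m] Ju[of n] unfolding v_def[symmetric] by (smt (verit))
  qed
  have E_Cauchy: "\<exists>N. \<forall>m\<ge>N. \<forall>n\<ge>N. Re (E (\<lambda>x. u m x - u n x) (\<lambda>x. u m x - u n x)) < e" if "e > 0" for e
  proof -
    obtain N where N: "4 / e < real N" using reals_Archimedean2 by blast
    have b: "2 / real (Suc n) < e / 2" if "n \<ge> N" for n
    proof -
      have "4 / e < real (Suc n)" using N that by linarith
      then show ?thesis using \<open>e > 0\<close> by (simp add: field_simps)
    qed
    show ?thesis
    proof (intro exI[of _ N] allI impI)
      fix m n assume "N \<le> m" "N \<le> n"
      then show "Re (E (\<lambda>x. u m x - u n x) (\<lambda>x. u m x - u n x)) < e"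
        using par[of m n] b[of m] b[of n] by linarith
    qed
  qed
  have "\<exists>N. \<forall>m\<ge>N. \<forall>n\<ge>N. (l2_norm M (\<lambda>x. u m x - u n x))\<^sup>2 < e" if e: "e > 0" for e
  proof -
    obtain N where N: "\<forall>m\<ge>N. \<forall>n\<ge>N. Re (E (\<lambda>x. u m x - u n x) (\<lambda>x. u m x - u n x)) < c * e"
      using E_Cauchy[OF mult_pos_pos[OF c e]] by blast
    show ?thesis
    proof (intro exI[of _ N] allI impI)
      fix m n assume "N \<le> m" "N \<le> n"
      then have "c * (l2_norm M (\<lambda>x. u m x - u n x))\<^sup>2 < c * e"
        using EL[OF diffD[OF u u], of m n] N by (meson le_less_trans)
      then show "(l2_norm M (\<lambda>x. u m x - u n x))\<^sup>2 < e" using c by simp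
    qed
  qed
  then obtain f where f: "f \<in> L2 M" "(\<lambda>n. l2_norm M (\<lambda>x. u n x - f x)) \<longlonglongrightarrow> 0"
    using L2_complete[of u M] u DL by blast
  have Qabs: "cmod (Q w) = Re (B w w)" if "w \<in> D" for w
    using semi_inner_eq_complex_Re[OF B(1) that] D(4)[OF that] B(2)[rule_format, OF that]
    by (metis abs_of_nonneg norm_of_real)
  have "form_converges M D Q u f"
    unfolding form_converges_def
  proof (intro conjI allI impI u f)
    fix e :: real assume "e > 0"
    then obtain N where "\<forall>m\<ge>N. \<forall>n\<ge>N. Re (E (\<lambda>x. u m x - u n x) (\<lambda>x. u m x - u n x)) < e"
      using E_Cauchy by blast
    then show "\<exists>N. \<forall>m\<ge>N. \<forall>n\<ge>N. cmod (Q (\<lambda>x. u m x - u n x)) < e"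
      unfolding Qabs[OF diffD[OF u u]] using EB le_less_trans by blast
  qed
  with closed have fD: "f \<in> D" and Qf: "(\<lambda>n. Q (\<lambda>x. u n x - f x)) \<longlonglongrightarrow> 0"
    unfolding closed_form_def by blast+
  have "(\<lambda>n. Re (Q (\<lambda>x. u n x - f x)) + c * (l2_norm M (\<lambda>x. u n x - f x))\<^sup>2) \<longlonglongrightarrow> Re 0 + c * 0\<^sup>2"
    by (intro tendsto_intros Qf f)
  then have Ef: "(\<lambda>n. Re (E (\<lambda>x. u n x - f x) (\<lambda>x. u n x - f x))) \<longlonglongrightarrow> 0"
    unfolding B(2)[rule_format, OF diffD[OF u fD]] E_eq by simp
  show ?thesis
  proof (rule that[OF fD])
    fix v assume v: "v \<in> D"
    have EL1: "(cmod (E (u n) v - l2_inner M g v))\<^sup>2 \<le> 1 / real (Suc n) * Re (E v v)" for n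
    proof (rule nonneg_quadratic_imp_discriminant)
      show "0 \<le> Re (E v v)" by (rule semi_inner_nonneg[OF SE v])
      fix z
      have "I \<le> J (\<lambda>x. u n x + z * v x)" by (intro I l2_subspace_add_mult[OF D(1)] u v)
      then show "0 \<le> 1 / real (Suc n) + 2 * Re (cnj z * (E (u n) v - l2_inner M g v)) + (cmod z)\<^sup>2 * Re (E v v)"
        unfolding J_expand[OF u v] using Ju[of n] by linarith
    qed
    have "(\<lambda>n. (cmod (E (u n) v - l2_inner M g v))\<^sup>2) \<longlonglongrightarrow> 0"
    proof (rule tendsto_sandwich[OF _ _ tendsto_const])
      show "(\<lambda>n. 1 / real (Suc n) * Re (E v v)) \<longlonglongrightarrow> 0"
        using tendsto_mult_left_zero[OF LIMSEQ_inverse_real_of_nat] by (simp add: inverse_eq_divide)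
    qed (use EL1 in auto)
    then have l1: "(\<lambda>n. E (u n) v - l2_inner M g v) \<longlonglongrightarrow> 0"
      by (simp add: tendsto_norm_zero_iff)
    have "(\<lambda>n. (cmod (E (\<lambda>x. u n x - f x) v))\<^sup>2) \<longlonglongrightarrow> 0"
    proof (rule tendsto_sandwich[OF _ _ tendsto_const])
      show "(\<lambda>n. Re (E (\<lambda>x. u n x - f x) (\<lambda>x. u n x - f x)) * Re (E v v)) \<longlonglongrightarrow> 0"
        by (rule tendsto_mult_left_zero[OF Ef])
    qed (use semi_inner_Cauchy_Schwarz[OF SE diffD[OF u fD] v] in auto)
    then have "(\<lambda>n. E (\<lambda>x. u n x - f x) v) \<longlonglongrightarrow> 0"
      by (simp add: tendsto_norm_zero_iff)
    then have l2: "(\<lambda>n. E (u n) v - E f v) \<longlonglongrightarrow> 0"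
      unfolding sesquilinear_diff_left[OF semi_inner_sesquilinear[OF SE] D(1) u fD v] .
    have "(\<lambda>n. (E (u n) v - l2_inner M g v) - (E (u n) v - E f v)) \<longlonglongrightarrow> 0 - 0"
      by (rule tendsto_diff[OF l1 l2])
    then have "E f v - l2_inner M g v = 0" by (simp add: LIMSEQ_const_iff)
    then show "B f v + complex_of_real c * l2_inner M f v = l2_inner M g v" by (simp add: E_def)
  qed
qed

text \<open>
  The constant sequence \<open>u\<close> converges to every representative of its class, and a closed domain
  contains all limits.
\<close>

lemma closed_form_cong_AE:
  assumes closed: "closed_form M D Q" and "u \<in> D" "v \<in> L2 M" "AE x in M. u x = v x"
  shows "v \<in> D"
proof -
  have nf: "nonneg_form M D Q" using closed by (simp add: closed_form_def)
  obtain B where B: "semi_inner M D B" "\<forall>u\<in>D. Q u = B u u"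
    using nonneg_form_obtain_semi_inner[OF nf] by blast
  note D = semi_innerD[OF B(1)]
  have Q0: "Q (\<lambda>x. 0) = 0"
    using semi_inner_zero[OF B(1)] B(2)[rule_format, OF l2_subspace_zero[OF D(1)]] by simp
  have uL: "u \<in> L2 M" by (rule l2_subspace_imp_L2[OF D(1) assms(2)])
  have "l2_norm M (\<lambda>x. u x - v x) = l2_norm M (\<lambda>x. 0)"
    using assms(4) by (intro l2_norm_cong_AE L2_diff uL assms l2_subspace_zero[OF l2_subspace_L2]) auto
  then have "l2_norm M (\<lambda>x. u x - v x) = 0" by (simp add: l2_norm_def)
  then have "form_converges M D Q (\<lambda>n. u) v"
    unfolding form_converges_def using assms Q0 by simp
  with closed show ?thesis unfolding closed_form_def by blast
qed

lemma l2_dense_orthogonal_AE_0: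
  assumes "l2_dense M D" "h \<in> L2 M" "\<And>v. v \<in> D \<Longrightarrow> l2_inner M h v = 0"
  shows "AE x in M. h x = 0"
proof -
  have DL: "D \<subseteq> L2 M" using assms(1) by (simp add: l2_dense_def)
  have "(l2_norm M h)\<^sup>2 \<le> l2_norm M h * e" if "e > 0" for e
  proof -
    obtain v where v: "v \<in> D" "l2_norm M (\<lambda>x. h x - v x) < e"
      using assms(1,2) \<open>e > 0\<close> unfolding l2_dense_def by blast
    have vL: "v \<in> L2 M" using v DL by blast
    have "l2_inner M h (\<lambda>x. h x - v x) = of_real ((l2_norm M h)\<^sup>2)"
      using sesquilinear_diff_right[OF sesquilinear_on_l2_inner l2_subspace_L2 assms(2) vL assms(2)]
        assms(3)[OF v(1)] by (simp add: l2_inner_self)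
    then have "(l2_norm M h)\<^sup>2 = cmod (l2_inner M h (\<lambda>x. h x - v x))" by (simp add: norm_power l2_norm_nonneg)
    also have "\<dots> \<le> l2_norm M h * l2_norm M (\<lambda>x. h x - v x)"
      by (rule L2_Cauchy_Schwarz[OF assms(2) L2_diff[OF assms(2) vL]])
    also have "\<dots> \<le> l2_norm M h * e" using v(2) by (intro mult_left_mono l2_norm_nonneg) auto
    finally show ?thesis .
  qed
  note * = this
  have "l2_norm M h = 0"
  proof (rule ccontr)
    assume "l2_norm M h \<noteq> 0"
    then have "l2_norm M h > 0" using l2_norm_nonneg[of M h] by simp
    with *[of "l2_norm M h / 2"] show False by (simp add: power2_eq_square)
  qed
  then show ?thesis by (rule l2_norm_eq_0_imp_AE[OF assms(2)])
qed

lemma l2_inner_orthogonal_imp_AE_0: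
  assumes "h \<in> L2 M" "l2_inner M h h = 0" shows "AE x in M. h x = 0"
  using l2_norm_eq_0_imp_AE[OF assms(1)] assms(2) by (simp add: l2_inner_self)

lemma form_operator_iff:
  assumes "semi_inner M D B" "\<forall>u\<in>D. Q u = B u u"
  shows "(u, w) \<in> form_operator M D Q \<longleftrightarrow>
    u \<in> D \<and> w \<in> L2 M \<and> (\<forall>v\<in>D. B u v = l2_inner M w v)"
  unfolding form_operator_def using form_polar_eq[OF assms] by auto

text \<open>
  The vectors \<open>u\<^sub>n = n (A + n)\<^sup>-\<^sup>1 f\<close> lie in the domain of \<open>A\<close> and converge to \<open>f\<close> for each \<open>f\<close> in
  the form domain, since testing the resolvent equation with \<open>u\<^sub>n - f\<close> gives
  \<open>n \<parallel>u\<^sub>n - f\<parallel>\<^sup>2 \<le> Q[f] / 4\<close>.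
\<close>

lemma form_operator_domain_dense:
  assumes closed: "closed_form M D Q" and dense: "l2_dense M D"
  shows "l2_dense M (Domain (form_operator M D Q))"
proof -
  have nf: "nonneg_form M D Q" using closed by (simp add: closed_form_def)
  obtain B where B: "semi_inner M D B" "\<forall>u\<in>D. Q u = B u u"
    using nonneg_form_obtain_semi_inner[OF nf] by blast
  note D = semi_innerD[OF B(1)]
  have DL: "D \<subseteq> L2 M" using D(1) by (simp add: l2_subspace_def)
  show ?thesis unfolding l2_dense_def
  proof (intro conjI ballI allI impI)
    show "Domain (form_operator M D Q) \<subseteq> L2 M" using DL by (auto simp: form_operator_def)
    fix f e assume f: "f \<in> L2 M" and e: "(0::real) < e"
    obtain h where h: "h \<in> D" "l2_norm M (\<lambda>x. f x - h x) < e / 2"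
      using dense f e unfolding l2_dense_def by (meson half_gt_zero)
    have hL: "h \<in> L2 M" using h DL by blast
    define q where "q = Re (B h h)"
    have q: "0 \<le> q" unfolding q_def by (rule D(4)[OF h(1)])
    \<comment> \<open>Large enough for the resolvent estimate \<open>q / (4 c) < (e / 2)\<^sup>2\<close>.\<close>
    define c where "c = (q + 1) / e\<^sup>2"
    have c: "c > 0" unfolding c_def using q e by simp
    obtain u where u: "u \<in> D"
      "\<And>v. v \<in> D \<Longrightarrow> B u v + complex_of_real c * l2_inner M u v = l2_inner M (\<lambda>x. of_real c * h x) v"
      using closed_form_resolvent[OF closed B c L2_cmult[OF hL, of "of_real c"]] by blast
    have uL: "u \<in> L2 M" using u DL by blast
    have Bu: "B u v = l2_inner M (\<lambda>x. of_real c * (h x - u x)) v" if "v \<in> D" for v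
    proof -
      have vL: "v \<in> L2 M" using that DL by blast
      show ?thesis
        using u(2)[OF that]
        unfolding sesquilinear_diff_left[OF sesquilinear_on_l2_inner l2_subspace_L2 hL uL vL] sesquilinear_mult_left[OF sesquilinear_on_l2_inner L2_diff[OF hL uL] vL]
          sesquilinear_mult_left[OF sesquilinear_on_l2_inner hL vL]
        by (simp add: algebra_simps eq_diff_eq)
    qed
    have "(u, \<lambda>x. of_real c * (h x - u x)) \<in> form_operator M D Q"
      unfolding form_operator_iff[OF B]
      using u(1) Bu L2_cmult[OF L2_diff[OF hL uL]] by blast
    then have dom: "u \<in> Domain (form_operator M D Q)" by (rule DomainI)
    define d where "d = (\<lambda>x. h x - u x)"
    have d: "d \<in> D" unfolding d_def by (rule l2_subspace_diff[OF D(1) h(1) u(1)])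
    have dL: "d \<in> L2 M" using d DL by blast
    have "B h d - B d d = B u d"
      using sesquilinear_diff_left[OF D(2,1) h(1) d d] by (simp add: d_def)
    also have "\<dots> = of_real (c * (l2_norm M d)\<^sup>2)"
      using Bu[OF d] sesquilinear_mult_left[OF sesquilinear_on_l2_inner dL dL, of "of_real c"]
      by (simp add: d_def l2_inner_self)
    finally have "c * (l2_norm M d)\<^sup>2 = Re (B h d) - Re (B d d)" by (metis Re_complex_of_real minus_complex.simps(1))
    moreover have "Re (B h d) \<le> Re (B d d) + q / 4"
    proof -
      have "0 \<le> Re (B (\<lambda>x. h x + (-2) * d x) (\<lambda>x. h x + (-2) * d x))"
        by (intro D(4) l2_subspace_add_mult[OF D(1)] h d)
      then show ?thesis unfolding semi_inner_add_mult_Re[OF B(1) h(1) d] by (simp add: q_def)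
    qed
    ultimately have "c * (l2_norm M d)\<^sup>2 \<le> q / 4" by simp
    also have "\<dots> < c * (e / 2)\<^sup>2" using e q by (simp add: c_def power2_eq_square)
    finally have "(l2_norm M d)\<^sup>2 < (e/2)\<^sup>2" using c by simp
    then have du: "l2_norm M d < e / 2" by (rule power2_less_imp_less) (use e in simp)
    have "(l2_norm M (\<lambda>x. (f x - h x) + d x))\<^sup>2 \<le> 2 * (l2_norm M (\<lambda>x. f x - h x))\<^sup>2 + 2 * (l2_norm M d)\<^sup>2"
      by (rule l2_norm_add_squared_le[OF L2_diff[OF f hL] dL])
    also have "\<dots> < 2 * (e/2)\<^sup>2 + 2 * (e/2)\<^sup>2"
      using h(2) du by (intro add_strict_mono mult_strict_left_mono power_strict_mono l2_norm_nonneg) auto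
    also have "\<dots> = e\<^sup>2" by (simp add: power2_eq_square)
    finally have "(l2_norm M (\<lambda>x. f x - u x))\<^sup>2 < e\<^sup>2" by (simp add: d_def)
    then have "l2_norm M (\<lambda>x. f x - u x) < e" by (rule power2_less_imp_less) (use e in simp)
    then show "\<exists>g\<in>Domain (form_operator M D Q). l2_norm M (\<lambda>x. f x - g x) < e" using dom by blast
  qed
qed

text \<open>
  \<open>A\<close> is symmetric and \<open>A + 1\<close> is onto. Hence, if \<open>v\<close> is in the domain of the adjoint, solve
  \<open>(A + 1) u = (A\<^sup>* + 1) v\<close>; then \<open>v - u\<close> is orthogonal to the range of \<open>A + 1\<close>, so that \<open>v = u\<close>.
\<close>

theorem form_operator_self_adjoint:
  assumes closed: "closed_form M D Q" and dense: "l2_dense M D"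
  shows "l2_self_adjoint M (form_operator M D Q)"
proof -
  have nf: "nonneg_form M D Q" using closed by (simp add: closed_form_def)
  obtain B where B: "semi_inner M D B" "\<forall>u\<in>D. Q u = B u u"
    using nonneg_form_obtain_semi_inner[OF nf] by blast
  note D = semi_innerD[OF B(1)]
  have DL: "D \<subseteq> L2 M" using D(1) by (simp add: l2_subspace_def)
  note iff = form_operator_iff[OF B]
  note SI = sesquilinear_on_l2_inner[of M] and L2s = l2_subspace_L2[of M]
  let ?A = "form_operator M D Q"
  have sub: "?A \<subseteq> l2_adjoint M ?A"
  proof
    fix p assume "p \<in> ?A"
    then obtain v z where p: "p = (v, z)" and vz: "(v, z) \<in> ?A" by (cases p) auto
    have "l2_inner M w v = l2_inner M u z" if "(u, w) \<in> ?A" for u w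
    proof -
      have "l2_inner M w v = B u v" using that vz by (simp add: iff)
      also have "\<dots> = cnj (B v u)" using that vz unfolding iff by (intro semi_inner_hermitian[OF B(1)]) auto
      also have "\<dots> = cnj (l2_inner M z u)" using that vz by (simp add: iff)
      finally show ?thesis by (simp add: l2_inner_cnj)
    qed
    moreover have "v \<in> L2 M" "z \<in> L2 M" using vz DL unfolding iff by auto
    ultimately show "p \<in> l2_adjoint M ?A" unfolding p l2_adjoint_def by auto
  qed
  have sup: "l2_adjoint M ?A \<subseteq> ?A"
  proof
    fix p assume "p \<in> l2_adjoint M ?A"
    moreover obtain v z where p: "p = (v, z)" by (cases p)
    ultimately have v: "v \<in> L2 M" and z: "z \<in> L2 M"
      and adj': "\<forall>(u, w)\<in>?A. l2_inner M w v = l2_inner M u z"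
      by (simp_all add: l2_adjoint_def)
    have adj: "l2_inner M w v = l2_inner M u z" if "(u, w) \<in> ?A" for u w
      using bspec[OF adj' that] by simp
    \<comment> \<open>\<open>A + 1\<close> is onto: the resolvent equation with constant 1 reads \<open>A u = g - u\<close>.\<close>
    have surj: "\<exists>u\<in>D. (u, \<lambda>x. g x - u x) \<in> ?A" if g: "g \<in> L2 M" for g
    proof -
      obtain u where u: "u \<in> D" "\<And>w. w \<in> D \<Longrightarrow> B u w + complex_of_real 1 * l2_inner M u w = l2_inner M g w"
        using closed_form_resolvent[OF closed B _ g, of 1] by auto
      have uL: "u \<in> L2 M" using u DL by blast
      have "B u w = l2_inner M (\<lambda>x. g x - u x) w" if "w \<in> D" for w
        using u(2)[OF that] unfolding sesquilinear_diff_left[OF SI L2s g uL subsetD[OF DL that]]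
        by (simp add: algebra_simps)
      then have "(u, \<lambda>x. g x - u x) \<in> ?A" unfolding iff using u(1) L2_diff[OF g uL] by blast
      then show ?thesis using u by blast
    qed
    have zv: "(\<lambda>x. z x + v x) \<in> L2 M" by (rule L2_add[OF z v])
    obtain u where uD: "u \<in> D" and uA: "(u, \<lambda>x. z x + v x - u x) \<in> ?A" using surj[OF zv] by blast
    have uL: "u \<in> L2 M" using uD DL by blast
    define d where "d = (\<lambda>x. v x - u x)"
    have d: "d \<in> L2 M" unfolding d_def by (rule L2_diff[OF v uL])
    obtain y where yD: "y \<in> D" and yA: "(y, \<lambda>x. d x - y x) \<in> ?A" using surj[OF d] by blast
    have yL: "y \<in> L2 M" using yD DL by blast
    have "l2_inner M (\<lambda>x. d x - y x) v = l2_inner M y z" by (rule adj[OF yA])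
    moreover have "l2_inner M (\<lambda>x. d x - y x) u = l2_inner M y (\<lambda>x. z x + v x - u x)"
      using subsetD[OF sub uA] yA unfolding l2_adjoint_def by auto
    ultimately have "l2_inner M d v = l2_inner M d u"
      unfolding sesquilinear_diff_left[OF SI L2s d yL v] sesquilinear_diff_left[OF SI L2s d yL uL]
        sesquilinear_diff_right[OF SI L2s zv uL yL] sesquilinear_add_right[OF SI z v yL]
      by (simp add: algebra_simps)
    then have "l2_inner M d d = 0"
      using sesquilinear_diff_right[OF SI L2s v uL d] by (simp add: d_def)
    then have d0: "AE x in M. d x = 0" by (rule l2_inner_orthogonal_imp_AE_0[OF d])
    then have ae: "AE x in M. u x = v x" by eventually_elim (simp add: d_def)
    have vD: "v \<in> D" by (rule closed_form_cong_AE[OF closed uD v ae])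
    have "B v w = l2_inner M z w" if w: "w \<in> D" for w
    proof -
      have dD: "d \<in> D" unfolding d_def by (rule l2_subspace_diff[OF D(1) vD uD])
      have "Q d = Q (\<lambda>x. 0)"
        by (rule nonneg_form_cong_AE[OF nf dD l2_subspace_zero[OF D(1)] d0])
      also have "\<dots> = 0"
        using semi_inner_zero[OF B(1)] B(2)[rule_format, OF l2_subspace_zero[OF D(1)]] by simp
      finally have "B d d = 0" using B(2)[rule_format, OF dD] by simp
      then have "B d w = 0" using semi_inner_Cauchy_Schwarz[OF B(1) dD w] by simp
      then have "B v w = B u w" using sesquilinear_diff_left[OF D(2,1) vD uD w] by (simp add: d_def)
      also have "\<dots> = l2_inner M (\<lambda>x. z x + v x - u x) w" using uA w unfolding iff by blast
      also have "\<dots> = l2_inner M z w"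
      proof (rule l2_inner_cong_AE[OF L2_diff[OF zv uL] z])
        show "AE x in M. z x + v x - u x = z x" using ae by eventually_elim simp
      qed (use w DL in auto)
      finally show ?thesis .
    qed
    then show "p \<in> ?A" unfolding p iff using vD z by blast
  qed
  show ?thesis
    unfolding l2_self_adjoint_def
    using form_operator_domain_dense[OF closed dense] sub sup by blast
qed

section \<open>Smooth functions of compact support\<close>

text \<open>
  The differentiability condition in \<^const>\<open>C0_infinity_Rplus\<close>.
\<close>

definition smooth :: "(real \<Rightarrow> complex) \<Rightarrow> bool" where
  "smooth f \<longleftrightarrow> (\<forall>n x. ((\<lambda>g y. vector_derivative g (at y)) ^^ n) f differentiable (at x))"

text \<open>Coinduction: every member of a family that is closed under differentiation is smooth.\<close>

lemma smooth_coinduct: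
  assumes "f \<in> S" and closed: "\<And>g. g \<in> S \<Longrightarrow> \<exists>g'\<in>S. \<forall>x. (g has_vector_derivative g' x) (at x)"
  shows "smooth f"
proof -
  have D: "(\<lambda>y. vector_derivative g (at y)) \<in> S" if gS: "g \<in> S" for g
  proof -
    obtain g' where g': "g' \<in> S" "\<forall>x. (g has_vector_derivative g' x) (at x)" using closed[OF gS] by blast
    then have "(\<lambda>y. vector_derivative g (at y)) = g'" by (auto intro: vector_derivative_at)
    with g' show ?thesis by simp
  qed
  have S: "((\<lambda>g y. vector_derivative g (at y)) ^^ n) f \<in> S" for n
    by (induction n) (simp_all add: assms(1) D)
  show ?thesis unfolding smooth_def
  proof (intro allI)
    fix n x show "((\<lambda>g y. vector_derivative g (at y)) ^^ n) f differentiable (at x)"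
      using closed[OF S[of n]] by (auto simp: has_vector_derivative_def differentiable_def)
  qed
qed

lemma smooth_has_vector_derivative:
  assumes "smooth f"
  shows "\<exists>f'. smooth f' \<and> (\<forall>x. (f has_vector_derivative f' x) (at x))"
proof (intro exI conjI allI)
  show "smooth (\<lambda>y. vector_derivative f (at y))"
    unfolding smooth_def
  proof (intro allI)
    fix n x
    have "((\<lambda>g y. vector_derivative g (at y)) ^^ Suc n) f differentiable (at x)"
      using assms unfolding smooth_def by blast
    then show "((\<lambda>g y. vector_derivative g (at y)) ^^ n) (\<lambda>y. vector_derivative f (at y)) differentiable (at x)"
      unfolding funpow_Suc_right o_def .
  qed
  fix x
  have "((\<lambda>g y. vector_derivative g (at y)) ^^ 0) f differentiable (at x)"
    using assms unfolding smooth_def by blast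
  then show "(f has_vector_derivative vector_derivative f (at x)) (at x)"
    by (simp add: vector_derivative_works)
qed

lemma smooth_continuous: "smooth f \<Longrightarrow> continuous_on S f"
  using smooth_has_vector_derivative
  by (meson continuous_at_imp_continuous_on has_vector_derivative_continuous)

lemma smooth_polynomial_function:
  fixes p :: "real \<Rightarrow> complex" assumes "polynomial_function p" shows "smooth p"
proof (rule smooth_coinduct[where S = "Collect polynomial_function"])
  fix g :: "real \<Rightarrow> complex" assume "g \<in> Collect polynomial_function"
  then have "polynomial_function g" by simp
  then obtain g' where "polynomial_function g'" "\<And>x. (g has_vector_derivative g' x) (at x)"
    by (rule has_vector_derivative_polynomial_function) blast
  then show "\<exists>g'\<in>Collect polynomial_function. \<forall>x. (g has_vector_derivative g' x) (at x)"
    by (intro bexI[of _ g']) auto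
qed (use assms in simp)

lemma smooth_add:
  assumes "smooth f" "smooth g" shows "smooth (\<lambda>x. f x + g x)"
proof (rule smooth_coinduct[where S = "{\<lambda>x. f x + g x | f g. smooth f \<and> smooth g}"])
  fix h assume "h \<in> {\<lambda>x. f x + g x | f g. smooth f \<and> smooth g}"
  then obtain f g where h: "h = (\<lambda>x. f x + g x)" and "smooth f" "smooth g" by blast
  then obtain f' g' where "smooth f'" "smooth g'"
    "\<forall>x. (f has_vector_derivative f' x) (at x)" "\<forall>x. (g has_vector_derivative g' x) (at x)"
    using smooth_has_vector_derivative by metis
  then show "\<exists>h'\<in>{\<lambda>x. f x + g x | f g. smooth f \<and> smooth g}. \<forall>x. (h has_vector_derivative h' x) (at x)"
    unfolding h by (intro bexI[of _ "\<lambda>x. f' x + g' x"]) (auto intro: has_vector_derivative_add)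
qed (use assms in blast)

text \<open>
  Products alone are not closed under differentiation, but finite sums of products are, by the
  Leibniz rule.
\<close>

inductive_set product_sums :: "(real \<Rightarrow> complex) set" where
  product: "smooth f \<Longrightarrow> smooth g \<Longrightarrow> (\<lambda>x. f x * g x) \<in> product_sums"
| sum: "h \<in> product_sums \<Longrightarrow> k \<in> product_sums \<Longrightarrow> (\<lambda>x. h x + k x) \<in> product_sums"

lemma smooth_mult:
  assumes "smooth f" "smooth g" shows "smooth (\<lambda>x. f x * g x)"
proof (rule smooth_coinduct[where S = product_sums])
  show "(\<lambda>x. f x * g x) \<in> product_sums" by (rule product_sums.product[OF assms])
  fix h assume "h \<in> product_sums"
  then show "\<exists>h'\<in>product_sums. \<forall>x. (h has_vector_derivative h' x) (at x)"
  proof induction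
    case (product f g)
    then obtain f' g' where f': "smooth f'" "smooth g'"
      "\<forall>x. (f has_vector_derivative f' x) (at x)" "\<forall>x. (g has_vector_derivative g' x) (at x)"
      using smooth_has_vector_derivative by metis
    show ?case
    proof (intro bexI allI)
      show "(\<lambda>x. f x * g' x + f' x * g x) \<in> product_sums"
        by (intro product_sums.intros product f')
      show "((\<lambda>x. f x * g x) has_vector_derivative f x * g' x + f' x * g x) (at x)" for x
        by (intro has_vector_derivative_mult f'(3,4)[rule_format])
    qed
  next
    case (sum h k)
    then obtain h' k' where "h' \<in> product_sums" "k' \<in> product_sums"
      "\<forall>x. (h has_vector_derivative h' x) (at x)" "\<forall>x. (k has_vector_derivative k' x) (at x)" by blast
    then show ?case
      by (intro bexI[of _ "\<lambda>x. h' x + k' x"]) (auto intro: has_vector_derivative_add product_sums.sum)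
  qed
qed

lemma smooth_affine:
  assumes "smooth f" shows "smooth (\<lambda>x. f (c * x + d))"
proof (rule smooth_coinduct[where S = "{\<lambda>x. z * f (c * x + d) | z f. smooth f}"])
  have "(\<lambda>x. f (c * x + d)) = (\<lambda>x. 1 * f (c * x + d))" by simp
  then show "(\<lambda>x. f (c * x + d)) \<in> {\<lambda>x. z * f (c * x + d) | z f. smooth f}" using assms by blast
  fix h assume "h \<in> {\<lambda>x. z * f (c * x + d) | z f. smooth f}"
  then obtain z f where h: "h = (\<lambda>x. z * f (c * x + d))" and "smooth f" by blast
  then obtain f' where f': "smooth f'" "\<forall>x. (f has_vector_derivative f' x) (at x)"
    using smooth_has_vector_derivative by metis
  show "\<exists>h'\<in>{\<lambda>x. z * f (c * x + d) | z f. smooth f}. \<forall>x. (h has_vector_derivative h' x) (at x)"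
  proof (intro bexI allI)
    show "(\<lambda>x. (z * of_real c) * f' (c * x + d)) \<in> {\<lambda>x. z * f (c * x + d) | z f. smooth f}"
      using f' by blast
    fix x
    have "((\<lambda>x. c * x + d) has_vector_derivative c) (at x)"
      by (auto intro!: derivative_eq_intros simp flip: has_real_derivative_iff_has_vector_derivative)
    from vector_diff_chain_at[OF this f'(2)[rule_format, of "c * x + d"]]
    have "((\<lambda>x. f (c * x + d)) has_vector_derivative c *\<^sub>R f' (c * x + d)) (at x)" by (simp add: o_def)
    then have "((\<lambda>x. z * f (c * x + d)) has_vector_derivative z * (c *\<^sub>R f' (c * x + d))) (at x)"
      by (rule has_vector_derivative_mult_right)
    then show "(h has_vector_derivative (z * of_real c) * f' (c * x + d)) (at x)"
      by (simp add: h scaleR_conv_of_real mult.assoc)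
  qed
qed

text \<open>
  The functions \<open>p (1 / x) exp (- 1 / x)\<close> on the positive half-line, extended by zero, form a family
  that is closed under differentiation; it contains the standard flat function for \<open>p = 1\<close>.
\<close>

definition exp_flat :: "real poly \<Rightarrow> real \<Rightarrow> real" where
  "exp_flat p x = (if 0 < x then poly p (1 / x) * exp (- (1 / x)) else 0)"

lemma poly_mult_exp_tendsto_0: "((\<lambda>y. poly p y * exp (- y)) \<longlongrightarrow> 0) at_top" for p :: "real poly"
proof -
  have "((\<lambda>y. \<Sum>i\<le>degree p. coeff p i * (y ^ i / exp y)) \<longlongrightarrow> (\<Sum>i\<le>degree p. coeff p i * 0)) at_top"
    by (intro tendsto_intros tendsto_power_div_exp_0)
  moreover have "poly p y * exp (- y) = (\<Sum>i\<le>degree p. coeff p i * (y ^ i / exp y))" for y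
    by (simp add: poly_altdef sum_distrib_right exp_minus divide_inverse mult.assoc)
  ultimately show ?thesis by simp
qed

lemma exp_flat_tendsto_0: "((\<lambda>x. poly p (1 / x) * exp (- (1 / x))) \<longlongrightarrow> 0) (at_right 0)" for p :: "real poly"
  using filterlim_compose[OF poly_mult_exp_tendsto_0[of p] filterlim_inverse_at_top_right]
  by (simp add: inverse_eq_divide)

text \<open>
  With \<open>y = 1 / x\<close>, the chain rule turns \<open>p(y) exp (- y)\<close> into \<open>y\<^sup>2 (p(y) - p'(y)) exp (- y)\<close>. At the
  origin the difference quotient is \<open>y p(y) exp (- y)\<close>, which tends to zero.
\<close>

lemma exp_flat_has_derivative:
  "(exp_flat p has_real_derivative exp_flat ([:0, 0, 1:] * (p - pderiv p)) x) (at x)"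
proof -
  let ?p' = "[:0, 0, 1:] * (p - pderiv p)"
  consider "x < 0" | "x = 0" | "0 < x" by linarith
  then show ?thesis
  proof cases
    case 1
    have "((\<lambda>_. 0) has_real_derivative 0) (at x)" by simp
    then have "(exp_flat p has_real_derivative 0) (at x)"
      by (rule has_field_derivative_transform_within_open[of _ _ _ "{..<0}"])
         (use 1 in \<open>auto simp: exp_flat_def\<close>)
    then show ?thesis using 1 by (simp add: exp_flat_def)
  next
    case 3
    have "((\<lambda>x. poly p (1 / x) * exp (- (1 / x))) has_real_derivative
        poly (pderiv p) (1 / x) * (- (1 / x\<^sup>2)) * exp (- (1 / x)) + poly p (1 / x) * (exp (- (1 / x)) * (1 / x\<^sup>2))) (at x)"
      using 3 by (auto intro!: derivative_eq_intros simp: power2_eq_square)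
    also have "poly (pderiv p) (1 / x) * (- (1 / x\<^sup>2)) * exp (- (1 / x)) + poly p (1 / x) * (exp (- (1 / x)) * (1 / x\<^sup>2))
        = exp_flat ?p' x"
      using 3 by (simp add: exp_flat_def power2_eq_square algebra_simps)
    finally have "((\<lambda>x. poly p (1 / x) * exp (- (1 / x))) has_real_derivative exp_flat ?p' x) (at x)" .
    then show ?thesis
      by (rule has_field_derivative_transform_within_open[of _ _ _ "{0<..}"])
         (use 3 in \<open>auto simp: exp_flat_def\<close>)
  next
    case 2
    have r: "((\<lambda>h. (exp_flat p (0 + h) - exp_flat p 0) / h) \<longlongrightarrow> 0) (at_right 0)"
    proof (rule Lim_transform_eventually[OF exp_flat_tendsto_0[of "[:0, 1:] * p"]])
      show "eventually (\<lambda>h. poly ([:0, 1:] * p) (1 / h) * exp (- (1 / h)) = (exp_flat p (0 + h) - exp_flat p 0) / h) (at_right 0)"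
        using eventually_at_right_less by (rule eventually_mono) (auto simp: exp_flat_def)
    qed
    have l: "((\<lambda>h. (exp_flat p (0 + h) - exp_flat p 0) / h) \<longlongrightarrow> 0) (at_left 0)"
    proof (rule Lim_transform_eventually[OF tendsto_const])
      have "eventually (\<lambda>h. h < 0) (at_left (0::real))" by (simp add: eventually_at_filter)
      then show "eventually (\<lambda>h. 0 = (exp_flat p (0 + h) - exp_flat p 0) / h) (at_left 0)"
        by (rule eventually_mono) (auto simp: exp_flat_def)
    qed
    have "exp_flat ?p' 0 = 0" by (simp add: exp_flat_def)
    then show ?thesis using filterlim_split_at_real[OF l r] 2 by (simp add: DERIV_def)
  qed
qed

lemma smooth_exp_flat: "smooth (\<lambda>x. of_real (exp_flat p x))"
proof (rule smooth_coinduct[where S = "range (\<lambda>p x. complex_of_real (exp_flat p x))"])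
  fix g assume "g \<in> range (\<lambda>p x. complex_of_real (exp_flat p x))"
  then obtain p where g: "g = (\<lambda>x. complex_of_real (exp_flat p x))" by blast
  show "\<exists>g'\<in>range (\<lambda>p x. complex_of_real (exp_flat p x)). \<forall>x. (g has_vector_derivative g' x) (at x)"
    unfolding g
    by (intro bexI[OF _ rangeI[of _ "[:0, 0, 1:] * (p - pderiv p)"]] allI has_vector_derivative_of_real
        exp_flat_has_derivative)
qed blast

definition bump :: "real \<Rightarrow> real \<Rightarrow> real \<Rightarrow> real" where
  "bump a b x = exp_flat 1 (x - a) * exp_flat 1 (b - x)"

lemma smooth_bump: "smooth (\<lambda>x. of_real (bump a b x))"
  using smooth_mult[OF smooth_affine[OF smooth_exp_flat[of 1], of 1 "-a"]
      smooth_affine[OF smooth_exp_flat[of 1], of "-1" b]]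
  by (simp add: bump_def)

lemma bump_bounds: "0 \<le> bump a b x" "bump a b x \<le> 1"
  by (auto simp: bump_def exp_flat_def mult_le_one)

lemma bump_pos: "a < x \<Longrightarrow> x < b \<Longrightarrow> 0 < bump a b x"
  by (simp add: bump_def exp_flat_def)

lemma bump_eq_0: "x \<notin> {a<..<b} \<Longrightarrow> bump a b x = 0"
  by (auto simp: bump_def exp_flat_def)

lemma continuous_on_bump: "continuous_on S (bump a b)"
  using continuous_on_Re[OF smooth_continuous[OF smooth_bump[of a b]]] by simp

lemma C0_infinity_RplusI:
  assumes "smooth f" "0 < a" "\<And>x. x \<notin> {a..b} \<Longrightarrow> f x = 0"
  shows "f \<in> C0_infinity_Rplus"
proof -
  have "{x. f x \<noteq> 0} \<subseteq> {a..b}" using assms(3) by blast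
  then have "closure {x. f x \<noteq> 0} \<subseteq> {a..b}" by (rule closure_minimal) simp
  moreover from this have "bounded (closure {x. f x \<noteq> 0})"
    using bounded_closed_interval bounded_subset by blast
  ultimately show ?thesis
    using assms(1,2) unfolding C0_infinity_Rplus_def smooth_def
    by (force simp: compact_eq_bounded_closed)
qed

lemma C0_infinity_Rplus_smooth: "f \<in> C0_infinity_Rplus \<Longrightarrow> smooth f"
  by (simp add: C0_infinity_Rplus_def smooth_def)

lemma C0_infinity_Rplus_obtain:
  assumes "f \<in> C0_infinity_Rplus"
  obtains a b K where "0 < a" "a \<le> b" "\<And>x. x \<notin> {a..b} \<Longrightarrow> f x = 0" "0 \<le> K" "\<And>x. cmod (f x) \<le> K"
proof -
  let ?S = "closure {x. f x \<noteq> 0}"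
  have S: "compact ?S" "?S \<subseteq> {0<..}" using assms by (auto simp: C0_infinity_Rplus_def)
  have sub: "\<And>x. f x \<noteq> 0 \<Longrightarrow> x \<in> ?S" using closure_subset[of "{x. f x \<noteq> 0}"] by blast
  show ?thesis
  proof (cases "?S = {}")
    case True
    then show ?thesis using that[of 1 1 0] sub by force
  next
    case False
    obtain a where a: "a \<in> ?S" "\<And>x. x \<in> ?S \<Longrightarrow> a \<le> x" using compact_attains_inf[OF S(1) False] by blast
    obtain b where b: "b \<in> ?S" "\<And>x. x \<in> ?S \<Longrightarrow> x \<le> b" using compact_attains_sup[OF S(1) False] by blast
    have "compact (f ` ?S)"
      by (intro compact_continuous_image S smooth_continuous C0_infinity_Rplus_smooth assms)
    then obtain K where K: "\<And>x. x \<in> ?S \<Longrightarrow> cmod (f x) \<le> K"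
      using compact_imp_bounded[of "f ` ?S"] unfolding bounded_iff by blast
    have K0: "0 \<le> K" using K[OF a(1)] norm_ge_zero order_trans by blast
    have Kb: "cmod (f x) \<le> K" for x
      using K sub[of x] K0 by (cases "f x = 0") auto
    have z: "f x = 0" if "x \<notin> {a..b}" for x
      using sub[of x] a(2) b(2) that by fastforce
    have "0 < a" "a \<le> b" using a(1) S(2) b(2) by auto
    from that[OF this z K0 Kb] show ?thesis .
  qed
qed

lemma C0_infinity_Rplus_measurable:
  assumes "f \<in> C0_infinity_Rplus" shows "f \<in> borel_measurable borel"
  by (intro borel_measurable_continuous_onI smooth_continuous C0_infinity_Rplus_smooth assms)

section \<open>Approximation by test functions on the line\<close>

text \<open>
  A bounded Borel function \<open>g\<close> supported in \<open>[a, b]\<close> is written as \<open>\<beta> u\<close> with a smooth \<open>\<beta>\<close> that is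
  positive on a larger interval. The bounded factor \<open>u\<close> is an almost everywhere limit of continuous
  functions, which can be clamped to a common bound and then replaced by polynomials; multiplying
  these by \<open>\<beta>\<close> gives test functions.
\<close>

lemma test_function_approximation:
  fixes g :: "real \<Rightarrow> complex"
  assumes g: "g \<in> borel_measurable borel" and K: "\<And>x. cmod (g x) \<le> K"
    and supp: "\<And>x. x \<notin> {a..b} \<Longrightarrow> g x = 0"
    and ab: "0 < a0" "a0 < a" "b < b0" and e: "0 < e"
  shows "\<exists>\<phi>\<in>C0_infinity_Rplus. (\<forall>x. x \<notin> {a0..b0} \<longrightarrow> \<phi> x = 0) \<and>
      integrable lborel (\<lambda>x. (cmod (g x - \<phi> x))\<^sup>2) \<and> (LINT x|lborel. (cmod (g x - \<phi> x))\<^sup>2) < e"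
proof (cases "a \<le> b")
  case False
  then have "g = (\<lambda>x. 0)" using supp by fastforce
  moreover have "(\<lambda>x. 0) \<in> C0_infinity_Rplus"
    by (rule C0_infinity_RplusI[of _ 1 1]) (auto intro: smooth_polynomial_function)
  ultimately show ?thesis using e by (intro bexI[of _ "\<lambda>x. 0"]) auto
next
  case True
  let ?\<beta> = "bump a0 b0"
  obtain m where m: "m \<in> {a..b}" "\<And>x. x \<in> {a..b} \<Longrightarrow> ?\<beta> m \<le> ?\<beta> x"
    using continuous_attains_inf[OF compact_Icc _ continuous_on_bump, of a b a0 b0] True by auto
  define \<mu> where "\<mu> = ?\<beta> m"
  have \<mu>: "\<mu> > 0" unfolding \<mu>_def using m ab by (intro bump_pos) auto
  define u where "u x = g x / of_real (?\<beta> x)" for x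
  have \<beta>m[measurable]: "?\<beta> \<in> borel_measurable borel"
    by (intro borel_measurable_continuous_onI continuous_on_bump)
  have um: "u \<in> borel_measurable borel" unfolding u_def using g by measurable
  have K0: "0 \<le> K" using K[of 0] norm_ge_zero order_trans by blast
  define L where "L = K / \<mu> + 1"
  have L: "L > 0" unfolding L_def using K0 \<mu> by (simp add: add_nonneg_pos)
  have uL: "cmod (u x) \<le> L" for x
  proof (cases "x \<in> {a..b}")
    case True
    then have "\<mu> \<le> ?\<beta> x" using m by (simp add: \<mu>_def)
    then have "cmod (g x) / ?\<beta> x \<le> K / \<mu>" using \<mu> K[of x] K0 by (intro frac_le) auto
    then show ?thesis using bump_bounds(1)[of a0 b0 x] by (simp add: u_def L_def norm_divide)
  qed (use supp L in \<open>simp add: u_def\<close>)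
  have g_eq: "g x = of_real (?\<beta> x) * u x" for x
  proof (cases "x \<in> {a..b}")
    case True
    then have "?\<beta> x > 0" using ab by (intro bump_pos) auto
    then show ?thesis by (simp add: u_def)
  qed (use supp in \<open>simp add: u_def\<close>)
  have "u measurable_on UNIV"
    using um by (intro lebesgue_measurable_imp_measurable_on measurable_completion) auto
  then obtain N h where N: "negligible N" and hc: "\<And>n. continuous_on UNIV (h n)"
    and hl: "\<And>x. x \<notin> N \<Longrightarrow> (\<lambda>n. h n x) \<longlonglongrightarrow> u x"
    unfolding measurable_on_def by auto
  define c where "c n x = of_real (L / max L (cmod (h n x))) * h n x" for n :: nat and x
  have cc: "continuous_on UNIV (c n)" for n
    unfolding c_def by (intro continuous_intros hc) (use L in auto)
  have cm[measurable]: "c n \<in> borel_measurable borel" for n by (intro borel_measurable_continuous_onI cc)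
  have cL: "cmod (c n x) \<le> L" for n x
  proof -
    have "max L (cmod (h n x)) > 0" using L by (simp add: less_max_iff_disj)
    then have "cmod (c n x) = L * (cmod (h n x) / max L (cmod (h n x)))"
      using L by (simp add: c_def norm_mult norm_divide)
    also have "\<dots> \<le> L * 1" using L by (intro mult_left_mono) auto
    finally show ?thesis by simp
  qed
  have cl: "(\<lambda>n. c n x) \<longlonglongrightarrow> u x" if "x \<notin> N" for x
  proof -
    have "(\<lambda>n. c n x) \<longlonglongrightarrow> of_real (L / max L (cmod (u x))) * u x"
      unfolding c_def by (intro tendsto_intros hl that) (use L in auto)
    also have "of_real (L / max L (cmod (u x))) * u x = u x" using uL[of x] L by (simp add: max_def)
    finally show ?thesis .
  qed
  have aeN: "AE x in lborel. x \<notin> N"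
    using N by (metis AE_completion_iff negligible_iff_null_sets AE_not_in)
  have int_const: "integrable lborel (\<lambda>x. C * indicator {a0..b0} x :: real)" for C
    by (intro integrable_mult_right integrable_real_indicator) (auto simp: emeasure_lborel_Icc_eq)
  define I where "I n = (LINT x|lborel. (cmod (u x - c n x))\<^sup>2 * indicator {a0..b0} x)" for n
  have bdd: "(cmod (u x - c n x))\<^sup>2 \<le> (2 * L)\<^sup>2" for n x
    using norm_triangle_ineq4[of "u x" "c n x"] uL[of x] cL[of n x] by (intro power_mono) auto
  have "I \<longlonglongrightarrow> (LINT x|lborel. (cmod (u x - u x))\<^sup>2 * indicator {a0..b0} (x::real))"
    unfolding I_def
  proof (rule integral_dominated_convergence[OF _ _ int_const[of "(2 * L)\<^sup>2"]])
    show "AE x in lborel. (\<lambda>n. (cmod (u x - c n x))\<^sup>2 * indicator {a0..b0} x)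
            \<longlonglongrightarrow> (cmod (u x - u x))\<^sup>2 * indicator {a0..b0} x"
      using aeN by eventually_elim (intro tendsto_intros cl)
    show "AE x in lborel. norm ((cmod (u x - c n x))\<^sup>2 * indicator {a0..b0} x) \<le> (2 * L)\<^sup>2 * indicator {a0..b0} x" for n
      using bdd by (intro AE_I2) (simp add: indicator_def)
    show "(\<lambda>x. (cmod (u x - c n x))\<^sup>2 * indicator {a0..b0} x) \<in> borel_measurable lborel" for n
      using um by measurable
  qed (use um in measurable)
  then have "I \<longlonglongrightarrow> 0" by simp
  then obtain n where n: "I n < e / 4"
    using order_tendstoD(2)[of I 0 sequentially "e/4"] e eventually_happens by fastforce
  define \<delta> where "\<delta> = sqrt (e / (8 * (b0 - a0)))"
  have \<delta>: "\<delta> > 0" using ab True e by (simp add: \<delta>_def)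
  have \<delta>2: "2 * \<delta>\<^sup>2 * (b0 - a0) = e / 4" using ab True e by (simp add: \<delta>_def field_simps)
  obtain p where p: "polynomial_function p" "\<And>x. x \<in> {a0..b0} \<Longrightarrow> cmod (c n x - p x) < \<delta>"
    using Stone_Weierstrass_polynomial_function[OF compact_Icc continuous_on_subset[OF cc subset_UNIV] \<delta>] by metis
  define \<phi> where "\<phi> x = of_real (?\<beta> x) * p x" for x
  have \<phi>s: "smooth \<phi>" unfolding \<phi>_def by (intro smooth_mult smooth_bump smooth_polynomial_function p)
  have \<phi>0: "\<phi> x = 0" if "x \<notin> {a0..b0}" for x
    using bump_eq_0[of x a0 b0] that by (auto simp: \<phi>_def)
  have \<phi>C: "\<phi> \<in> C0_infinity_Rplus" by (rule C0_infinity_RplusI[OF \<phi>s ab(1) \<phi>0])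
  have \<phi>m[measurable]: "\<phi> \<in> borel_measurable borel" by (rule C0_infinity_Rplus_measurable[OF \<phi>C])
  let ?G = "\<lambda>x. 2 * ((cmod (u x - c n x))\<^sup>2 * indicator {a0..b0} x) + 2 * \<delta>\<^sup>2 * indicator {a0..b0} x"
  have le: "(cmod (g x - \<phi> x))\<^sup>2 \<le> ?G x" for x
  proof (cases "x \<in> {a0..b0}")
    case True
    have "(cmod (g x - \<phi> x))\<^sup>2 = (?\<beta> x)\<^sup>2 * (cmod (u x - p x))\<^sup>2"
      by (simp add: g_eq \<phi>_def norm_mult power_mult_distrib flip: right_diff_distrib)
    also have "\<dots> \<le> 1 * (cmod (u x - p x))\<^sup>2"
      using bump_bounds[of a0 b0 x] by (intro mult_right_mono) (auto simp: power_le_one)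
    also have "\<dots> \<le> 2 * (cmod (u x - c n x))\<^sup>2 + 2 * (cmod (c n x - p x))\<^sup>2"
      using cmod_add_squared_le[of "u x - c n x" "c n x - p x"] by simp
    also have "\<dots> \<le> 2 * (cmod (u x - c n x))\<^sup>2 + 2 * \<delta>\<^sup>2"
      using p(2)[OF True] by (intro add_left_mono mult_left_mono power_mono) auto
    finally show ?thesis using True by simp
  next
    case False
    then have "x \<notin> {a..b}" using ab by auto
    then show ?thesis using False \<phi>0 supp by simp
  qed
  have int1: "integrable lborel (\<lambda>x. (cmod (u x - c n x))\<^sup>2 * indicator {a0..b0} x)"
  proof (rule Bochner_Integration.integrable_bound[OF int_const[of "(2 * L)\<^sup>2"]])
    show "(\<lambda>x. (cmod (u x - c n x))\<^sup>2 * indicator {a0..b0} x) \<in> borel_measurable lborel"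
      using um by measurable
    show "AE x in lborel. norm ((cmod (u x - c n x))\<^sup>2 * indicator {a0..b0} x) \<le> norm ((2 * L)\<^sup>2 * indicator {a0..b0} x :: real)"
      using bdd by (intro AE_I2) (simp add: indicator_def)
  qed
  have int2: "integrable lborel ?G" by (intro Bochner_Integration.integrable_add integrable_mult_right int1 int_const)
  have int3: "integrable lborel (\<lambda>x. (cmod (g x - \<phi> x))\<^sup>2)"
  proof (rule Bochner_Integration.integrable_bound[OF int2])
    show "(\<lambda>x. (cmod (g x - \<phi> x))\<^sup>2) \<in> borel_measurable lborel" using g by measurable
    show "AE x in lborel. norm ((cmod (g x - \<phi> x))\<^sup>2) \<le> norm (?G x)"
      using le by (intro AE_I2) (simp add: order_trans[OF _ abs_ge_self])
  qed
  have "(LINT x|lborel. (cmod (g x - \<phi> x))\<^sup>2) \<le> (LINT x|lborel. ?G x)"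
    by (rule integral_mono[OF int3 int2 le])
  also have "\<dots> = 2 * I n + 2 * \<delta>\<^sup>2 * (b0 - a0)"
    unfolding I_def using int1 int_const[of "2 * \<delta>\<^sup>2"] ab True by simp
  also have "\<dots> < e" unfolding \<delta>2 using n e by simp
  finally show ?thesis using \<phi>C \<phi>0 int3 by blast
qed

section \<open>Density of test functions on the half-line\<close>

lemma sets_Rplus_restrict: "{0<..} \<inter> space lborel \<in> sets (lborel :: real measure)"
  by simp

lemma space_Rplus: "space Rplus = {0<..}"
  by (simp add: Rplus_def space_restrict_space)

lemma sigma_finite_Rplus: "sigma_finite_measure Rplus"
  unfolding Rplus_def by (rule sigma_finite_measure_restrict_space[OF lborel.sigma_finite_measure_axioms]) simp

interpretation Rplus: sigma_finite_measure Rplus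
  by (rule sigma_finite_Rplus)

lemma measurable_Rplus: "f \<in> measurable borel N \<Longrightarrow> f \<in> measurable Rplus N"
  unfolding Rplus_def by (rule measurable_restrict_space1) (simp add: measurable_lborel1)

lemma measurable_ident_Rplus: "(\<lambda>x. x) \<in> borel_measurable Rplus"
  by (rule measurable_Rplus) simp

lemma borel_measurable_Rplus_iff:
  fixes f :: "real \<Rightarrow> 'b::real_normed_vector"
  shows "f \<in> borel_measurable Rplus \<longleftrightarrow> (\<lambda>x. indicator {0<..} x *\<^sub>R f x) \<in> borel_measurable borel"
  unfolding Rplus_def by (subst borel_measurable_restrict_space_iff[OF sets_Rplus_restrict]) simp

lemma integrable_Rplus_iff:
  fixes f :: "real \<Rightarrow> 'b::{banach, second_countable_topology}"
  shows "integrable Rplus f \<longleftrightarrow> integrable lborel (\<lambda>x. indicator {0<..} x *\<^sub>R f x)"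
  unfolding Rplus_def by (rule integrable_restrict_space[OF sets_Rplus_restrict])

lemma integral_Rplus:
  fixes f :: "real \<Rightarrow> 'b::{banach, second_countable_topology}"
  shows "(LINT x|Rplus. f x) = (LINT x|lborel. indicator {0<..} x *\<^sub>R f x)"
  unfolding Rplus_def by (rule integral_restrict_space[OF sets_Rplus_restrict])

lemma integral_Rplus_le:
  fixes f :: "real \<Rightarrow> real"
  assumes "integrable lborel f" "\<And>x. 0 \<le> f x"
  shows "integrable Rplus f" "(LINT x|Rplus. f x) \<le> (LINT x|lborel. f x)"
proof -
  show "integrable Rplus f"
    unfolding integrable_Rplus_iff using assms(1) by (intro integrable_mult_indicator) auto
  show "(LINT x|Rplus. f x) \<le> (LINT x|lborel. f x)"
    unfolding integral_Rplus using assms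
    by (intro integral_mono integrable_mult_indicator) (auto simp: indicator_def)
qed

lemma integrable_exp_Rplus:
  assumes "0 < c" shows "integrable Rplus (\<lambda>t. exp (- (c * t)))"
proof -
  have "(\<integral>\<^sup>+x. ennreal (exp (- (c * x))) * indicator {0..} x \<partial>lborel) = 0 - (- exp (- (c * 0)) / c)"
  proof (rule nn_integral_FTC_atLeast)
    show "((\<lambda>x. - exp (- (c * x)) / c) \<longlongrightarrow> 0) at_top"
    proof -
      have "LIM x at_top. - (c * x) :> at_bot"
        using assms by (simp add: filterlim_uminus_at_top[symmetric] filterlim_tendsto_pos_mult_at_top[OF tendsto_const _ filterlim_ident])
      then have "((\<lambda>x. - exp (- (c * x)) / c) \<longlongrightarrow> - 0 / c) at_top"
        by (intro tendsto_intros filterlim_compose[OF exp_at_bot]) (use assms in auto)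
      then show ?thesis by simp
    qed
  qed (use assms in \<open>auto intro!: derivative_eq_intros\<close>)
  then have fin: "(\<integral>\<^sup>+x. ennreal (exp (- (c * x))) * indicator {0..} x \<partial>lborel) < \<infinity>" by simp
  show ?thesis
    unfolding integrable_Rplus_iff
  proof (rule integrableI_nonneg)
    have "(\<integral>\<^sup>+x. ennreal (indicator {0<..} x *\<^sub>R exp (- (c * x))) \<partial>lborel)
        \<le> (\<integral>\<^sup>+x. ennreal (exp (- (c * x))) * indicator {0..} x \<partial>lborel)"
      by (intro nn_integral_mono) (auto simp: indicator_def)
    then show "(\<integral>\<^sup>+x. ennreal (indicator {0<..} x *\<^sub>R exp (- (c * x))) \<partial>lborel) < \<infinity>"
      using fin by (rule le_less_trans)
  qed auto
qed

lemma C0_infinity_Rplus_integrable: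
  assumes "f \<in> C0_infinity_Rplus"
  shows "integrable Rplus f" "f \<in> L2 Rplus"
proof -
  obtain a b K where ab: "0 < a" "a \<le> b" "\<And>x. x \<notin> {a..b} \<Longrightarrow> f x = 0" "0 \<le> K" "\<And>x. cmod (f x) \<le> K"
    using C0_infinity_Rplus_obtain[OF assms] by metis
  have m: "f \<in> borel_measurable Rplus" by (intro measurable_Rplus C0_infinity_Rplus_measurable assms)
  have i: "integrable Rplus (\<lambda>x. C * indicator {a..b} x :: real)" if "0 \<le> C" for C
    using that by (intro integral_Rplus_le integrable_mult_right integrable_real_indicator)
      (auto simp: emeasure_lborel_Icc_eq indicator_def)
  show "integrable Rplus f"
    by (rule Bochner_Integration.integrable_bound[OF i[OF ab(4)] m])
       (use ab in \<open>auto intro!: AE_I2 simp: indicator_def\<close>)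
  show "f \<in> L2 Rplus"
    by (rule L2_dominated[OF m i[of "K\<^sup>2"]])
       (use ab in \<open>auto intro!: power_mono simp: indicator_def\<close>)
qed

lemma l2_subspace_C0_infinity: "l2_subspace Rplus C0_infinity_Rplus"
  unfolding l2_subspace_def
proof (intro conjI ballI allI)
  show "C0_infinity_Rplus \<subseteq> L2 Rplus" using C0_infinity_Rplus_integrable by blast
  show "(\<lambda>x. 0) \<in> C0_infinity_Rplus"
    by (rule C0_infinity_RplusI[of _ 1 1]) (auto intro: smooth_polynomial_function)
next
  fix f g assume fg: "f \<in> C0_infinity_Rplus" "g \<in> C0_infinity_Rplus"
  obtain a b K where ab: "0 < a" "a \<le> b" "\<And>x. x \<notin> {a..b} \<Longrightarrow> f x = 0" "0 \<le> K" "\<And>x. cmod (f x) \<le> K"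
    using C0_infinity_Rplus_obtain[OF fg(1)] by metis
  obtain a' b' K' where ab': "0 < a'" "a' \<le> b'" "\<And>x. x \<notin> {a'..b'} \<Longrightarrow> g x = 0" "0 \<le> K'" "\<And>x. cmod (g x) \<le> K'"
    using C0_infinity_Rplus_obtain[OF fg(2)] by metis
  show "(\<lambda>x. f x + g x) \<in> C0_infinity_Rplus"
  proof (rule C0_infinity_RplusI[of _ "min a a'" "max b b'"])
    show "smooth (\<lambda>x. f x + g x)" by (intro smooth_add C0_infinity_Rplus_smooth fg)
    fix x assume "x \<notin> {min a a'..max b b'}"
    then have "x \<notin> {a..b}" "x \<notin> {a'..b'}" by auto
    then show "f x + g x = 0" using ab(3)[of x] ab'(3)[of x] by simp
  qed (use ab(1) ab'(1) in simp)
next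
  fix c :: complex and f assume f: "f \<in> C0_infinity_Rplus"
  obtain a b K where ab: "0 < a" "a \<le> b" "\<And>x. x \<notin> {a..b} \<Longrightarrow> f x = 0" "0 \<le> K" "\<And>x. cmod (f x) \<le> K"
    using C0_infinity_Rplus_obtain[OF f] by metis
  show "(\<lambda>x. c * f x) \<in> C0_infinity_Rplus"
  proof (rule C0_infinity_RplusI[of _ a b])
    show "smooth (\<lambda>x. c * f x)"
      by (rule smooth_mult[OF smooth_polynomial_function C0_infinity_Rplus_smooth[OF f]]) simp
  qed (use ab(1,3) in simp_all)
qed

text \<open>
  Truncation in the variable and in the values reduces the claim to bounded functions with compact
  support in the open half-line. The approximants stay away from the origin if \<open>f\<close> does, and they are
  also close in \<open>L\<^sup>1\<close> if \<open>f\<close> is integrable: both are needed to control the Laplace transform of the error.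
\<close>

lemma test_function_approximation_Rplus:
  assumes f: "f \<in> L2 Rplus" and \<epsilon>: "0 \<le> \<epsilon>" and f0: "\<And>x. 0 < x \<Longrightarrow> x < \<epsilon> \<Longrightarrow> f x = 0" and e: "0 < e"
  shows "\<exists>\<phi>\<in>C0_infinity_Rplus. (\<forall>x<\<epsilon> / 2. \<phi> x = 0) \<and> (l2_norm Rplus (\<lambda>x. f x - \<phi> x))\<^sup>2 < e \<and>
     (integrable Rplus f \<longrightarrow> (LINT x|Rplus. cmod (f x - \<phi> x)) < e)"
proof -
  have fm[measurable]: "f \<in> borel_measurable Rplus" by (rule L2_measurable[OF f])
  define f0 where "f0 x = indicator {0<..} x *\<^sub>R f x" for x :: real
  have f0m[measurable]: "f0 \<in> borel_measurable borel"
    using fm unfolding borel_measurable_Rplus_iff f0_def .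
  define P where "P n x \<longleftrightarrow> max \<epsilon> (1 / real (Suc n)) \<le> x \<and> x \<le> real (Suc n) \<and> cmod (f0 x) \<le> real (Suc n)" for n x
  define F where "F n x = (if P n x then f0 x else 0)" for n x
  have Pm[measurable]: "Measurable.pred borel (P n)" for n unfolding P_def by measurable
  have Fm[measurable]: "F n \<in> borel_measurable borel" for n unfolding F_def by measurable
  have Fm'[measurable]: "F n \<in> borel_measurable Rplus" for n by (rule measurable_Rplus) simp
  have F_le: "cmod (f x - F n x) \<le> cmod (f x)" if "0 < x" for n x
    using that by (simp add: F_def f0_def)
  have F_lim: "(\<lambda>n. f x - F n x) \<longlonglongrightarrow> 0" if x: "0 < x" for x
  proof (cases "x < \<epsilon>")
    case True
    then have "f x - F n x = 0" for n using f0[OF x True] x by (simp add: F_def f0_def)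
    then show ?thesis by simp
  next
    case False
    obtain n0 where n0: "max x (max (1/x) (cmod (f0 x))) < real n0" using reals_Archimedean2 by blast
    have "P n x" if "n \<ge> n0" for n
    proof -
      have "real n0 \<le> real (Suc n)" using that by simp
      then have *: "x < real (Suc n)" "1 / x < real (Suc n)" "cmod (f0 x) < real (Suc n)" using n0 by auto
      then have "1 / real (Suc n) \<le> x" using x by (simp add: field_simps)
      then show ?thesis using * False by (simp add: P_def)
    qed
    then have "f x - F n x = 0" if "n \<ge> n0" for n
      using x that by (simp add: F_def f0_def)
    then have "eventually (\<lambda>n. f x - F n x = 0) sequentially"
      by (rule eventually_sequentiallyI)
    then show ?thesis by (rule tendsto_eventually)
  qed
  have l2lim: "(\<lambda>n. LINT x|Rplus. (cmod (f x - F n x))\<^sup>2) \<longlonglongrightarrow> (LINT x|Rplus. (cmod 0)\<^sup>2)"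
  proof (rule integral_dominated_convergence[OF _ _ L2_integrable[OF f]])
    show "AE x in Rplus. (\<lambda>n. (cmod (f x - F n x))\<^sup>2) \<longlonglongrightarrow> (cmod 0)\<^sup>2"
      by (rule AE_I2) (intro tendsto_intros F_lim, simp add: space_Rplus)
    show "AE x in Rplus. norm ((cmod (f x - F n x))\<^sup>2) \<le> (cmod (f x))\<^sup>2" for n
      by (rule AE_I2) (auto intro!: power_mono F_le simp: space_Rplus)
  qed measurable
  have l1lim: "(\<lambda>n. LINT x|Rplus. cmod (f x - F n x)) \<longlonglongrightarrow> (LINT x|Rplus. cmod 0)" if "integrable Rplus f"
  proof (rule integral_dominated_convergence[OF _ _ integrable_norm[OF that]])
    show "AE x in Rplus. (\<lambda>n. cmod (f x - F n x)) \<longlonglongrightarrow> cmod 0"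
      by (rule AE_I2) (intro tendsto_intros F_lim, simp add: space_Rplus)
    show "AE x in Rplus. norm (cmod (f x - F n x)) \<le> norm (f x)" for n
      by (rule AE_I2) (auto intro!: F_le simp: space_Rplus)
  qed measurable
  have "eventually (\<lambda>n. (LINT x|Rplus. (cmod (f x - F n x))\<^sup>2) < e / 4 \<and>
      (integrable Rplus f \<longrightarrow> (LINT x|Rplus. cmod (f x - F n x)) < e / 2)) sequentially"
    using order_tendstoD(2)[OF l2lim, of "e/4"] order_tendstoD(2)[OF l1lim, of "e/2"] e
    by (cases "integrable Rplus f") (auto intro: eventually_conj)
  then obtain n where n: "(LINT x|Rplus. (cmod (f x - F n x))\<^sup>2) < e / 4"
      "integrable Rplus f \<Longrightarrow> (LINT x|Rplus. cmod (f x - F n x)) < e / 2"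
    using eventually_happens'[OF sequentially_bot] by blast
  define a where "a = max \<epsilon> (1 / real (Suc n))"
  define b where "b = real (Suc n)"
  have a: "a > 0" by (simp add: a_def less_max_iff_disj)
  have \<epsilon>a: "\<epsilon> \<le> a" by (simp add: a_def)
  define \<Lambda> where "\<Lambda> = max a b + 1 - a / 2"
  have \<Lambda>: "\<Lambda> > 0" using a by (simp add: \<Lambda>_def)
  \<comment> \<open>On a set of measure \<open>\<Lambda>\<close>, smallness in \<open>L\<^sup>1\<close> follows from smallness in \<open>L\<^sup>2\<close> by \<open>2 z \<le> \<eta> + z\<^sup>2 / \<eta>\<close>.\<close>
  define \<eta> where "\<eta> = e / (2 * \<Lambda>)"
  have \<eta>: "\<eta> > 0" using e \<Lambda> by (simp add: \<eta>_def)
  have e': "0 < min (e / 4) (\<eta> * e / 2)" using e \<eta> by simp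
  have bd: "cmod (F n x) \<le> b" for x by (simp add: F_def P_def b_def)
  have sp: "F n x = 0" if "x \<notin> {a..max a b}" for x
    using that by (auto simp: F_def P_def a_def b_def)
  have "\<exists>\<phi>\<in>C0_infinity_Rplus. (\<forall>x. x \<notin> {a / 2..max a b + 1} \<longrightarrow> \<phi> x = 0) \<and>
      integrable lborel (\<lambda>x. (cmod (F n x - \<phi> x))\<^sup>2) \<and>
      (LINT x|lborel. (cmod (F n x - \<phi> x))\<^sup>2) < min (e / 4) (\<eta> * e / 2)"
    by (rule test_function_approximation[OF Fm bd sp _ _ _ e']) (use a in auto)
  then obtain \<phi> where \<phi>: "\<phi> \<in> C0_infinity_Rplus" "\<And>x. x \<notin> {a / 2..max a b + 1} \<Longrightarrow> \<phi> x = 0"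
      "integrable lborel (\<lambda>x. (cmod (F n x - \<phi> x))\<^sup>2)"
      "(LINT x|lborel. (cmod (F n x - \<phi> x))\<^sup>2) < min (e / 4) (\<eta> * e / 2)"
    by blast
  have \<phi>L: "\<phi> \<in> L2 Rplus" "integrable Rplus \<phi>" using C0_infinity_Rplus_integrable[OF \<phi>(1)] by auto
  have FL: "F n \<in> L2 Rplus"
  proof (rule L2_dominated[OF Fm' L2_integrable[OF f]])
    fix x assume "x \<in> space Rplus"
    then show "(cmod (F n x))\<^sup>2 \<le> (cmod (f x))\<^sup>2" by (simp add: F_def f0_def space_Rplus)
  qed
  let ?d = "\<lambda>x. F n x - \<phi> x"
  have d2: "(LINT x|Rplus. (cmod (?d x))\<^sup>2) < min (e / 4) (\<eta> * e / 2)"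
    using integral_Rplus_le(2)[OF \<phi>(3)] \<phi>(4) by simp
  have "(l2_norm Rplus (\<lambda>x. (f x - F n x) + (F n x - \<phi> x)))\<^sup>2
      \<le> 2 * (l2_norm Rplus (\<lambda>x. f x - F n x))\<^sup>2 + 2 * (l2_norm Rplus (\<lambda>x. F n x - \<phi> x))\<^sup>2"
    by (intro l2_norm_add_squared_le L2_diff f FL \<phi>L)
  also have "\<dots> < e" using n(1) d2 by (simp add: l2_norm_squared)
  finally have r1: "(l2_norm Rplus (\<lambda>x. f x - \<phi> x))\<^sup>2 < e" by simp
  have r2: "(LINT x|Rplus. cmod (f x - \<phi> x)) < e" if fi: "integrable Rplus f"
  proof -
    have Fi: "integrable Rplus (F n)"
      by (rule Bochner_Integration.integrable_bound[OF fi Fm'])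
         (auto intro!: AE_I2 simp: F_def f0_def space_Rplus)
    have di: "integrable Rplus ?d" by (intro Bochner_Integration.integrable_diff Fi \<phi>L)
    have ind: "integrable Rplus (\<lambda>x. \<eta> / 2 * indicator {a/2..max a b + 1} x :: real)"
      "(LINT x|Rplus. \<eta> / 2 * indicator {a/2..max a b + 1} x) \<le> (LINT x|lborel. \<eta> / 2 * indicator {a/2..max a b + 1} x :: real)"
      using \<eta> by (intro integral_Rplus_le integrable_mult_right integrable_real_indicator;
        auto simp: emeasure_lborel_Icc_eq indicator_def)+
    have d2i: "integrable Rplus (\<lambda>x. 1 / (2 * \<eta>) * (cmod (?d x))\<^sup>2)"
      by (intro integrable_mult_right L2_integrable L2_diff FL \<phi>L)
    have "(LINT x|Rplus. cmod (?d x)) \<le> (LINT x|Rplus. \<eta> / 2 * indicator {a/2..max a b + 1} x + 1 / (2 * \<eta>) * (cmod (?d x))\<^sup>2)"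
    proof (intro integral_mono Bochner_Integration.integrable_add integrable_norm di ind(1) d2i)
      fix x
      show "cmod (?d x) \<le> \<eta> / 2 * indicator {a/2..max a b + 1} x + 1 / (2 * \<eta>) * (cmod (?d x))\<^sup>2"
      proof (cases "x \<in> {a/2..max a b + 1}")
        case True
        have "0 \<le> (\<eta> - cmod (?d x))\<^sup>2" by simp
        then have "2 * \<eta> * cmod (?d x) \<le> \<eta>\<^sup>2 + (cmod (?d x))\<^sup>2" by (simp add: power2_diff)
        then show ?thesis using True \<eta> by (simp add: field_simps power2_eq_square)
      next
        case False
        then have "x \<notin> {a..max a b}" using a by auto
        then show ?thesis using False sp[of x] \<phi>(2)[OF False] by simp
      qed
    qed
    also have "\<dots> = (LINT x|Rplus. \<eta> / 2 * indicator {a/2..max a b + 1} x) + 1 / (2 * \<eta>) * (LINT x|Rplus. (cmod (?d x))\<^sup>2)"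
      using ind(1) d2i by simp
    also have "\<dots> < \<eta> / 2 * \<Lambda> + 1 / (2 * \<eta>) * (\<eta> * e / 2)"
    proof (rule add_le_less_mono)
      show "(LINT x|Rplus. \<eta> / 2 * indicator {a/2..max a b + 1} x) \<le> \<eta> / 2 * \<Lambda>"
      proof -
        have "a / 2 \<le> max a b + 1" using max.cobounded1[of a b] a by linarith
        then have "(LINT x|lborel. \<eta> / 2 * indicator {a/2..max a b + 1} x) = \<eta> / 2 * \<Lambda>"
          by (simp add: \<Lambda>_def)
        then show ?thesis using ind(2) by (simp only:)
      qed
      show "1 / (2 * \<eta>) * (LINT x|Rplus. (cmod (?d x))\<^sup>2) < 1 / (2 * \<eta>) * (\<eta> * e / 2)"
        using d2 \<eta> by (intro mult_strict_left_mono) auto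
    qed
    also have "\<dots> = e / 2" using \<eta> \<Lambda> by (simp add: \<eta>_def)
    finally have dd: "(LINT x|Rplus. cmod (?d x)) < e / 2" .
    have "(LINT x|Rplus. cmod (f x - \<phi> x)) \<le> (LINT x|Rplus. cmod (f x - F n x) + cmod (?d x))"
      by (intro integral_mono Bochner_Integration.integrable_add integrable_norm
           Bochner_Integration.integrable_diff fi Fi \<phi>L) (metis diff_add_cancel diff_add_eq norm_triangle_ineq add_diff_eq)
    also have "\<dots> = (LINT x|Rplus. cmod (f x - F n x)) + (LINT x|Rplus. cmod (?d x))"
      using fi Fi di by (intro Bochner_Integration.integral_add) auto
    also have "\<dots> < e" using n(2)[OF fi] dd by simp
    finally show ?thesis .
  qed
  have "\<phi> x = 0" if "x < \<epsilon> / 2" for x using \<phi>(2)[of x] that \<epsilon>a by auto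
  then show ?thesis using \<phi>(1) r1 r2 by blast
qed

lemma l2_dense_C0_infinity: "l2_dense Rplus C0_infinity_Rplus"
  unfolding l2_dense_def
proof (intro conjI ballI allI impI)
  show "C0_infinity_Rplus \<subseteq> L2 Rplus" using C0_infinity_Rplus_integrable by blast
  fix f and e :: real assume f: "f \<in> L2 Rplus" and e: "0 < e"
  have "\<exists>\<phi>\<in>C0_infinity_Rplus. (\<forall>x<0 / 2. \<phi> x = 0) \<and> (l2_norm Rplus (\<lambda>x. f x - \<phi> x))\<^sup>2 < e\<^sup>2 \<and>
     (integrable Rplus f \<longrightarrow> (LINT x|Rplus. cmod (f x - \<phi> x)) < e\<^sup>2)"
    by (rule test_function_approximation_Rplus[OF f]) (use e in auto)
  then obtain \<phi> where \<phi>: "\<phi> \<in> C0_infinity_Rplus" "(l2_norm Rplus (\<lambda>x. f x - \<phi> x))\<^sup>2 < e\<^sup>2" by blast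
  have "l2_norm Rplus (\<lambda>x. f x - \<phi> x) < e" using \<phi>(2) by (rule power2_less_imp_less) (use e in simp)
  with \<phi>(1) show "\<exists>g\<in>C0_infinity_Rplus. l2_norm Rplus (\<lambda>x. f x - g x) < e" by blast
qed

section \<open>The Laplace transform on L2\<close>

definition exponential :: "real \<Rightarrow> real \<Rightarrow> complex" where
  "exponential \<xi> t = complex_of_real (exp (- t * \<xi>))"

lemma norm_integral_le:
  fixes f :: "'a \<Rightarrow> 'b::{banach, second_countable_topology}"
  assumes "integrable M g" "AE x in M. norm (f x) \<le> g x"
  shows "norm (LINT x|M. f x) \<le> (LINT x|M. g x)"
proof (cases "integrable M f")
  case True
  have "norm (LINT x|M. f x) \<le> (LINT x|M. norm (f x))" by (rule integral_norm_bound)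
  also have "\<dots> \<le> (LINT x|M. g x)" using True assms by (intro integral_mono_AE) auto
  finally show ?thesis .
next
  case False
  have "AE x in M. 0 \<le> g x" using assms(2) by eventually_elim (rule order_trans[OF norm_ge_zero])
  then show ?thesis using False by (simp add: not_integrable_integral_eq integral_nonneg_AE)
qed

lemma exponential_measurable [measurable]: "exponential \<xi> \<in> borel_measurable M" if "(\<lambda>x. x) \<in> borel_measurable M"
  using that unfolding exponential_def by measurable

lemma exponential_L2:
  assumes "0 < \<xi>" shows "exponential \<xi> \<in> L2 Rplus"
proof (rule L2_dominated[OF exponential_measurable[OF measurable_ident_Rplus]])
  show "integrable Rplus (\<lambda>t. exp (- (2 * \<xi> * t)))"
    using integrable_exp_Rplus[of "2 * \<xi>"] assms by simp
  show "(cmod (exponential \<xi> t))\<^sup>2 \<le> exp (- (2 * \<xi> * t))" for t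
    by (simp add: exponential_def power2_eq_square mult_exp_exp algebra_simps)
qed

lemma laplace_eq_l2_inner: "laplace f \<xi> = l2_inner Rplus f (exponential \<xi>)"
  by (simp add: laplace_def l2_inner_def exponential_def mult.commute)

lemma laplace_integrable:
  assumes "f \<in> L2 Rplus" "0 < \<xi>"
  shows "integrable Rplus (\<lambda>t. complex_of_real (exp (- t * \<xi>)) * f t)"
  using L2_prod_integrable[OF assms(1) exponential_L2[OF assms(2)]]
  by (simp add: exponential_def mult.commute)

lemma laplace_add:
  assumes "f \<in> L2 Rplus" "g \<in> L2 Rplus" "0 < \<xi>"
  shows "laplace (\<lambda>t. f t + g t) \<xi> = laplace f \<xi> + laplace g \<xi>"
  unfolding laplace_eq_l2_inner
  by (rule sesquilinear_add_left[OF sesquilinear_on_l2_inner assms(1,2) exponential_L2[OF assms(3)]])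

lemma laplace_mult:
  assumes "f \<in> L2 Rplus" "0 < \<xi>"
  shows "laplace (\<lambda>t. c * f t) \<xi> = c * laplace f \<xi>"
  unfolding laplace_eq_l2_inner
  by (rule sesquilinear_mult_left[OF sesquilinear_on_l2_inner assms(1) exponential_L2[OF assms(2)]])

lemma laplace_diff:
  assumes "f \<in> L2 Rplus" "g \<in> L2 Rplus" "0 < \<xi>"
  shows "laplace (\<lambda>t. f t - g t) \<xi> = laplace f \<xi> - laplace g \<xi>"
  unfolding laplace_eq_l2_inner
  by (rule sesquilinear_diff_left[OF sesquilinear_on_l2_inner l2_subspace_L2 assms(1,2) exponential_L2[OF assms(3)]])

text \<open>
  For \<open>\<xi> > 0\<close> the exponential is in \<open>L\<^sup>2\<close>, so that the value of the transform at \<open>\<xi>\<close> is a bounded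
  functional.
\<close>

lemma laplace_tendsto:
  assumes u: "\<And>n. u n \<in> L2 Rplus" and f: "f \<in> L2 Rplus"
    and lim: "(\<lambda>n. l2_norm Rplus (\<lambda>t. u n t - f t)) \<longlonglongrightarrow> 0" and \<xi>: "0 < \<xi>"
  shows "(\<lambda>n. laplace (u n) \<xi>) \<longlonglongrightarrow> laplace f \<xi>"
proof (rule LIM_zero_cancel, rule Lim_null_comparison)
  show "eventually (\<lambda>n. cmod (laplace (u n) \<xi> - laplace f \<xi>)
      \<le> l2_norm Rplus (\<lambda>t. u n t - f t) * l2_norm Rplus (exponential \<xi>)) sequentially"
    unfolding laplace_diff[OF u f \<xi>, symmetric] unfolding laplace_eq_l2_inner
    by (intro always_eventually allI L2_Cauchy_Schwarz L2_diff u f exponential_L2 \<xi>)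
  show "(\<lambda>n. l2_norm Rplus (\<lambda>t. u n t - f t) * l2_norm Rplus (exponential \<xi>)) \<longlonglongrightarrow> 0"
    by (rule tendsto_mult_left_zero[OF lim])
qed

lemma laplace_cong_AE:
  assumes "f \<in> borel_measurable Rplus" "g \<in> borel_measurable Rplus" "AE t in Rplus. f t = g t"
  shows "laplace f \<xi> = laplace g \<xi>"
  unfolding laplace_def
proof (rule integral_cong_AE)
  show "AE t in Rplus. complex_of_real (exp (- t * \<xi>)) * f t = complex_of_real (exp (- t * \<xi>)) * g t"
    using assms(3) by eventually_elim simp
qed (use assms(1,2) measurable_ident_Rplus in measurable)

lemma laplace_measurable:
  assumes [measurable]: "f \<in> borel_measurable Rplus"
  shows "laplace f \<in> borel_measurable borel"
proof -
  note [measurable] = measurable_ident_Rplus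
  show ?thesis unfolding laplace_def by measurable
qed

lemma laplace_bound_L1:
  assumes g: "integrable Rplus g" and g0: "\<And>t. 0 < t \<Longrightarrow> t < \<epsilon> \<Longrightarrow> g t = 0" and \<xi>: "0 < \<xi>"
  shows "cmod (laplace g \<xi>) \<le> exp (- (\<epsilon> * \<xi>)) * (LINT t|Rplus. cmod (g t))"
proof -
  have "cmod (laplace g \<xi>) \<le> (LINT t|Rplus. exp (- (\<epsilon> * \<xi>)) * cmod (g t))"
    unfolding laplace_def
  proof (rule norm_integral_le)
    show "integrable Rplus (\<lambda>t. exp (- (\<epsilon> * \<xi>)) * cmod (g t))" using g by simp
    show "AE t in Rplus. norm (complex_of_real (exp (- t * \<xi>)) * g t) \<le> exp (- (\<epsilon> * \<xi>)) * cmod (g t)"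
    proof (rule AE_I2)
      fix t assume "t \<in> space Rplus"
      then have t: "0 < t" by (simp add: space_Rplus)
      show "norm (complex_of_real (exp (- t * \<xi>)) * g t) \<le> exp (- (\<epsilon> * \<xi>)) * cmod (g t)"
      proof (cases "t < \<epsilon>")
        case False
        then have "exp (- t * \<xi>) \<le> exp (- (\<epsilon> * \<xi>))" using \<xi> by simp
        then show ?thesis by (simp add: norm_mult mult_right_mono)
      qed (use g0 t in simp)
    qed
  qed
  then show ?thesis by simp
qed

lemma integrable_prod_mult:
  fixes f :: "'a \<Rightarrow> 'c::{real_normed_field, banach, second_countable_topology}" and g :: "'b \<Rightarrow> 'c"
  assumes "sigma_finite_measure M1" "sigma_finite_measure M2" and f: "integrable M1 f" and g: "integrable M2 g"
  shows "integrable (M1 \<Otimes>\<^sub>M M2) (\<lambda>p. f (fst p) * g (snd p))"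
    and "(LINT p|(M1 \<Otimes>\<^sub>M M2). f (fst p) * g (snd p)) = (LINT x|M1. f x) * (LINT y|M2. g y)"
proof -
  interpret pair_sigma_finite M1 M2 using assms(1,2) by (simp add: pair_sigma_finite_def)
  have [measurable]: "f \<in> borel_measurable M1" "g \<in> borel_measurable M2" using f g by auto
  show i: "integrable (M1 \<Otimes>\<^sub>M M2) (\<lambda>p. f (fst p) * g (snd p))"
  proof (rule Fubini_integrable)
    show "integrable M1 (\<lambda>x. LINT y|M2. norm (f (fst (x, y)) * g (snd (x, y))))"
      using f by (simp add: norm_mult)
  qed (use g in simp_all)
  show "(LINT p|(M1 \<Otimes>\<^sub>M M2). f (fst p) * g (snd p)) = (LINT x|M1. f x) * (LINT y|M2. g y)"
    using integral_fst'[OF i] by simp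
qed

subsection \<open>Injectivity\<close>

lemma AE_lborel_obtain_in_interval:
  fixes a b :: real
  assumes "AE x in lborel. P x" "a < b" obtains x where "a < x" "x < b" "P x"
proof -
  have "\<not> (AE x in lborel. x \<notin> {a<..<b})"
  proof
    assume "AE x in lborel. x \<notin> {a<..<b}"
    then have "emeasure lborel {x \<in> space lborel. \<not> x \<notin> {a<..<b}} = 0"
      by (subst (asm) AE_iff_measurable[OF _ refl]) auto
    moreover have "{x \<in> space lborel. \<not> x \<notin> {a<..<b}} = {a<..<b}" by auto
    ultimately show False using assms(2) by (simp only: emeasure_lborel_Ioo) simp
  qed
  then have "\<exists>x\<in>{a<..<b}. P x" using assms(1) by (metis (mono_tags, lifting) AE_mp AE_I2)
  then show ?thesis using that by auto
qed

text \<open>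
  Complex polynomials are split into real and imaginary parts, because only real polynomial functions
  come with an expansion into monomials.
\<close>

lemma polynomial_moments_zero:
  fixes p :: "real \<Rightarrow> complex" and w :: "'a \<Rightarrow> real"
  assumes p: "polynomial_function p" and int: "\<And>n::nat. integrable M (\<lambda>x. complex_of_real (w x ^ n) * k x)"
    and zero: "\<And>n. (LINT x|M. complex_of_real (w x ^ n) * k x) = 0"
  shows "integrable M (\<lambda>x. p (w x) * k x)" "(LINT x|M. p (w x) * k x) = 0"
proof -
  have real: "has_bochner_integral M (\<lambda>x. complex_of_real (r (w x)) * k x) 0"
    if "real_polynomial_function r" for r
  proof -
    obtain a n where r: "r = (\<lambda>x. \<Sum>i\<le>n. a i * x ^ i)"
      using \<open>real_polynomial_function r\<close> unfolding real_polynomial_function_iff_sum by blast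
    have "has_bochner_integral M (\<lambda>x. complex_of_real (w x ^ i) * k x) 0" for i
      using int[of i] zero[of i] by (simp add: has_bochner_integral_iff)
    then have "has_bochner_integral M (\<lambda>x. \<Sum>i\<le>n. complex_of_real (a i) * (complex_of_real (w x ^ i) * k x)) (\<Sum>i\<le>n. complex_of_real (a i) * 0)"
      by (intro has_bochner_integral_sum has_bochner_integral_mult_right)
    then show ?thesis by (simp add: r sum_distrib_right mult.assoc)
  qed
  have "real_polynomial_function (\<lambda>x. Re (p x))" "real_polynomial_function (\<lambda>x. Im (p x))"
    using p bounded_linear_Re bounded_linear_Im unfolding polynomial_function_def o_def by blast+
  then have "has_bochner_integral M (\<lambda>x. complex_of_real (Re (p (w x))) * k x + \<i> * (complex_of_real (Im (p (w x))) * k x)) (0 + \<i> * 0)"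
    by (intro has_bochner_integral_add has_bochner_integral_mult_right real)
  moreover have "complex_of_real (Re (p (w x))) * k x + \<i> * (complex_of_real (Im (p (w x))) * k x) = p (w x) * k x" for x
    by (subst (3) complex_eq) (simp add: algebra_simps)
  ultimately have "has_bochner_integral M (\<lambda>x. p (w x) * k x) 0" by simp
  then show "integrable M (\<lambda>x. p (w x) * k x)" "(LINT x|M. p (w x) * k x) = 0"
    by (auto simp: has_bochner_integral_iff)
qed

text \<open>
  If the transform vanishes at \<open>c, c + 1, c + 2, \<dots>\<close>, then \<open>k t = exp (- c t) f t\<close> annihilates all
  polynomials in \<open>exp (- t)\<close>, hence by Weierstrass all test functions.
\<close>

lemma laplace_injective:
  assumes f: "f \<in> L2 Rplus" and \<alpha>: "0 \<le> \<alpha>" and zero: "AE \<xi> in lborel. \<alpha> < \<xi> \<longrightarrow> laplace f \<xi> = 0"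
  shows "AE t in Rplus. f t = 0"
proof -
  have fm[measurable]: "f \<in> borel_measurable Rplus" by (rule L2_measurable[OF f])
  have [measurable]: "laplace f \<in> borel_measurable borel" by (rule laplace_measurable) simp
  have "AE \<xi> in lborel. \<forall>n::nat. \<alpha> < real n + 1 * \<xi> \<longrightarrow> laplace f (real n + 1 * \<xi>) = 0"
    unfolding AE_all_countable by (intro allI AE_borel_affine zero) auto
  then obtain c where c: "\<alpha> < c" "\<And>n::nat. \<alpha> < real n + 1 * c \<longrightarrow> laplace f (real n + 1 * c) = 0"
    by (rule AE_lborel_obtain_in_interval[of _ \<alpha> "\<alpha> + 1"]) auto
  have c0: "0 < c" using \<alpha> c(1) by simp
  define k where "k t = complex_of_real (exp (- t * c)) * f t" for t
  have k1: "integrable Rplus k" unfolding k_def by (rule laplace_integrable[OF f c0])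
  have km[measurable]: "k \<in> borel_measurable Rplus" using k1 by (rule borel_measurable_integrable)
  have k2: "k \<in> L2 Rplus"
  proof (rule L2_dominated[OF km L2_integrable[OF f]])
    fix t assume "t \<in> space Rplus"
    then have "exp (- t * c) \<le> 1" using c0 by (simp add: space_Rplus)
    then have "cmod (k t) \<le> 1 * cmod (f t)" unfolding k_def norm_mult by (intro mult_right_mono) auto
    then show "(cmod (k t))\<^sup>2 \<le> (cmod (f t))\<^sup>2" by (simp add: power_mono)
  qed
  have pw: "complex_of_real (exp (- t) ^ n) * k t = complex_of_real (exp (- t * (real n + c))) * f t" for n t
    by (simp add: k_def exp_of_nat_mult[symmetric] algebra_simps mult_exp_exp flip: of_real_mult)
  have mi: "integrable Rplus (\<lambda>t. complex_of_real (exp (- t) ^ n) * k t)" for n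
    unfolding pw by (rule laplace_integrable[OF f]) (use c0 in simp)
  have mz: "(LINT t|Rplus. complex_of_real (exp (- t) ^ n) * k t) = 0" for n
    using c(2)[of n] c(1) unfolding pw laplace_def by simp
  have "AE t in Rplus. k t = 0"
  proof (rule l2_dense_orthogonal_AE_0[OF l2_dense_C0_infinity k2])
    fix v assume v: "v \<in> C0_infinity_Rplus"
    obtain a b K where ab: "0 < a" "a \<le> b" "\<And>x. x \<notin> {a..b} \<Longrightarrow> v x = 0" "0 \<le> K" "\<And>x. cmod (v x) \<le> K"
      using C0_infinity_Rplus_obtain[OF v] by metis
    define G where "G x = cnj (v (- ln (max x (exp (- (b + 1))))))" for x
    have cv: "continuous_on UNIV v" by (intro smooth_continuous C0_infinity_Rplus_smooth v)
    have pos: "0 < max x (exp (- (b + 1)))" for x :: real by (simp add: less_max_iff_disj)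
    have "continuous_on {0..1} (\<lambda>x. - ln (max x (exp (- (b + 1)))))"
      by (intro continuous_on_minus continuous_on_ln continuous_on_max continuous_on_id continuous_on_const ballI
          pos[THEN less_imp_neq, THEN not_sym])
    from continuous_on_compose2[OF cv this subset_UNIV]
    have cG: "continuous_on {0..1} G" unfolding G_def by (rule continuous_on_cnj)
    have Gv: "G (exp (- t)) = cnj (v t)" for t
    proof (cases "t \<le> b + 1")
      case True
      then have "max (exp (- t)) (exp (- (b + 1))) = exp (- t)" by (intro max_absorb1) simp
      then show ?thesis by (simp add: G_def)
    next
      case False
      then have "max (exp (- t)) (exp (- (b + 1))) = exp (- (b + 1))" by (intro max_absorb2) simp
      then show ?thesis using ab(3)[of t] ab(3)[of "b + 1"] False by (simp add: G_def add.commute)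
    qed
    have vL: "v \<in> L2 Rplus" using C0_infinity_Rplus_integrable[OF v] by simp
    have ki: "integrable Rplus (\<lambda>t. k t * cnj (v t))" by (rule L2_prod_integrable[OF k2 vL])
    let ?N = "LINT t|Rplus. cmod (k t)"
    have bound: "cmod (l2_inner Rplus k v) \<le> \<delta> * ?N" if \<delta>: "0 < \<delta>" for \<delta>
    proof -
      obtain p where p: "polynomial_function p" "\<And>x. x \<in> {0..1} \<Longrightarrow> cmod (G x - p x) < \<delta>"
        using Stone_Weierstrass_polynomial_function[OF compact_Icc cG \<delta>] by metis
      note pz = polynomial_moments_zero[where w = "\<lambda>t. exp (- t)", OF p(1) mi mz]
      have "l2_inner Rplus k v = (LINT t|Rplus. k t * cnj (v t)) - (LINT t|Rplus. p (exp (- t)) * k t)"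
        unfolding pz(2) by (simp add: l2_inner_def)
      also have "\<dots> = (LINT t|Rplus. k t * cnj (v t) - p (exp (- t)) * k t)"
        by (rule Bochner_Integration.integral_diff[OF ki pz(1), symmetric])
      finally have eq: "l2_inner Rplus k v = (LINT t|Rplus. k t * cnj (v t) - p (exp (- t)) * k t)" .
      have "cmod (l2_inner Rplus k v) \<le> (LINT t|Rplus. \<delta> * cmod (k t))"
        unfolding eq
      proof (rule norm_integral_le)
        show "integrable Rplus (\<lambda>t. \<delta> * cmod (k t))" using k1 by simp
        show "AE t in Rplus. cmod (k t * cnj (v t) - p (exp (- t)) * k t) \<le> \<delta> * cmod (k t)"
        proof (rule AE_I2)
          fix t assume "t \<in> space Rplus"
          then have "exp (- t) \<in> {0..1}" by (simp add: space_Rplus)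
          then have "cmod (G (exp (- t)) - p (exp (- t))) \<le> \<delta>" by (intro less_imp_le p(2))
          moreover have "k t * cnj (v t) - p (exp (- t)) * k t = (G (exp (- t)) - p (exp (- t))) * k t"
            by (simp add: Gv algebra_simps)
          ultimately show "cmod (k t * cnj (v t) - p (exp (- t)) * k t) \<le> \<delta> * cmod (k t)"
            by (simp add: norm_mult mult_right_mono)
        qed
      qed
      then show ?thesis by simp
    qed
    have N: "0 \<le> ?N" by simp
    have "cmod (l2_inner Rplus k v) \<le> 0"
    proof (rule field_le_epsilon)
      fix e :: real assume "0 < e"
      have N1: "0 < ?N + 1" using N by linarith
      have "cmod (l2_inner Rplus k v) \<le> e / (?N + 1) * ?N" by (intro bound divide_pos_pos \<open>0 < e\<close> N1)
      also have "\<dots> \<le> e / (?N + 1) * (?N + 1)"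
        using N1 \<open>0 < e\<close> by (intro mult_left_mono divide_nonneg_pos) auto
      also have "\<dots> = e" using N1 by simp
      finally show "cmod (l2_inner Rplus k v) \<le> 0 + e" by simp
    qed
    then show "l2_inner Rplus k v = 0" by simp
  qed
  then show ?thesis by eventually_elim (simp add: k_def)
qed

section \<open>The weighted Laplace form\<close>

locale quasi_carleman =
  fixes r q \<alpha> :: real
  assumes r_nonneg: "0 \<le> r" and q_pos: "0 < q" and \<alpha>_nonneg: "0 \<le> \<alpha>"
begin

definition weight :: "real \<Rightarrow> real" where
  "weight \<xi> = pos_power (\<xi> - \<alpha>) (q - 1) * exp (- r * \<xi>)"

text \<open>
  The Laplace transform multiplied by the root of the weight. It is linear on \<open>L\<^sup>2\<close> and turns the form
  into a multiple of a squared \<open>L\<^sup>2\<close> norm over the line: outside \<open>(\<alpha>, \<infinity>)\<close>, where the transform need not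
  exist, the weight vanishes.
\<close>

definition W :: "(real \<Rightarrow> complex) \<Rightarrow> real \<Rightarrow> complex" where
  "W f \<xi> = complex_of_real (sqrt (weight \<xi>)) * laplace f \<xi>"

definition C :: real where
  "C = exp (\<alpha> * r) / Gamma q"

abbreviation Dom :: "(real \<Rightarrow> complex) set" where
  "Dom \<equiv> laplace_form_domain r q \<alpha>"

abbreviation Q :: "(real \<Rightarrow> complex) \<Rightarrow> complex" where
  "Q \<equiv> laplace_form r q \<alpha>"

definition B :: "(real \<Rightarrow> complex) \<Rightarrow> (real \<Rightarrow> complex) \<Rightarrow> complex" where
  "B u v = complex_of_real C * l2_inner lborel (W u) (W v)"

lemma C_pos: "0 < C"
  using Gamma_real_pos[OF q_pos] by (simp add: C_def)

lemma weight_nonneg: "0 \<le> weight \<xi>"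
  by (simp add: weight_def pos_power_def)

lemma weight_eq_0: "\<xi> \<le> \<alpha> \<Longrightarrow> weight \<xi> = 0"
  by (simp add: weight_def pos_power_def)

lemma weight_pos: "\<alpha> < \<xi> \<Longrightarrow> 0 < weight \<xi>"
  by (simp add: weight_def pos_power_def)

lemma weight_measurable [measurable]: "weight \<in> borel_measurable borel"
  unfolding weight_def pos_power_def by measurable

lemma laplace_integrand_eq: "laplace_integrand r q \<alpha> f \<xi> = (cmod (W f \<xi>))\<^sup>2"
  by (simp add: laplace_integrand_def W_def norm_mult power_mult_distrib weight_nonneg)
    (simp add: weight_def)

lemma laplace_form_eq: "Q f = complex_of_real (C * (l2_norm lborel (W f))\<^sup>2)"
  by (simp add: laplace_form_def laplace_integrand_eq l2_norm_squared C_def)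

lemma W_measurable:
  assumes "f \<in> L2 Rplus" shows "W f \<in> borel_measurable lborel"
proof -
  have [measurable]: "laplace f \<in> borel_measurable borel"
    by (rule laplace_measurable[OF L2_measurable[OF assms]])
  have "(\<lambda>\<xi>. complex_of_real (sqrt (weight \<xi>)) * laplace f \<xi>) \<in> borel_measurable borel"
    by (intro borel_measurable_times borel_measurable_of_real borel_measurable_sqrt) measurable
  then show ?thesis by (simp add: W_def[abs_def])
qed

lemma Dom_iff: "f \<in> Dom \<longleftrightarrow> f \<in> L2 Rplus \<and> W f \<in> L2 lborel"
proof -
  have "laplace_integrand r q \<alpha> f = (\<lambda>\<xi>. (cmod (W f \<xi>))\<^sup>2)" by (rule ext) (rule laplace_integrand_eq)
  then show ?thesis
    using W_measurable[of f] unfolding laplace_form_domain_def L2_def[of lborel] by auto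
qed

lemma Dom_L2: "f \<in> Dom \<Longrightarrow> f \<in> L2 Rplus" and Dom_W: "f \<in> Dom \<Longrightarrow> W f \<in> L2 lborel"
  by (simp_all add: Dom_iff)

lemma W_add:
  assumes "f \<in> L2 Rplus" "g \<in> L2 Rplus"
  shows "W (\<lambda>t. f t + g t) = (\<lambda>\<xi>. W f \<xi> + W g \<xi>)"
proof
  fix \<xi> show "W (\<lambda>t. f t + g t) \<xi> = W f \<xi> + W g \<xi>"
  proof (cases "\<xi> \<le> \<alpha>")
    case False
    then have "0 < \<xi>" using \<alpha>_nonneg by simp
    then show ?thesis using laplace_add[OF assms] by (simp add: W_def algebra_simps)
  qed (simp add: W_def weight_eq_0)
qed

lemma W_mult:
  assumes "f \<in> L2 Rplus"
  shows "W (\<lambda>t. c * f t) = (\<lambda>\<xi>. c * W f \<xi>)"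
proof
  fix \<xi> show "W (\<lambda>t. c * f t) \<xi> = c * W f \<xi>"
  proof (cases "\<xi> \<le> \<alpha>")
    case False
    then have "0 < \<xi>" using \<alpha>_nonneg by simp
    then show ?thesis using laplace_mult[OF assms] by (simp add: W_def algebra_simps)
  qed (simp add: W_def weight_eq_0)
qed

lemma W_diff:
  assumes "f \<in> L2 Rplus" "g \<in> L2 Rplus"
  shows "W (\<lambda>t. f t - g t) = (\<lambda>\<xi>. W f \<xi> - W g \<xi>)"
  using W_add[OF assms(1) L2_cmult[OF assms(2)], of "-1"] W_mult[OF assms(2), of "-1"] by simp

lemma W_tendsto:
  assumes "\<And>n. u n \<in> L2 Rplus" "f \<in> L2 Rplus"
    "(\<lambda>n. l2_norm Rplus (\<lambda>t. u n t - f t)) \<longlonglongrightarrow> 0"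
  shows "(\<lambda>n. W (u n) \<xi>) \<longlonglongrightarrow> W f \<xi>"
proof (cases "\<xi> \<le> \<alpha>")
  case False
  then have "0 < \<xi>" using \<alpha>_nonneg by simp
  then show ?thesis unfolding W_def by (intro tendsto_intros laplace_tendsto assms)
qed (simp add: W_def weight_eq_0)

lemma l2_subspace_Dom: "l2_subspace Rplus Dom"
  unfolding l2_subspace_def
proof (intro conjI ballI allI)
  show "Dom \<subseteq> L2 Rplus" using Dom_L2 by blast
  have "(\<lambda>x. 0) \<in> L2 Rplus" by (rule l2_subspace_zero[OF l2_subspace_L2])
  moreover have "W (\<lambda>x. 0) = (\<lambda>x. 0)" by (simp add: W_def laplace_def fun_eq_iff)
  ultimately show "(\<lambda>x. 0) \<in> Dom" by (simp add: Dom_iff l2_subspace_zero[OF l2_subspace_L2])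
qed (simp_all add: Dom_iff W_add W_mult L2_add L2_cmult)

lemma semi_inner_B: "semi_inner Rplus Dom B"
  unfolding semi_inner_def
proof (intro conjI ballI)
  show "l2_subspace Rplus Dom" by (rule l2_subspace_Dom)
  note S = sesquilinear_on_l2_inner[of lborel]
  show "sesquilinear_on Dom B"
    unfolding sesquilinear_on_def B_def
    by (intro conjI ballI allI)
      (simp_all add: W_add W_mult Dom_L2 Dom_W sesquilinear_add_left[OF S] sesquilinear_add_right[OF S]
        sesquilinear_mult_left[OF S] sesquilinear_mult_right[OF S] algebra_simps)
  fix u assume "u \<in> Dom"
  show "B u u \<in> \<real>" "0 \<le> Re (B u u)"
    unfolding B_def l2_inner_self using C_pos by (simp_all flip: of_real_mult of_real_power)
qed

lemma Q_eq_B: "Q u = B u u"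
  unfolding laplace_form_eq B_def l2_inner_self by simp

lemma W_cong_AE:
  assumes "u \<in> L2 Rplus" "v \<in> L2 Rplus" "AE x in Rplus. u x = v x" shows "W u = W v"
  using laplace_cong_AE[OF L2_measurable[OF assms(1)] L2_measurable[OF assms(2)] assms(3)]
  by (simp add: W_def fun_eq_iff)

lemma nonneg_form_subspace:
  assumes D: "l2_subspace Rplus D" "D \<subseteq> Dom" and P: "\<And>u. u \<in> D \<Longrightarrow> P u = Q u"
  shows "nonneg_form Rplus D P"
  unfolding nonneg_form_def
proof (intro conjI ballI impI)
  note SB = semi_inner_subset[OF semi_inner_B D]
  show "l2_subspace Rplus D" by fact
  show "\<exists>B. sesquilinear_on D B \<and> (\<forall>u\<in>D. P u = B u u)"
    using semi_inner_sesquilinear[OF SB] P Q_eq_B by auto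
  fix u assume u: "u \<in> D"
  show "P u \<in> \<real>" "0 \<le> Re (P u)"
    using semi_inner_real[OF SB u] semi_inner_nonneg[OF SB u] by (simp_all add: P[OF u] Q_eq_B)
  fix v assume v: "v \<in> D" and uv: "AE x in Rplus. u x = v x"
  have "W u = W v" using u v D(2) by (intro W_cong_AE uv Dom_L2) auto
  then show "P u = P v" by (simp add: P[OF u] P[OF v] laplace_form_eq)
qed

text \<open>
  \<open>L\<^sup>2\<close>-convergence of \<open>u\<^sub>n\<close> forces pointwise convergence of the transforms, so Fatou's lemma passes to
  the limit in the Cauchy condition.
\<close>

lemma form_converges_Dom:
  assumes conv: "form_converges Rplus Dom Q u f"
  shows "f \<in> Dom" "(\<lambda>n. Q (\<lambda>x. u n x - f x)) \<longlonglongrightarrow> 0"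
proof -
  have u: "u n \<in> Dom" for n using conv unfolding form_converges_def by blast
  have f: "f \<in> L2 Rplus" and lim: "(\<lambda>n. l2_norm Rplus (\<lambda>x. u n x - f x)) \<longlonglongrightarrow> 0"
    using conv unfolding form_converges_def by blast+
  have uL: "u n \<in> L2 Rplus" and uW: "W (u n) \<in> L2 lborel" for n using u Dom_L2 Dom_W by blast+
  have [measurable]: "W (u n) \<in> borel_measurable lborel" "W f \<in> borel_measurable lborel" for n
    by (rule W_measurable[OF uL], rule W_measurable[OF f])
  have Qd: "cmod (Q (\<lambda>x. u m x - u n x)) = C * (LINT \<xi>|lborel. (cmod (W (u m) \<xi> - W (u n) \<xi>))\<^sup>2)" for m n
    unfolding laplace_form_eq W_diff[OF uL uL] l2_norm_squared norm_of_real using C_pos by (simp add: abs_mult)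
  have cauchy: "\<exists>N. \<forall>m\<ge>N. \<forall>n\<ge>N. (LINT \<xi>|lborel. (cmod (W (u m) \<xi> - W (u n) \<xi>))\<^sup>2) < e" if e: "0 < e" for e
  proof -
    have "\<exists>N. \<forall>m\<ge>N. \<forall>n\<ge>N. cmod (Q (\<lambda>x. u m x - u n x)) < C * e"
      using conv mult_pos_pos[OF C_pos e] unfolding form_converges_def by blast
    then show ?thesis unfolding Qd using C_pos by simp
  qed
  have bound: "integrable lborel (\<lambda>\<xi>. (cmod (W (u n) \<xi> - W f \<xi>))\<^sup>2)"
      "(LINT \<xi>|lborel. (cmod (W (u n) \<xi> - W f \<xi>))\<^sup>2) \<le> e"
    if N: "\<forall>m\<ge>N. (LINT \<xi>|lborel. (cmod (W (u n) \<xi> - W (u m) \<xi>))\<^sup>2) < e" for n N e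
  proof -
    have i: "integrable lborel (\<lambda>\<xi>. (cmod (W (u n) \<xi> - W (u m) \<xi>))\<^sup>2)" for m
      by (rule L2_integrable[OF L2_diff[OF uW uW]])
    have l: "AE \<xi> in lborel. (\<lambda>m. (cmod (W (u n) \<xi> - W (u m) \<xi>))\<^sup>2) \<longlonglongrightarrow> (cmod (W (u n) \<xi> - W f \<xi>))\<^sup>2"
      by (intro AE_I2 tendsto_intros W_tendsto uL f lim)
    have "eventually (\<lambda>m. (LINT \<xi>|lborel. (cmod (W (u n) \<xi> - W (u m) \<xi>))\<^sup>2) \<le> e) sequentially"
      using N by (intro eventually_sequentiallyI[of N]) (simp add: less_imp_le)
    from Fatou_integral_bound[OF i _ _ l this]
    show "integrable lborel (\<lambda>\<xi>. (cmod (W (u n) \<xi> - W f \<xi>))\<^sup>2)"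
      "(LINT \<xi>|lborel. (cmod (W (u n) \<xi> - W f \<xi>))\<^sup>2) \<le> e" by auto
  qed
  obtain N where "\<forall>m\<ge>N. \<forall>n\<ge>N. (LINT \<xi>|lborel. (cmod (W (u m) \<xi> - W (u n) \<xi>))\<^sup>2) < 1"
    using cauchy[of 1] by auto
  then have "integrable lborel (\<lambda>\<xi>. (cmod (W (u N) \<xi> - W f \<xi>))\<^sup>2)" using bound(1)[of N N 1] by simp
  then have "(\<lambda>\<xi>. W (u N) \<xi> - W f \<xi>) \<in> L2 lborel" by (simp add: L2_def)
  from L2_diff[OF uW[of N] this] have "W f \<in> L2 lborel" by simp
  then show "f \<in> Dom" using f by (simp add: Dom_iff)
  have "(\<lambda>n. LINT \<xi>|lborel. (cmod (W (u n) \<xi> - W f \<xi>))\<^sup>2) \<longlonglongrightarrow> 0"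
  proof (rule LIMSEQ_I)
    fix e :: real assume e: "e > 0"
    then obtain N where N: "\<forall>m\<ge>N. \<forall>n\<ge>N. (LINT \<xi>|lborel. (cmod (W (u m) \<xi> - W (u n) \<xi>))\<^sup>2) < e / 2"
      using cauchy[of "e/2"] by auto
    show "\<exists>N. \<forall>n\<ge>N. norm ((LINT \<xi>|lborel. (cmod (W (u n) \<xi> - W f \<xi>))\<^sup>2) - 0) < e"
    proof (intro exI[of _ N] allI impI)
      fix n assume "N \<le> n"
      then have "(LINT \<xi>|lborel. (cmod (W (u n) \<xi> - W f \<xi>))\<^sup>2) \<le> e / 2"
        using N by (intro bound(2)[of N]) blast
      moreover have "0 \<le> (LINT \<xi>|lborel. (cmod (W (u n) \<xi> - W f \<xi>))\<^sup>2)" by simp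
      ultimately show "norm ((LINT \<xi>|lborel. (cmod (W (u n) \<xi> - W f \<xi>))\<^sup>2) - 0) < e"
        using e by simp
    qed
  qed
  then have "(\<lambda>n. complex_of_real (C * (LINT \<xi>|lborel. (cmod (W (u n) \<xi> - W f \<xi>))\<^sup>2))) \<longlonglongrightarrow> complex_of_real (C * 0)"
    by (intro tendsto_intros)
  then show "(\<lambda>n. Q (\<lambda>x. u n x - f x)) \<longlonglongrightarrow> 0"
    unfolding laplace_form_eq W_diff[OF uL f] l2_norm_squared by simp
qed

lemma closed_form_Dom: "closed_form Rplus Dom Q"
  unfolding closed_form_def
  using nonneg_form_subspace[OF l2_subspace_Dom subset_refl, of Q] form_converges_Dom by simp

subsection \<open>The Hankel form\<close>

text \<open>
  The substitution \<open>t = (r + c) (\<xi> - \<alpha>)\<close> turns the integral into Euler's integral for the gamma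
  function.
\<close>

lemma weight_exp_integral:
  assumes c: "0 < c"
  shows "has_bochner_integral lborel (\<lambda>\<xi>. weight \<xi> * exp (- (c * \<xi>)))
    (exp (- (\<alpha> * (r + c))) * Gamma q * (r + c) powr (- q))"
proof (rule has_bochner_integral_nn_integral)
  define k where "k = r + c"
  have k: "0 < k" using r_nonneg c by (simp add: k_def)
  define G where "G t = indicator {0..} t * t powr (q - 1) / exp t" for t :: real
  have Gm[measurable]: "G \<in> borel_measurable borel" unfolding G_def by measurable
  define c0 where "c0 = k powr (1 - q) * exp (- (k * \<alpha>))"
  have c0: "0 < c0" using k by (simp add: c0_def)
  have eq: "weight \<xi> * exp (- (c * \<xi>)) = c0 * G (- (k * \<alpha>) + k * \<xi>)" for \<xi>
  proof (cases "\<alpha> < \<xi>")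
    case True
    have "- (k * \<alpha>) + k * \<xi> = k * (\<xi> - \<alpha>)" by (simp add: algebra_simps)
    then have "G (- (k * \<alpha>) + k * \<xi>) = k powr (q - 1) * (\<xi> - \<alpha>) powr (q - 1) * (exp (k * \<alpha>) * exp (- (k * \<xi>)))"
      using True k
      by (simp add: G_def powr_mult divide_inverse flip: exp_minus exp_add)
    moreover have "k powr (1 - q) * k powr (q - 1) = 1" using k by (simp flip: powr_add)
    moreover have "exp (- (k * \<alpha>)) * exp (k * \<alpha>) = 1" by (simp flip: exp_add)
    moreover have "exp (- (k * \<xi>)) = exp (- r * \<xi>) * exp (- (c * \<xi>))"
      by (simp add: k_def algebra_simps flip: exp_add)
    ultimately show ?thesis using True
      by (simp add: weight_def pos_power_def c0_def) (metis (no_types, opaque_lifting) mult.assoc mult.commute mult.right_neutral)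
  next
    case False
    then have "- (k * \<alpha>) + k * \<xi> \<le> 0" using k by simp
    then have "G (- (k * \<alpha>) + k * \<xi>) = 0" by (auto simp: G_def indicator_def)
    then show ?thesis using False by (simp add: weight_eq_0)
  qed
  have "(\<integral>\<^sup>+\<xi>. ennreal (G (- (k * \<alpha>) + k * \<xi>)) \<partial>lborel)
      = ennreal \<bar>1 / k\<bar> * (\<integral>\<^sup>+x. ennreal (G (- (k * \<alpha>) + k * (\<alpha> + 1 / k * x))) \<partial>lborel)"
    using k by (intro nn_integral_real_affine) auto
  also have "(\<lambda>x. G (- (k * \<alpha>) + k * (\<alpha> + 1 / k * x))) = G"
    using k by (simp add: algebra_simps)
  also have "(\<integral>\<^sup>+x. ennreal (G x) \<partial>lborel) = ennreal (Gamma q)"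
    unfolding G_def by (rule Gamma_conv_nn_integral_real[OF q_pos, symmetric])
  also have "ennreal \<bar>1 / k\<bar> * ennreal (Gamma q) = ennreal (1 / k * Gamma q)"
    using k Gamma_real_pos[OF q_pos] by (subst ennreal_mult[symmetric]) auto
  finally have nn: "(\<integral>\<^sup>+\<xi>. ennreal (G (- (k * \<alpha>) + k * \<xi>)) \<partial>lborel) = ennreal (1 / k * Gamma q)" .
  have G0: "0 \<le> G x" for x by (simp add: G_def)
  have "(\<integral>\<^sup>+\<xi>. ennreal (weight \<xi> * exp (- (c * \<xi>))) \<partial>lborel)
      = (\<integral>\<^sup>+\<xi>. ennreal c0 * ennreal (G (- (k * \<alpha>) + k * \<xi>)) \<partial>lborel)"
    unfolding eq using c0 G0 by (simp add: ennreal_mult)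
  also have "\<dots> = ennreal c0 * ennreal (1 / k * Gamma q)"
    unfolding nn[symmetric] by (rule nn_integral_cmult) measurable
  also have "\<dots> = ennreal (c0 * (1 / k * Gamma q))"
    using c0 k Gamma_real_pos[OF q_pos] by (intro ennreal_mult[symmetric]) auto
  also have "c0 * (1 / k * Gamma q) = exp (- (\<alpha> * (r + c))) * Gamma q * (r + c) powr (- q)"
  proof -
    have "k powr (1 - q) = k * k powr (- q)" using k by (simp add: powr_diff powr_minus divide_inverse)
    then show ?thesis using k unfolding c0_def k_def[symmetric] by (simp add: mult.commute)
  qed
  finally show "(\<integral>\<^sup>+\<xi>. ennreal (weight \<xi> * exp (- (c * \<xi>))) \<partial>lborel)
    = ennreal (exp (- (\<alpha> * (r + c))) * Gamma q * (r + c) powr (- q))" .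
  show "0 \<le> exp (- (\<alpha> * (r + c))) * Gamma q * (r + c) powr (- q)"
    using Gamma_real_pos[OF q_pos] by simp
qed (auto simp: weight_nonneg)

lemma qc_kernel_eq_integral:
  assumes \<tau>: "0 < \<tau>"
  shows "has_bochner_integral lborel (\<lambda>\<xi>. C * (weight \<xi> * exp (- (\<tau> * \<xi>)))) (qc_kernel r q \<alpha> \<tau>)"
proof -
  have "C * (exp (- (\<alpha> * (r + \<tau>))) * Gamma q * (r + \<tau>) powr (- q)) = qc_kernel r q \<alpha> \<tau>"
  proof -
    have "exp (\<alpha> * r) * exp (- (\<alpha> * (r + \<tau>))) = exp (- \<alpha> * \<tau>)"
      by (simp add: algebra_simps flip: exp_add)
    then show ?thesis
      using Gamma_real_pos[OF q_pos] by (simp add: C_def qc_kernel_def add.commute field_simps)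
  qed
  then show ?thesis using has_bochner_integral_mult_right[OF weight_exp_integral[OF \<tau>], of C] by simp
qed

lemma weight_exp_integrable: "0 < c \<Longrightarrow> integrable lborel (\<lambda>\<xi>. weight \<xi> * exp (- (c * \<xi>)))"
  using weight_exp_integral by (auto simp: has_bochner_integral_iff)

text \<open>
  The transform of an integrable function on \<open>[\<epsilon>, \<infinity>)\<close> is bounded by \<open>exp (- \<epsilon> \<xi>)\<close> times its \<open>L\<^sup>1\<close> norm,
  and this is square integrable for the weight: at infinity by the exponential decay, at \<open>\<alpha>\<close> because
  the weight is locally integrable. On such functions the form is therefore continuous in \<open>L\<^sup>1\<close>.
\<close>

lemma L1_away_from_0_Dom:
  assumes g: "g \<in> L2 Rplus" "integrable Rplus g" and \<epsilon>: "0 < \<epsilon>" and g0: "\<And>t. 0 < t \<Longrightarrow> t < \<epsilon> \<Longrightarrow> g t = 0"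
  shows "g \<in> Dom" "(l2_norm lborel (W g))\<^sup>2 \<le> (LINT \<xi>|lborel. weight \<xi> * exp (- (2 * \<epsilon> * \<xi>))) * (LINT t|Rplus. cmod (g t))\<^sup>2"
proof -
  let ?N = "LINT t|Rplus. cmod (g t)"
  have i: "integrable lborel (\<lambda>\<xi>. weight \<xi> * exp (- (2 * \<epsilon> * \<xi>)) * ?N\<^sup>2)"
    using weight_exp_integrable[of "2 * \<epsilon>"] \<epsilon> by (intro integrable_mult_left) simp
  have le: "(cmod (W g \<xi>))\<^sup>2 \<le> weight \<xi> * exp (- (2 * \<epsilon> * \<xi>)) * ?N\<^sup>2" for \<xi>
  proof (cases "\<xi> \<le> \<alpha>")
    case False
    then have \<xi>: "0 < \<xi>" using \<alpha>_nonneg by simp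
    have "(cmod (laplace g \<xi>))\<^sup>2 \<le> (exp (- (\<epsilon> * \<xi>)) * ?N)\<^sup>2"
      by (intro power_mono laplace_bound_L1[OF g(2) g0 \<xi>]) auto
    also have "\<dots> = exp (- (2 * \<epsilon> * \<xi>)) * ?N\<^sup>2"
      by (simp add: power_mult_distrib flip: exp_of_nat_mult)
    finally have "weight \<xi> * (cmod (laplace g \<xi>))\<^sup>2 \<le> weight \<xi> * (exp (- (2 * \<epsilon> * \<xi>)) * ?N\<^sup>2)"
      by (rule mult_left_mono[OF _ weight_nonneg])
    then show ?thesis by (simp add: W_def norm_mult power_mult_distrib weight_nonneg mult.assoc)
  qed (simp add: W_def weight_eq_0)
  have WL: "W g \<in> L2 lborel" by (rule L2_dominated[OF W_measurable[OF g(1)] i le])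
  then show "g \<in> Dom" using g by (simp add: Dom_iff)
  have "(l2_norm lborel (W g))\<^sup>2 \<le> (LINT \<xi>|lborel. weight \<xi> * exp (- (2 * \<epsilon> * \<xi>)) * ?N\<^sup>2)"
    unfolding l2_norm_squared by (rule integral_mono[OF L2_integrable[OF WL] i le])
  then show "(l2_norm lborel (W g))\<^sup>2 \<le> (LINT \<xi>|lborel. weight \<xi> * exp (- (2 * \<epsilon> * \<xi>))) * ?N\<^sup>2"
    by simp
qed

lemma C0_infinity_subset_Dom: "C0_infinity_Rplus \<subseteq> Dom"
proof
  fix f assume f: "f \<in> C0_infinity_Rplus"
  obtain a b K where ab: "0 < a" "a \<le> b" "\<And>x. x \<notin> {a..b} \<Longrightarrow> f x = 0" "0 \<le> K" "\<And>x. cmod (f x) \<le> K"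
    using C0_infinity_Rplus_obtain[OF f] by metis
  show "f \<in> Dom"
    by (rule L1_away_from_0_Dom(1)[OF C0_infinity_Rplus_integrable(2)[OF f] C0_infinity_Rplus_integrable(1)[OF f] ab(1)]) (use ab(3) in auto)
qed

text \<open>
  The kernel is a superposition of the rank one kernels \<open>exp (- t \<xi>) exp (- s \<xi>)\<close>; Fubini's theorem
  applies because a test function vanishes near the origin.
\<close>

lemma hankel_form_eq_laplace_form:
  assumes f: "f \<in> C0_infinity_Rplus"
  shows "integrable (Rplus \<Otimes>\<^sub>M Rplus) (hankel_integrand (qc_kernel r q \<alpha>) f)"
    and "hankel_form (qc_kernel r q \<alpha>) f = Q f"
proof -
  obtain a b K where ab: "0 < a" "a \<le> b" "\<And>x. x \<notin> {a..b} \<Longrightarrow> f x = 0" "0 \<le> K" "\<And>x. cmod (f x) \<le> K"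
    using C0_infinity_Rplus_obtain[OF f] by metis
  have fL: "f \<in> L2 Rplus" and fi: "integrable Rplus f" using C0_infinity_Rplus_integrable[OF f] by auto
  have fm[measurable]: "f \<in> borel_measurable Rplus" using fi by auto
  let ?R2 = "Rplus \<Otimes>\<^sub>M Rplus"
  have sf: "sigma_finite_measure ?R2" by (rule sigma_finite_pair_measure[OF sigma_finite_Rplus sigma_finite_Rplus])
  interpret P: pair_sigma_finite ?R2 "lborel :: real measure"
    using sf lborel.sigma_finite_measure_axioms by (simp add: pair_sigma_finite_def)
  define \<Phi> where "\<Phi> p \<xi> = complex_of_real (C * weight \<xi>) *
      ((complex_of_real (exp (- fst p * \<xi>)) * cnj (f (fst p))) * (complex_of_real (exp (- snd p * \<xi>)) * f (snd p)))"
    for p :: "real \<times> real" and \<xi>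
  define bd where "bd z = (cmod (f (fst (fst z))) * cmod (f (snd (fst z)))) * (C * (weight (snd z) * exp (- (2 * a * snd z))))"
    for z :: "(real \<times> real) \<times> real"
  have i1: "integrable ?R2 (\<lambda>p. cmod (f (fst p)) * cmod (f (snd p)))"
    by (intro integrable_prod_mult(1) sigma_finite_Rplus integrable_norm fi)
  have i2: "integrable lborel (\<lambda>\<xi>. C * (weight \<xi> * exp (- (2 * a * \<xi>))))"
    using weight_exp_integrable[of "2 * a"] ab(1) by simp
  have ibd: "integrable (?R2 \<Otimes>\<^sub>M lborel) bd"
    unfolding bd_def by (rule integrable_prod_mult(1)[OF sf lborel.sigma_finite_measure_axioms i1 i2])
  have \<Phi>m: "case_prod \<Phi> \<in> borel_measurable (?R2 \<Otimes>\<^sub>M lborel)"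
    using measurable_ident_Rplus unfolding \<Phi>_def by measurable
  have \<Phi>le: "cmod (\<Phi> p \<xi>) \<le> bd (p, \<xi>)" for p \<xi>
  proof (cases "\<xi> \<le> \<alpha> \<or> f (fst p) = 0 \<or> f (snd p) = 0")
    case True
    then show ?thesis using C_pos by (auto simp: \<Phi>_def bd_def weight_eq_0)
  next
    case False
    then have \<xi>: "0 < \<xi>" using \<alpha>_nonneg by simp
    have "a \<le> fst p" "a \<le> snd p" using False ab(3) by force+
    then have "exp (- fst p * \<xi>) \<le> exp (- (a * \<xi>))" "exp (- snd p * \<xi>) \<le> exp (- (a * \<xi>))" using \<xi> by auto
    then have "exp (- fst p * \<xi>) * exp (- snd p * \<xi>) \<le> exp (- (a * \<xi>)) * exp (- (a * \<xi>))"
      by (intro mult_mono) auto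
    also have "\<dots> = exp (- (2 * a * \<xi>))" by (simp flip: exp_add)
    finally have "(C * weight \<xi> * cmod (f (fst p)) * cmod (f (snd p))) * (exp (- fst p * \<xi>) * exp (- snd p * \<xi>))
        \<le> (C * weight \<xi> * cmod (f (fst p)) * cmod (f (snd p))) * exp (- (2 * a * \<xi>))"
      using C_pos weight_nonneg[of \<xi>] by (intro mult_left_mono) auto
    then show ?thesis using C_pos weight_nonneg[of \<xi>]
      by (simp add: \<Phi>_def bd_def norm_mult abs_mult mult_ac)
  qed
  have \<Phi>i: "integrable (?R2 \<Otimes>\<^sub>M lborel) (case_prod \<Phi>)"
  proof (rule Bochner_Integration.integrable_bound[OF ibd \<Phi>m])
    show "AE z in ?R2 \<Otimes>\<^sub>M lborel. norm (case_prod \<Phi> z) \<le> norm (bd z)"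
      using \<Phi>le by (intro AE_I2) (auto simp: split_beta intro: order_trans[OF _ abs_ge_self])
  qed
  have inner: "(LINT \<xi>|lborel. \<Phi> p \<xi>) = hankel_integrand (qc_kernel r q \<alpha>) f p" if p: "p \<in> space ?R2" for p
  proof -
    have pos: "0 < fst p" "0 < snd p" using p by (auto simp: space_pair_measure space_Rplus)
    have "\<Phi> p \<xi> = cnj (f (fst p)) * f (snd p) * complex_of_real (C * (weight \<xi> * exp (- ((fst p + snd p) * \<xi>))))" for \<xi>
      by (simp add: \<Phi>_def ring_distribs exp_add exp_diff exp_minus field_simps)
    moreover have "has_bochner_integral lborel (\<lambda>\<xi>. complex_of_real (C * (weight \<xi> * exp (- ((fst p + snd p) * \<xi>)))))
        (complex_of_real (qc_kernel r q \<alpha> (fst p + snd p)))"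
      using qc_kernel_eq_integral[of "fst p + snd p"] pos by (intro has_bochner_integral_of_real) simp
    ultimately show ?thesis
      by (simp add: hankel_integrand_def split_beta has_bochner_integral_iff)
  qed
  have hi: "integrable ?R2 (\<lambda>p. LINT \<xi>|lborel. \<Phi> p \<xi>)"
    using P.integrable_fst'[OF \<Phi>i] by simp
  show "integrable ?R2 (hankel_integrand (qc_kernel r q \<alpha>) f)"
    using hi inner by (simp cong: Bochner_Integration.integrable_cong)
  have outer: "(LINT p|?R2. \<Phi> p \<xi>) = complex_of_real (C * (cmod (W f \<xi>))\<^sup>2)" for \<xi>
  proof (cases "\<xi> \<le> \<alpha>")
    case False
    then have \<xi>: "0 < \<xi>" using \<alpha>_nonneg by simp
    have e1: "integrable Rplus (\<lambda>t. complex_of_real (exp (- t * \<xi>)) * f t)" by (rule laplace_integrable[OF fL \<xi>])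
    have e2: "integrable Rplus (\<lambda>t. cnj (complex_of_real (exp (- t * \<xi>)) * f t))"
      by (rule integrable_cnj[OF e1])
    have "(LINT p|?R2. (cnj (complex_of_real (exp (- fst p * \<xi>)) * f (fst p))) * (complex_of_real (exp (- snd p * \<xi>)) * f (snd p)))
        = cnj (laplace f \<xi>) * laplace f \<xi>"
      unfolding laplace_def Bochner_Integration.integral_cnj[symmetric]
      by (rule integrable_prod_mult(2)[OF sigma_finite_Rplus sigma_finite_Rplus e2 e1])
    then have "(LINT p|?R2. \<Phi> p \<xi>) = complex_of_real (C * weight \<xi>) * (cnj (laplace f \<xi>) * laplace f \<xi>)"
      unfolding \<Phi>_def by simp
    also have "cnj (laplace f \<xi>) * laplace f \<xi> = complex_of_real ((cmod (laplace f \<xi>))\<^sup>2)"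
      unfolding complex_norm_square by (simp add: mult.commute)
    finally show ?thesis
      by (simp add: W_def norm_mult power_mult_distrib weight_nonneg)
  qed (simp add: \<Phi>_def W_def weight_eq_0)
  have "hankel_form (qc_kernel r q \<alpha>) f = (LINT p|?R2. LINT \<xi>|lborel. \<Phi> p \<xi>)"
    unfolding hankel_form_def by (rule Bochner_Integration.integral_cong[OF refl]) (rule inner[symmetric])
  also have "\<dots> = (LINT \<xi>|lborel. LINT p|?R2. \<Phi> p \<xi>)" by (rule P.Fubini_integral[OF \<Phi>i, symmetric])
  also have "\<dots> = Q f"
    unfolding outer laplace_form_eq l2_norm_squared integral_complex_of_real by simp
  finally show "hankel_form (qc_kernel r q \<alpha>) f = Q f" .
qed

end

section \<open>Test functions form a core\<close>

text \<open>
  Pointwise convergence without loss of mass is convergence in norm: Fatou's lemma is applied to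
  \<open>2 |F\<^sub>n|\<^sup>2 + 2 |F|\<^sup>2 - |F\<^sub>n - F|\<^sup>2\<close>, which tends to \<open>4 |F|\<^sup>2\<close>.
\<close>

lemma L2_close_of_pointwise_and_norm:
  assumes F: "\<And>n. F n \<in> L2 M" "G \<in> L2 M" and lim: "AE x in M. (\<lambda>n. F n x) \<longlonglongrightarrow> G x"
    and c: "c \<longlonglongrightarrow> 0" and le: "\<And>n. (l2_norm M (F n))\<^sup>2 \<le> (l2_norm M G)\<^sup>2 + c n" and e: "0 < e"
  shows "\<exists>n\<ge>N. (l2_norm M (\<lambda>x. F n x - G x))\<^sup>2 < e"
proof (rule ccontr)
  assume "\<not> ?thesis"
  then have far: "e \<le> (l2_norm M (\<lambda>x. F n x - G x))\<^sup>2" if "n \<ge> N" for n using that by force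
  have [measurable]: "F n \<in> borel_measurable M" "G \<in> borel_measurable M" for n
    using L2_measurable F by blast+
  define g where "g n x = 2 * (cmod (F n x))\<^sup>2 + 2 * (cmod (G x))\<^sup>2 - (cmod (F n x - G x))\<^sup>2" for n x
  have i: "integrable M (g n)" for n
    unfolding g_def using F L2_integrable[OF F(1)] L2_integrable[OF F(2)] L2_integrable[OF L2_diff[OF F]] by auto
  have g0: "0 \<le> g n x" for n x
    using cmod_add_squared_le[of "F n x" "- G x"] by (simp add: g_def)
  have gl: "AE x in M. (\<lambda>n. g n x) \<longlonglongrightarrow> 2 * (cmod (G x))\<^sup>2 + 2 * (cmod (G x))\<^sup>2 - (cmod (G x - G x))\<^sup>2"
    using lim unfolding g_def by eventually_elim (intro tendsto_intros)
  have gi: "(LINT x|M. g n x) = 2 * (l2_norm M (F n))\<^sup>2 + 2 * (l2_norm M G)\<^sup>2 - (l2_norm M (\<lambda>x. F n x - G x))\<^sup>2" for n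
    unfolding g_def l2_norm_squared
    using L2_integrable[OF F(1)] L2_integrable[OF F(2)] L2_integrable[OF L2_diff[OF F]] by simp
  have "eventually (\<lambda>n. c n < e / 4) sequentially" using order_tendstoD(2)[OF c, of "e/4"] e by simp
  then have "eventually (\<lambda>n. (LINT x|M. g n x) \<le> 4 * (l2_norm M G)\<^sup>2 - e / 2) sequentially"
    using eventually_ge_at_top[of N]
  proof eventually_elim
    case (elim n)
    show ?case using far[OF elim(2)] le[of n] elim(1) unfolding gi by linarith
  qed
  from Fatou_integral_bound(2)[OF i g0 _ gl this]
  have "(LINT x|M. 4 * (cmod (G x))\<^sup>2) \<le> 4 * (l2_norm M G)\<^sup>2 - e / 2" by simp
  then show False using e by (simp add: l2_norm_squared)
qed

subsection \<open>Shifts\<close>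

text \<open>
  The translation semigroup on functions on the half-line, under which the Laplace transform is
  multiplied by \<open>exp (- \<epsilon> \<xi>)\<close>.
\<close>

definition shift :: "real \<Rightarrow> (real \<Rightarrow> 'b::zero) \<Rightarrow> real \<Rightarrow> 'b" where
  "shift \<epsilon> h t = (if \<epsilon> < t then h (t - \<epsilon>) else 0)"

lemma indicator_shift:
  fixes h :: "real \<Rightarrow> 'b::real_normed_vector"
  assumes "0 \<le> \<epsilon>"
  shows "indicator {0<..} t *\<^sub>R shift \<epsilon> h t = indicator {0<..} (- \<epsilon> + 1 * t) *\<^sub>R h (- \<epsilon> + 1 * t)"
  using assms by (auto simp: shift_def indicator_def)

lemma shift_measurable:
  fixes h :: "real \<Rightarrow> 'b::real_normed_vector"
  assumes "0 \<le> \<epsilon>" "h \<in> borel_measurable Rplus" shows "shift \<epsilon> h \<in> borel_measurable Rplus"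
  using assms(2) unfolding borel_measurable_Rplus_iff indicator_shift[OF assms(1)]
  by (rule measurable_compose[rotated]) simp

lemma shift_integral:
  fixes h :: "real \<Rightarrow> 'b::{banach, second_countable_topology}"
  assumes "0 \<le> \<epsilon>"
  shows "(LINT t|Rplus. shift \<epsilon> h t) = (LINT t|Rplus. h t)"
  unfolding integral_Rplus indicator_shift[OF assms]
  by (subst (2) lborel_integral_real_affine[where c = 1 and t = "- \<epsilon>"]) simp_all

lemma shift_integrable:
  fixes h :: "real \<Rightarrow> 'b::{banach, second_countable_topology}"
  assumes "0 \<le> \<epsilon>" "integrable Rplus h"
  shows "integrable Rplus (shift \<epsilon> h)"
  using assms(2) unfolding integrable_Rplus_iff indicator_shift[OF assms(1)]
  by (rule lborel_integrable_real_affine) simp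

lemma cmod_shift: "(cmod (shift \<epsilon> f t))\<^sup>2 = shift \<epsilon> (\<lambda>t. (cmod (f t))\<^sup>2) t"
  by (simp add: shift_def)

lemma shift_L2:
  assumes "0 \<le> \<epsilon>" "f \<in> L2 Rplus"
  shows "shift \<epsilon> f \<in> L2 Rplus" "l2_norm Rplus (shift \<epsilon> f) = l2_norm Rplus f"
  using shift_measurable[OF assms(1) L2_measurable[OF assms(2)]]
    shift_integrable[OF assms(1) L2_integrable[OF assms(2)]] shift_integral[OF assms(1), of "\<lambda>t. (cmod (f t))\<^sup>2"]
  by (simp_all add: L2_def l2_norm_def cmod_shift)

lemma shift_tendsto_C0_infinity:
  assumes \<phi>: "\<phi> \<in> C0_infinity_Rplus" and \<epsilon>: "\<epsilon> \<longlonglongrightarrow> 0" "\<And>n. 0 \<le> \<epsilon> n" "\<And>n. \<epsilon> n \<le> 1"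
  shows "(\<lambda>n. (l2_norm Rplus (\<lambda>t. shift (\<epsilon> n) \<phi> t - \<phi> t))\<^sup>2) \<longlonglongrightarrow> 0"
proof -
  obtain a b K where ab: "0 < a" "a \<le> b" "\<And>x. x \<notin> {a..b} \<Longrightarrow> \<phi> x = 0" "0 \<le> K" "\<And>x. cmod (\<phi> x) \<le> K"
    using C0_infinity_Rplus_obtain[OF \<phi>] by metis
  have eq: "shift (\<epsilon> n) \<phi> t = \<phi> (t - \<epsilon> n)" for n t
    using ab(1) ab(3)[of "t - \<epsilon> n"] by (simp add: shift_def)
  have [measurable]: "\<phi> \<in> borel_measurable borel" by (rule C0_infinity_Rplus_measurable[OF \<phi>])
  have "(\<lambda>n. LINT t|Rplus. (cmod (\<phi> (t - \<epsilon> n) - \<phi> t))\<^sup>2) \<longlonglongrightarrow> (LINT t|Rplus. (cmod (\<phi> (t - 0) - \<phi> t))\<^sup>2)"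
  proof (rule integral_dominated_convergence[where w = "\<lambda>t. (2 * K)\<^sup>2 * indicator {a..b + 1} t"])
    show "integrable Rplus (\<lambda>t. (2 * K)\<^sup>2 * indicator {a..b + 1} t :: real)"
      by (intro integral_Rplus_le integrable_mult_right integrable_real_indicator)
        (auto simp: emeasure_lborel_Icc_eq indicator_def)
    have c: "isCont \<phi> t" for t
      using smooth_continuous[OF C0_infinity_Rplus_smooth[OF \<phi>], of UNIV]
      by (simp add: continuous_on_eq_continuous_at)
    show "AE t in Rplus. (\<lambda>n. (cmod (\<phi> (t - \<epsilon> n) - \<phi> t))\<^sup>2) \<longlonglongrightarrow> (cmod (\<phi> (t - 0) - \<phi> t))\<^sup>2"
      by (intro AE_I2 tendsto_intros isCont_tendsto_compose[OF c] \<epsilon>(1))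
    show "AE t in Rplus. norm ((cmod (\<phi> (t - \<epsilon> n) - \<phi> t))\<^sup>2) \<le> (2 * K)\<^sup>2 * indicator {a..b + 1} t" for n
    proof (rule AE_I2)
      fix t
      show "norm ((cmod (\<phi> (t - \<epsilon> n) - \<phi> t))\<^sup>2) \<le> (2 * K)\<^sup>2 * indicator {a..b + 1} t"
      proof (cases "t \<in> {a..b + 1}")
        case True
        have "cmod (\<phi> (t - \<epsilon> n) - \<phi> t) \<le> 2 * K"
          using norm_triangle_ineq4[of "\<phi> (t - \<epsilon> n)" "\<phi> t"] ab(5)[of "t - \<epsilon> n"] ab(5)[of t] by linarith
        then have "(cmod (\<phi> (t - \<epsilon> n) - \<phi> t))\<^sup>2 \<le> (2 * K)\<^sup>2" by (rule power_mono) simp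
        then show ?thesis using True by simp
      next
        case False
        have "t \<notin> {a..b}" "t - \<epsilon> n \<notin> {a..b}" using False \<epsilon>(2)[of n] \<epsilon>(3)[of n] by auto
        then show ?thesis using False by (simp add: ab(3))
      qed
    qed
  qed (auto intro!: measurable_Rplus)
  then show ?thesis by (simp add: l2_norm_squared eq)
qed

lemma shift_diff: "shift \<epsilon> (\<lambda>t. f t - g t) t = shift \<epsilon> f t - (shift \<epsilon> g t :: complex)"
  by (simp add: shift_def)

text \<open>
  Translations preserve the norm, so their strong continuity needs to be known on a dense set only.
\<close>

lemma shift_tendsto:
  assumes f: "f \<in> L2 Rplus" and \<epsilon>: "\<epsilon> \<longlonglongrightarrow> 0" "\<And>n. 0 \<le> \<epsilon> n" "\<And>n. \<epsilon> n \<le> 1"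
  shows "(\<lambda>n. (l2_norm Rplus (\<lambda>t. shift (\<epsilon> n) f t - f t))\<^sup>2) \<longlonglongrightarrow> 0"
proof (rule LIMSEQ_I)
  fix e :: real assume e: "0 < e"
  have "0 < sqrt (e / 12)" using e by simp
  then obtain \<phi> where \<phi>: "\<phi> \<in> C0_infinity_Rplus" "l2_norm Rplus (\<lambda>t. f t - \<phi> t) < sqrt (e / 12)"
    using l2_dense_C0_infinity f unfolding l2_dense_def by blast
  have \<phi>L: "\<phi> \<in> L2 Rplus" using C0_infinity_Rplus_integrable[OF \<phi>(1)] by simp
  have "(l2_norm Rplus (\<lambda>t. f t - \<phi> t))\<^sup>2 < (sqrt (e / 12))\<^sup>2"
    using \<phi>(2) by (intro power_strict_mono l2_norm_nonneg) auto
  then have d: "(l2_norm Rplus (\<lambda>t. f t - \<phi> t))\<^sup>2 < e / 12" using e by simp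
  have "eventually (\<lambda>n. (l2_norm Rplus (\<lambda>t. shift (\<epsilon> n) \<phi> t - \<phi> t))\<^sup>2 < e / 8) sequentially"
    using order_tendstoD(2)[OF shift_tendsto_C0_infinity[OF \<phi>(1) \<epsilon>], of "e/8"] e by simp
  then obtain N where N: "\<And>n. n \<ge> N \<Longrightarrow> (l2_norm Rplus (\<lambda>t. shift (\<epsilon> n) \<phi> t - \<phi> t))\<^sup>2 < e / 8"
    unfolding eventually_sequentially by blast
  have "(l2_norm Rplus (\<lambda>t. shift (\<epsilon> n) f t - f t))\<^sup>2 < e" if n: "n \<ge> N" for n
  proof -
    have S: "shift (\<epsilon> n) (\<lambda>t. f t - \<phi> t) \<in> L2 Rplus" "shift (\<epsilon> n) \<phi> \<in> L2 Rplus"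
      "l2_norm Rplus (shift (\<epsilon> n) (\<lambda>t. f t - \<phi> t)) = l2_norm Rplus (\<lambda>t. f t - \<phi> t)"
      by (intro shift_L2 \<epsilon> L2_diff f \<phi>L)+
    have "(l2_norm Rplus (\<lambda>t. shift (\<epsilon> n) (\<lambda>t. f t - \<phi> t) t + ((shift (\<epsilon> n) \<phi> t - \<phi> t) + (\<phi> t - f t))))\<^sup>2
        \<le> 2 * (l2_norm Rplus (shift (\<epsilon> n) (\<lambda>t. f t - \<phi> t)))\<^sup>2
          + 2 * (l2_norm Rplus (\<lambda>t. (shift (\<epsilon> n) \<phi> t - \<phi> t) + (\<phi> t - f t)))\<^sup>2"
      by (intro l2_norm_add_squared_le L2_add L2_diff S f \<phi>L)
    also have "(l2_norm Rplus (\<lambda>t. (shift (\<epsilon> n) \<phi> t - \<phi> t) + (\<phi> t - f t)))\<^sup>2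
        \<le> 2 * (l2_norm Rplus (\<lambda>t. shift (\<epsilon> n) \<phi> t - \<phi> t))\<^sup>2 + 2 * (l2_norm Rplus (\<lambda>t. \<phi> t - f t))\<^sup>2"
      by (intro l2_norm_add_squared_le L2_diff S f \<phi>L)
    finally have "(l2_norm Rplus (\<lambda>t. shift (\<epsilon> n) (\<lambda>t. f t - \<phi> t) t + ((shift (\<epsilon> n) \<phi> t - \<phi> t) + (\<phi> t - f t))))\<^sup>2
        \<le> 6 * (l2_norm Rplus (\<lambda>t. f t - \<phi> t))\<^sup>2 + 4 * (l2_norm Rplus (\<lambda>t. shift (\<epsilon> n) \<phi> t - \<phi> t))\<^sup>2"
      unfolding S(3) l2_norm_sub_commute[of Rplus \<phi> f] by simp
    also have "\<dots> < e" using d N[OF n] by simp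
    finally show ?thesis by (simp add: shift_diff)
  qed
  then show "\<exists>N. \<forall>n\<ge>N. norm ((l2_norm Rplus (\<lambda>t. shift (\<epsilon> n) f t - f t))\<^sup>2 - 0) < e" by auto
qed

lemma laplace_shift:
  assumes "0 \<le> \<epsilon>"
  shows "laplace (shift \<epsilon> f) \<xi> = complex_of_real (exp (- (\<epsilon> * \<xi>))) * laplace f \<xi>"
proof -
  have "complex_of_real (exp (- t * \<xi>)) * shift \<epsilon> f t
      = shift \<epsilon> (\<lambda>u. complex_of_real (exp (- (\<epsilon> * \<xi>))) * (complex_of_real (exp (- u * \<xi>)) * f u)) t" for t
    by (simp add: shift_def algebra_simps mult_exp_exp flip: of_real_mult)
  then show ?thesis unfolding laplace_def by (simp add: shift_integral[OF assms])
qed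

lemma damp_tendsto:
  assumes f: "f \<in> L2 Rplus" and s: "s \<longlonglongrightarrow> 0" "\<And>n. 0 \<le> s n"
  shows "(\<lambda>n. (l2_norm Rplus (\<lambda>t. complex_of_real (exp (- t * s n)) * f t - f t))\<^sup>2) \<longlonglongrightarrow> 0"
proof -
  note [measurable] = L2_measurable[OF f] measurable_ident_Rplus
  have "(\<lambda>n. LINT t|Rplus. (cmod (complex_of_real (exp (- t * s n)) * f t - f t))\<^sup>2)
      \<longlonglongrightarrow> (LINT t|Rplus. (cmod (complex_of_real (exp (- t * 0)) * f t - f t))\<^sup>2)"
  proof (rule integral_dominated_convergence[OF _ _ L2_integrable[OF f]])
    show "AE t in Rplus. (\<lambda>n. (cmod (complex_of_real (exp (- t * s n)) * f t - f t))\<^sup>2)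
        \<longlonglongrightarrow> (cmod (complex_of_real (exp (- t * 0)) * f t - f t))\<^sup>2"
      by (intro AE_I2 tendsto_intros s)
    show "AE t in Rplus. norm ((cmod (complex_of_real (exp (- t * s n)) * f t - f t))\<^sup>2) \<le> (cmod (f t))\<^sup>2" for n
    proof (rule AE_I2)
      fix t assume "t \<in> space Rplus"
      then have e: "exp (- t * s n) \<le> 1" using s(2)[of n] by (simp add: space_Rplus)
      have "complex_of_real (exp (- t * s n)) * f t - f t = complex_of_real (exp (- t * s n) - 1) * f t"
        by (simp add: algebra_simps)
      then have "cmod (complex_of_real (exp (- t * s n)) * f t - f t) = \<bar>exp (- t * s n) - 1\<bar> * cmod (f t)"
        by (simp only: norm_mult norm_of_real)
      also have "\<dots> = (1 - exp (- t * s n)) * cmod (f t)" using e by simp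
      also have "\<dots> \<le> 1 * cmod (f t)" by (intro mult_right_mono) auto
      finally show "norm ((cmod (complex_of_real (exp (- t * s n)) * f t - f t))\<^sup>2) \<le> (cmod (f t))\<^sup>2"
        by (simp add: power_mono)
    qed
  qed measurable
  then show ?thesis by (simp add: l2_norm_squared)
qed

context quasi_carleman begin

subsection \<open>Averaging the weight over small translations\<close>

text \<open>
  \<open>weight_majorant \<delta>\<close> bounds the mean of \<open>weight (\<xi> - s)\<close> over \<open>0 < s < \<delta>\<close>. The singularity of the
  weight at \<open>\<alpha>\<close>, present for \<open>q < 1\<close>, is integrable and so costs only a constant factor within
  distance \<open>2 \<delta>\<close> of \<open>\<alpha>\<close>.
\<close>

definition weight_majorant :: "real \<Rightarrow> real \<Rightarrow> real" where
  "weight_majorant \<delta> \<xi> = (if \<xi> \<le> \<alpha> then 0 else exp (r * \<delta>) * exp (- r * \<xi>) *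
     (if 2 * \<delta> \<le> \<xi> - \<alpha> then max ((\<xi> - \<alpha>) powr (q - 1)) ((\<xi> - \<alpha> - \<delta>) powr (q - 1))
      else (\<xi> - \<alpha>) powr q / (q * \<delta>)))"

lemma weight_majorant_measurable [measurable]: "weight_majorant \<delta> \<in> borel_measurable borel"
  unfolding weight_majorant_def by measurable

lemma weight_majorant_nonneg: "0 < \<delta> \<Longrightarrow> 0 \<le> weight_majorant \<delta> \<xi>"
  using q_pos by (simp add: weight_majorant_def le_max_iff_disj)

lemma powr_le_max_endpoints:
  fixes a b x p :: real
  assumes "0 < a" "a \<le> x" "x \<le> b" shows "x powr p \<le> max (b powr p) (a powr p)"
proof (cases "0 \<le> p")
  case True
  then have "x powr p \<le> b powr p" using assms by (intro powr_mono2) auto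
  then show ?thesis by simp
next
  case False
  then have "x powr p \<le> a powr p" using assms by (intro powr_mono2') auto
  then show ?thesis by simp
qed

text \<open>
  At distance at least \<open>2 \<delta>\<close> from \<open>\<alpha>\<close> the power is monotone and lies between its end values. Closer to
  \<open>\<alpha>\<close>, the translates sweep out at most the integral of the power from \<open>0\<close> to \<open>\<xi> - \<alpha>\<close>.
\<close>

lemma nn_integral_weight_translates_le:
  assumes \<delta>: "0 < \<delta>"
  shows "(\<integral>\<^sup>+s. indicator {0<..<\<delta>} s * ennreal (weight (\<xi> - s)) \<partial>lborel) \<le> ennreal (\<delta> * weight_majorant \<delta> \<xi>)"
proof (cases "\<xi> \<le> \<alpha>")
  case True
  then have *: "indicator {0<..<\<delta>} s * ennreal (weight (\<xi> - s)) = 0" for s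
    by (auto simp: indicator_def weight_eq_0)
  show ?thesis unfolding * by simp
next
  case False
  define x where "x = \<xi> - \<alpha>"
  have x: "0 < x" using False by (simp add: x_def)
  define E where "E = exp (r * \<delta>) * exp (- r * \<xi>)"
  have E: "0 < E" by (simp add: E_def)
  have exp_le: "exp (- r * (\<xi> - s)) \<le> E" if "0 < s" "s < \<delta>" for s
  proof -
    have "- r * (\<xi> - s) \<le> r * \<delta> + - r * \<xi>"
      using mult_left_mono[OF less_imp_le[OF that(2)] r_nonneg] by (simp add: algebra_simps)
    then show ?thesis unfolding E_def exp_add[symmetric] by simp
  qed
  have w_le: "weight (\<xi> - s) \<le> E * pos_power (x - s) (q - 1)" if "0 < s" "s < \<delta>" for s
  proof -
    have "weight (\<xi> - s) = pos_power (x - s) (q - 1) * exp (- r * (\<xi> - s))"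
      by (simp add: weight_def x_def algebra_simps)
    also have "\<dots> \<le> pos_power (x - s) (q - 1) * E"
      using exp_le[OF that] by (intro mult_left_mono) (auto simp: pos_power_def)
    finally show ?thesis by (simp add: mult.commute)
  qed
  show ?thesis
  proof (cases "2 * \<delta> \<le> x")
    case True
    define m where "m = max (x powr (q - 1)) ((x - \<delta>) powr (q - 1))"
    have m: "0 \<le> m" by (simp add: m_def le_max_iff_disj)
    have "indicator {0<..<\<delta>} s * ennreal (weight (\<xi> - s)) \<le> ennreal (E * m) * indicator {0<..<\<delta>} s" for s
    proof (cases "0 < s \<and> s < \<delta>")
      case s: True
      have "pos_power (x - s) (q - 1) \<le> m"
        using s True \<delta> powr_le_max_endpoints[of "x - \<delta>" "x - s" x "q - 1"] by (auto simp: pos_power_def m_def)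
      then have "weight (\<xi> - s) \<le> E * m"
        using w_le[of s] s E by (meson mult_left_mono order_trans less_imp_le)
      then show ?thesis using s by (simp add: ennreal_leI)
    qed auto
    then have "(\<integral>\<^sup>+s. indicator {0<..<\<delta>} s * ennreal (weight (\<xi> - s)) \<partial>lborel)
        \<le> (\<integral>\<^sup>+s. ennreal (E * m) * indicator {0<..<\<delta>} s \<partial>lborel)"
      by (intro nn_integral_mono)
    also have "\<dots> = ennreal (E * m) * ennreal \<delta>" using \<delta> by (subst nn_integral_cmult_indicator) auto
    also have "\<dots> = ennreal (E * m * \<delta>)" using \<delta> E m by (subst ennreal_mult[symmetric]) auto
    also have "E * m * \<delta> = \<delta> * weight_majorant \<delta> \<xi>"
      using False True by (simp add: weight_majorant_def E_def m_def x_def)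
    finally show ?thesis .
  next
    case short: False
    define h where "h u = indicator {0..x} u * u powr (q - 1)" for u
    have hm[measurable]: "h \<in> borel_measurable borel" unfolding h_def by measurable
    have h0: "0 \<le> h u" for u by (simp add: h_def)
    have "indicator {0<..<\<delta>} s * ennreal (weight (\<xi> - s)) \<le> ennreal E * ennreal (h (x + (-1) * s))" for s
    proof (cases "0 < s \<and> s < \<delta>")
      case s: True
      have "pos_power (x - s) (q - 1) \<le> h (x - s)" using s by (auto simp: pos_power_def h_def)
      then have "weight (\<xi> - s) \<le> E * h (x - s)"
        using w_le[of s] s E by (meson mult_left_mono order_trans less_imp_le)
      then have "ennreal (weight (\<xi> - s)) \<le> ennreal (E * h (x - s))" by (rule ennreal_leI)
      then show ?thesis using s E h0 by (simp add: ennreal_mult)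
    qed auto
    then have "(\<integral>\<^sup>+s. indicator {0<..<\<delta>} s * ennreal (weight (\<xi> - s)) \<partial>lborel)
        \<le> (\<integral>\<^sup>+s. ennreal E * ennreal (h (x + (-1) * s)) \<partial>lborel)"
      by (intro nn_integral_mono)
    also have "\<dots> = ennreal E * (\<integral>\<^sup>+s. ennreal (h (x + (-1) * s)) \<partial>lborel)"
      by (rule nn_integral_cmult) measurable
    also have "(\<integral>\<^sup>+s. ennreal (h (x + (-1) * s)) \<partial>lborel) = (\<integral>\<^sup>+u. ennreal (h u) \<partial>lborel)"
      using nn_integral_real_affine[of "\<lambda>u. ennreal (h u)" "-1" x] by simp
    also have "\<dots> = ennreal (x powr q / q)"
      unfolding h_def
      using nn_integral_has_integral_lebesgue[OF _ has_integral_powr_from_0[of "q - 1" x]] q_pos x by simp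
    also have "ennreal E * ennreal (x powr q / q) = ennreal (E * (x powr q / q))"
      using E q_pos by (subst ennreal_mult[symmetric]) auto
    also have "E * (x powr q / q) = \<delta> * weight_majorant \<delta> \<xi>"
      using False short \<delta> by (simp add: weight_majorant_def E_def x_def)
    finally show ?thesis .
  qed
qed

lemma weight_majorant_le:
  assumes \<delta>: "0 < \<delta>" "\<delta> \<le> 1"
  shows "weight_majorant \<delta> \<xi> \<le> exp r * (max 1 ((1/2) powr (q - 1)) + 2 / q) * weight \<xi>"
proof (cases "\<xi> \<le> \<alpha>")
  case True
  then show ?thesis by (simp add: weight_majorant_def weight_eq_0)
next
  case False
  define x where "x = \<xi> - \<alpha>"
  have x: "0 < x" using False by (simp add: x_def)
  define P where "P = x powr (q - 1)"
  have P: "0 < P" using x by (simp add: P_def)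
  let ?k = "max 1 ((1/2) powr (q - 1)) + 2 / q"
  have "(if 2 * \<delta> \<le> x then max (x powr (q - 1)) ((x - \<delta>) powr (q - 1)) else x powr q / (q * \<delta>)) \<le> ?k * P"
  proof (cases "2 * \<delta> \<le> x")
    case True
    have h: "(x / 2) powr (q - 1) = P * (1/2) powr (q - 1)"
      using x powr_mult[of x "1/2" "q - 1"] by (simp add: P_def)
    have "(x - \<delta>) powr (q - 1) \<le> max (x powr (q - 1)) ((x / 2) powr (q - 1))"
      using True \<delta> x by (intro powr_le_max_endpoints) auto
    then have "max (x powr (q - 1)) ((x - \<delta>) powr (q - 1)) \<le> max P (P * (1/2) powr (q - 1))"
      by (simp add: h P_def)
    also have "\<dots> \<le> max 1 ((1/2) powr (q - 1)) * P"
    proof (rule max.boundedI)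
      have "1 * P \<le> max 1 ((1/2) powr (q - 1)) * P" using P by (intro mult_right_mono) auto
      then show "P \<le> max 1 ((1/2) powr (q - 1)) * P" by simp
      have "(1/2) powr (q - 1) * P \<le> max 1 ((1/2) powr (q - 1)) * P" using P by (intro mult_right_mono) auto
      then show "P * (1/2) powr (q - 1) \<le> max 1 ((1/2) powr (q - 1)) * P" by (simp only: mult.commute)
    qed
    also have "\<dots> \<le> ?k * P" using P q_pos by (intro mult_right_mono) auto
    finally show ?thesis using True by simp
  next
    case False
    have "x powr q = x * P" using x by (simp add: P_def powr_mult_base)
    also have "\<dots> \<le> (2 * \<delta>) * P" using False P by (intro mult_right_mono) auto
    finally have "x powr q / (q * \<delta>) \<le> (2 * \<delta>) * P / (q * \<delta>)" using q_pos \<delta> by (intro divide_right_mono) auto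
    also have "\<dots> = 2 / q * P" using \<delta> by simp
    also have "\<dots> \<le> ?k * P" using P by (intro mult_right_mono) (auto simp: le_max_iff_disj)
    finally show ?thesis using False by simp
  qed
  note b = this
  have "r * \<delta> \<le> r" using r_nonneg \<delta> by (simp add: mult_left_le)
  then have "exp (r * \<delta>) * exp (- r * \<xi>) \<le> exp r * exp (- r * \<xi>)" by simp
  then have "weight_majorant \<delta> \<xi> \<le> (exp r * exp (- r * \<xi>)) * (?k * P)"
    unfolding weight_majorant_def x_def[symmetric] using False x b P q_pos \<delta>
    by (simp only: if_False) (rule mult_mono, auto simp: le_max_iff_disj)
  also have "\<dots> = exp r * ?k * weight \<xi>"
    using x by (simp add: weight_def pos_power_def x_def P_def algebra_simps)
  finally show ?thesis .
qed

lemma weight_majorant_tendsto: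
  assumes \<delta>: "\<delta> \<longlonglongrightarrow> 0" "\<And>n. 0 < \<delta> n"
  shows "(\<lambda>n. weight_majorant (\<delta> n) \<xi>) \<longlonglongrightarrow> weight \<xi>"
proof (cases "\<xi> \<le> \<alpha>")
  case True
  then show ?thesis by (simp add: weight_majorant_def weight_eq_0)
next
  case False
  define x where "x = \<xi> - \<alpha>"
  have x: "0 < x" using False by (simp add: x_def)
  have "(\<lambda>n. exp (r * \<delta> n) * exp (- r * \<xi>) * max (x powr (q - 1)) ((x - \<delta> n) powr (q - 1)))
      \<longlonglongrightarrow> exp (r * 0) * exp (- r * \<xi>) * max (x powr (q - 1)) ((x - 0) powr (q - 1))"
    using x by (intro tendsto_intros \<delta>) auto
  also have "exp (r * 0) * exp (- r * \<xi>) * max (x powr (q - 1)) ((x - 0) powr (q - 1)) = weight \<xi>"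
    using x by (simp add: weight_def pos_power_def x_def)
  finally have l: "(\<lambda>n. exp (r * \<delta> n) * exp (- r * \<xi>) * max (x powr (q - 1)) ((x - \<delta> n) powr (q - 1))) \<longlonglongrightarrow> weight \<xi>" .
  have "eventually (\<lambda>n. \<delta> n < x / 2) sequentially" using order_tendstoD(2)[OF \<delta>(1), of "x/2"] x by simp
  then have "eventually (\<lambda>n. exp (r * \<delta> n) * exp (- r * \<xi>) * max (x powr (q - 1)) ((x - \<delta> n) powr (q - 1))
      = weight_majorant (\<delta> n) \<xi>) sequentially"
    by eventually_elim (use False in \<open>simp add: weight_majorant_def x_def\<close>)
  with l show ?thesis by (rule Lim_transform_eventually)
qed

text \<open>
  For \<open>q \<ge> 1\<close> every small translation would do. For \<open>q < 1\<close> the weight is singular and an individual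
  translation may increase the integral, but their average does not in the limit.
\<close>

lemma good_translation:
  assumes Gm[measurable]: "G \<in> borel_measurable borel" and G0: "\<And>\<xi>. 0 \<le> G \<xi>"
    and int: "integrable lborel (\<lambda>\<xi>. weight \<xi> * G \<xi>)" and e: "0 < e" and d: "0 < d"
  obtains s where "0 < s" "s < d"
    "(\<integral>\<^sup>+\<xi>. ennreal (weight \<xi> * G (s + \<xi>)) \<partial>lborel) \<le> ennreal ((LINT \<xi>|lborel. weight \<xi> * G \<xi>) + e)"
proof -
  let ?A = "LINT \<xi>|lborel. weight \<xi> * G \<xi>"
  have A: "0 \<le> ?A" by (simp add: integral_nonneg_AE weight_nonneg G0)
  define \<delta> where "\<delta> n = 1 / real (Suc n)" for n
  have \<delta>: "0 < \<delta> n" "\<delta> n \<le> 1" for n by (simp_all add: \<delta>_def)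
  have \<delta>l: "\<delta> \<longlonglongrightarrow> 0" unfolding \<delta>_def using LIMSEQ_inverse_real_of_nat by (simp add: inverse_eq_divide)
  define k where "k = exp r * (max 1 ((1/2) powr (q - 1)) + 2 / q)"
  have ik: "integrable lborel (\<lambda>\<xi>. k * (weight \<xi> * G \<xi>))" using int by simp
  have bd: "norm (weight_majorant (\<delta> n) \<xi> * G \<xi>) \<le> k * (weight \<xi> * G \<xi>)" for n \<xi>
    using mult_right_mono[OF weight_majorant_le[OF \<delta>[of n], of \<xi>] G0[of \<xi>]]
      weight_majorant_nonneg[OF \<delta>(1)[of n], of \<xi>] G0[of \<xi>] by (simp add: k_def mult.assoc)
  have "(\<lambda>n. LINT \<xi>|lborel. weight_majorant (\<delta> n) \<xi> * G \<xi>) \<longlonglongrightarrow> ?A"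
  proof (rule integral_dominated_convergence[OF _ _ ik])
    show "AE \<xi> in lborel. (\<lambda>n. weight_majorant (\<delta> n) \<xi> * G \<xi>) \<longlonglongrightarrow> weight \<xi> * G \<xi>"
      by (intro AE_I2 tendsto_intros weight_majorant_tendsto \<delta>l \<delta>)
  qed (use bd in auto)
  then have "eventually (\<lambda>n. (LINT \<xi>|lborel. weight_majorant (\<delta> n) \<xi> * G \<xi>) < ?A + e \<and> \<delta> n < d) sequentially"
    using order_tendstoD(2)[of _ ?A sequentially "?A + e"] order_tendstoD(2)[OF \<delta>l d] e
    by (intro eventually_conj) auto
  then obtain n where n: "(LINT \<xi>|lborel. weight_majorant (\<delta> n) \<xi> * G \<xi>) < ?A + e" "\<delta> n < d"
    using eventually_happens'[OF sequentially_bot] by blast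
  have im: "integrable lborel (\<lambda>\<xi>. weight_majorant (\<delta> n) \<xi> * G \<xi>)"
    by (rule Bochner_Integration.integrable_bound[OF ik]) (use bd[of n] in \<open>auto intro!: AE_I2 intro: order_trans[OF _ abs_ge_self]\<close>)
  define H where "H s = (\<integral>\<^sup>+\<xi>. ennreal (weight (\<xi> - s) * G \<xi>) \<partial>lborel)" for s
  have "\<exists>s\<in>{0<..<\<delta> n}. H s \<le> ennreal (?A + e)"
  proof (rule ccontr)
    assume "\<not> ?thesis"
    then have big: "ennreal (?A + e) \<le> H s" if "s \<in> {0<..<\<delta> n}" for s using that by (meson linear)
    have "ennreal (?A + e) * ennreal (\<delta> n) = (\<integral>\<^sup>+s. ennreal (?A + e) * indicator {0<..<\<delta> n} s \<partial>lborel)"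
      using \<delta>(1)[of n] by (subst nn_integral_cmult_indicator) auto
    also have "\<dots> \<le> (\<integral>\<^sup>+s. indicator {0<..<\<delta> n} s * H s \<partial>lborel)"
      using big by (intro nn_integral_mono) (auto simp: indicator_def)
    also have "\<dots> = (\<integral>\<^sup>+s. \<integral>\<^sup>+\<xi>. indicator {0<..<\<delta> n} s * ennreal (weight (\<xi> - s) * G \<xi>) \<partial>lborel \<partial>lborel)"
      unfolding H_def by (subst nn_integral_cmult) auto
    also have "\<dots> = (\<integral>\<^sup>+\<xi>. \<integral>\<^sup>+s. indicator {0<..<\<delta> n} s * ennreal (weight (\<xi> - s) * G \<xi>) \<partial>lborel \<partial>lborel)"
      by (rule lborel_pair.Fubini') measurable
    also have "\<dots> = (\<integral>\<^sup>+\<xi>. (\<integral>\<^sup>+s. indicator {0<..<\<delta> n} s * ennreal (weight (\<xi> - s)) \<partial>lborel) * ennreal (G \<xi>) \<partial>lborel)"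
    proof (rule nn_integral_cong)
      fix \<xi>
      have "indicator {0<..<\<delta> n} s * ennreal (weight (\<xi> - s) * G \<xi>)
          = (indicator {0<..<\<delta> n} s * ennreal (weight (\<xi> - s))) * ennreal (G \<xi>)" for s
        using G0[of \<xi>] weight_nonneg[of "\<xi> - s"] by (simp add: ennreal_mult mult.assoc)
      then show "(\<integral>\<^sup>+s. indicator {0<..<\<delta> n} s * ennreal (weight (\<xi> - s) * G \<xi>) \<partial>lborel)
          = (\<integral>\<^sup>+s. indicator {0<..<\<delta> n} s * ennreal (weight (\<xi> - s)) \<partial>lborel) * ennreal (G \<xi>)"
        by (simp only:) (rule nn_integral_multc, measurable)
    qed
    also have "\<dots> \<le> (\<integral>\<^sup>+\<xi>. ennreal (\<delta> n * weight_majorant (\<delta> n) \<xi>) * ennreal (G \<xi>) \<partial>lborel)"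
      by (intro nn_integral_mono mult_right_mono nn_integral_weight_translates_le \<delta>) auto
    also have "\<dots> = (\<integral>\<^sup>+\<xi>. ennreal (\<delta> n * (weight_majorant (\<delta> n) \<xi> * G \<xi>)) \<partial>lborel)"
      using \<delta>(1)[of n] weight_majorant_nonneg[OF \<delta>(1)[of n]] G0
      by (intro nn_integral_cong) (simp add: mult.assoc flip: ennreal_mult)
    also have "\<dots> = ennreal (LINT \<xi>|lborel. \<delta> n * (weight_majorant (\<delta> n) \<xi> * G \<xi>))"
      using \<delta>(1)[of n] weight_majorant_nonneg[OF \<delta>(1)[of n]] G0 im
      by (intro nn_integral_eq_integral) auto
    also have "\<dots> = ennreal (\<delta> n * (LINT \<xi>|lborel. weight_majorant (\<delta> n) \<xi> * G \<xi>))" by simp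
    also have "\<dots> < ennreal (\<delta> n * (?A + e))"
      using n(1) \<delta>(1)[of n] A e by (intro ennreal_lessI mult_pos_pos mult_strict_left_mono) auto
    also have "\<dots> = ennreal (?A + e) * ennreal (\<delta> n)"
      using \<delta>(1)[of n] A e by (subst ennreal_mult[symmetric]) (auto simp: mult.commute)
    finally show False by simp
  qed
  then obtain s where s: "0 < s" "s < \<delta> n" "H s \<le> ennreal (?A + e)" by auto
  have "H s = (\<integral>\<^sup>+\<xi>. ennreal (weight (s + 1 * \<xi> - s) * G (s + 1 * \<xi>)) \<partial>lborel)"
    unfolding H_def by (subst nn_integral_real_affine[where c = 1 and t = s]) simp_all
  then have "H s = (\<integral>\<^sup>+\<xi>. ennreal (weight \<xi> * G (s + \<xi>)) \<partial>lborel)" by simp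
  then show ?thesis using that[of s] s n(2) by simp
qed

subsection \<open>Approximation in the form norm\<close>

text \<open>
  For \<open>u(t) = exp (- s t) f(t - \<epsilon>)\<close> the transform is \<open>exp (- \<epsilon> (\<xi> + s)) (L f)(\<xi> + s)\<close>. The shift moves the
  support away from the origin, and the damping makes the function integrable. The shift decreases the
  transform in modulus; the translation by \<open>s\<close> caused by the damping is harmless for a good choice of
  \<open>s\<close> in \<open>(0, \<epsilon>)\<close>.
\<close>

lemma damped_shifts:
  assumes f: "f \<in> Dom"
  obtains u where "\<And>n::nat. u n \<in> Dom" "\<And>n. integrable Rplus (u n)"
    "\<And>n t. 0 < t \<Longrightarrow> t < 1 / real (Suc n) \<Longrightarrow> u n t = 0"
    "(\<lambda>n. l2_norm Rplus (\<lambda>t. u n t - f t)) \<longlonglongrightarrow> 0"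
    "\<And>n. (l2_norm lborel (W (u n)))\<^sup>2 \<le> (l2_norm lborel (W f))\<^sup>2 + 1 / real (Suc n)"
proof -
  have fL: "f \<in> L2 Rplus" and fW: "W f \<in> L2 lborel" using f Dom_L2 Dom_W by blast+
  define \<epsilon> where "\<epsilon> n = 1 / real (Suc n)" for n
  have \<epsilon>: "0 < \<epsilon> n" "0 \<le> \<epsilon> n" "\<epsilon> n \<le> 1" for n by (simp_all add: \<epsilon>_def)
  have \<epsilon>l: "\<epsilon> \<longlonglongrightarrow> 0" unfolding \<epsilon>_def using LIMSEQ_inverse_real_of_nat by (simp add: inverse_eq_divide)
  define G where "G \<xi> = (cmod (laplace f \<xi>))\<^sup>2" for \<xi>
  have lm[measurable]: "laplace f \<in> borel_measurable borel" by (rule laplace_measurable[OF L2_measurable[OF fL]])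
  have Gm: "G \<in> borel_measurable borel" unfolding G_def by measurable
  have WG: "(cmod (W f \<xi>))\<^sup>2 = weight \<xi> * G \<xi>" for \<xi>
    by (simp add: W_def G_def norm_mult power_mult_distrib weight_nonneg)
  have int: "integrable lborel (\<lambda>\<xi>. weight \<xi> * G \<xi>)" using L2_integrable[OF fW] by (simp add: WG)
  have A: "(LINT \<xi>|lborel. weight \<xi> * G \<xi>) = (l2_norm lborel (W f))\<^sup>2" by (simp add: l2_norm_squared WG)
  have "\<exists>s. 0 < s \<and> s < \<epsilon> n \<and> (\<integral>\<^sup>+\<xi>. ennreal (weight \<xi> * G (s + \<xi>)) \<partial>lborel)
      \<le> ennreal ((l2_norm lborel (W f))\<^sup>2 + \<epsilon> n)" for n
  proof -
    have G0: "0 \<le> G \<xi>" for \<xi> by (simp add: G_def)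
    show ?thesis
      by (rule good_translation[OF Gm G0 int \<epsilon>(1)[of n] \<epsilon>(1)[of n]]) (auto simp only: A)
  qed
  then obtain s where s: "\<And>n. 0 < s n" "\<And>n. s n < \<epsilon> n"
    "\<And>n. (\<integral>\<^sup>+\<xi>. ennreal (weight \<xi> * G (s n + \<xi>)) \<partial>lborel) \<le> ennreal ((l2_norm lborel (W f))\<^sup>2 + \<epsilon> n)"
    by metis
  define u where "u n t = complex_of_real (exp (- t * s n)) * shift (\<epsilon> n) f t" for n t
  have SL: "shift (\<epsilon> n) f \<in> L2 Rplus" for n by (rule shift_L2(1)[OF \<epsilon>(2) fL])
  have ui: "integrable Rplus (u n)" for n unfolding u_def by (rule laplace_integrable[OF SL s(1)])
  have damp: "(\<lambda>t. complex_of_real (exp (- t * s n)) * g t) \<in> L2 Rplus" "l2_norm Rplus (\<lambda>t. complex_of_real (exp (- t * s n)) * g t) \<le> l2_norm Rplus g"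
    if g: "g \<in> L2 Rplus" for g n
  proof -
    have m: "(\<lambda>t. complex_of_real (exp (- t * s n)) * g t) \<in> borel_measurable Rplus"
      by (rule borel_measurable_integrable[OF laplace_integrable[OF g s(1)]])
    have le: "(cmod (complex_of_real (exp (- t * s n)) * g t))\<^sup>2 \<le> (cmod (g t))\<^sup>2" if "t \<in> space Rplus" for t
    proof -
      have "exp (- t * s n) \<le> 1" using that s(1)[of n] by (simp add: space_Rplus)
      then have "exp (- t * s n) * cmod (g t) \<le> 1 * cmod (g t)" by (intro mult_right_mono) auto
      then have "cmod (complex_of_real (exp (- t * s n)) * g t) \<le> cmod (g t)" by (simp add: norm_mult)
      then show ?thesis by (rule power_mono) simp
    qed
    show L: "(\<lambda>t. complex_of_real (exp (- t * s n)) * g t) \<in> L2 Rplus"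
      by (rule L2_dominated[OF m L2_integrable[OF g] le])
    show "l2_norm Rplus (\<lambda>t. complex_of_real (exp (- t * s n)) * g t) \<le> l2_norm Rplus g"
      unfolding l2_norm_def by (intro real_sqrt_le_mono integral_mono L2_integrable[OF L] L2_integrable[OF g] le)
  qed
  have uL: "u n \<in> L2 Rplus" for n unfolding u_def by (rule damp(1)[OF SL])
  have Lu: "laplace (u n) \<xi> = complex_of_real (exp (- (\<epsilon> n * (s n + \<xi>)))) * laplace f (s n + \<xi>)" for n \<xi>
  proof -
    have "laplace (u n) \<xi> = laplace (shift (\<epsilon> n) f) (s n + \<xi>)"
      unfolding laplace_def u_def by (simp add: algebra_simps mult_exp_exp flip: of_real_mult mult.assoc)
    then show ?thesis using laplace_shift[OF \<epsilon>(2)] by simp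
  qed
  have Wu: "(cmod (W (u n) \<xi>))\<^sup>2 \<le> weight \<xi> * G (s n + \<xi>)" for n \<xi>
  proof (cases "\<xi> \<le> \<alpha>")
    case False
    then have "0 < s n + \<xi>" using \<alpha>_nonneg s(1)[of n] by simp
    then have "exp (- (\<epsilon> n * (s n + \<xi>))) \<le> 1" using \<epsilon>(1)[of n] by simp
    then have "exp (- (\<epsilon> n * (s n + \<xi>))) * cmod (laplace f (s n + \<xi>)) \<le> 1 * cmod (laplace f (s n + \<xi>))"
      by (intro mult_right_mono) auto
    then have "(cmod (laplace (u n) \<xi>))\<^sup>2 \<le> G (s n + \<xi>)"
      unfolding Lu G_def by (intro power_mono) (auto simp: norm_mult)
    then show ?thesis
      by (simp add: W_def norm_mult power_mult_distrib weight_nonneg mult_left_mono)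
  qed (simp add: W_def weight_eq_0)
  have nn: "(\<integral>\<^sup>+\<xi>. ennreal ((cmod (W (u n) \<xi>))\<^sup>2) \<partial>lborel) \<le> ennreal ((l2_norm lborel (W f))\<^sup>2 + \<epsilon> n)" for n
    using nn_integral_mono[OF ennreal_leI[OF Wu]] s(3) by (rule order_trans)
  have Wm: "W (u n) \<in> borel_measurable lborel" for n by (rule W_measurable[OF uL])
  have uW: "W (u n) \<in> L2 lborel" for n
  proof -
    have "integrable lborel (\<lambda>\<xi>. (cmod (W (u n) \<xi>))\<^sup>2)"
    proof (rule integrableI_nonneg)
      show "(\<lambda>\<xi>. (cmod (W (u n) \<xi>))\<^sup>2) \<in> borel_measurable lborel" using Wm by measurable
      show "(\<integral>\<^sup>+\<xi>. ennreal ((cmod (W (u n) \<xi>))\<^sup>2) \<partial>lborel) < \<infinity>"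
        using nn[of n] by (rule le_less_trans) simp
    qed simp
    then show ?thesis using Wm by (simp add: L2_def)
  qed
  show ?thesis
  proof (rule that[of u])
    show "u n \<in> Dom" for n using uL uW by (simp add: Dom_iff)
    show "integrable Rplus (u n)" for n by (rule ui)
    show "u n t = 0" if "t < 1 / real (Suc n)" for n t using that by (simp add: u_def shift_def \<epsilon>_def)
    show "(l2_norm lborel (W (u n)))\<^sup>2 \<le> (l2_norm lborel (W f))\<^sup>2 + 1 / real (Suc n)" for n
    proof -
      have "ennreal ((l2_norm lborel (W (u n)))\<^sup>2) \<le> ennreal ((l2_norm lborel (W f))\<^sup>2 + \<epsilon> n)"
        using nn[of n] nn_integral_eq_integral[OF L2_integrable[OF uW[of n]]] by (simp add: l2_norm_squared)
      then have "(l2_norm lborel (W (u n)))\<^sup>2 \<le> (l2_norm lborel (W f))\<^sup>2 + \<epsilon> n"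
        by (subst (asm) ennreal_le_iff) (use \<epsilon>(2)[of n] in auto)
      then show ?thesis by (simp add: \<epsilon>_def)
    qed
    have sl: "s \<longlonglongrightarrow> 0"
      by (rule tendsto_sandwich[OF _ _ tendsto_const \<epsilon>l]) (use s in \<open>auto intro!: always_eventually less_imp_le\<close>)
    have "(\<lambda>n. (l2_norm Rplus (\<lambda>t. u n t - f t))\<^sup>2) \<longlonglongrightarrow> 0"
    proof (rule tendsto_sandwich[OF _ _ tendsto_const])
      show "eventually (\<lambda>n. 0 \<le> (l2_norm Rplus (\<lambda>t. u n t - f t))\<^sup>2) sequentially" by simp
      have "(\<lambda>n. 2 * (l2_norm Rplus (\<lambda>t. shift (\<epsilon> n) f t - f t))\<^sup>2
          + 2 * (l2_norm Rplus (\<lambda>t. complex_of_real (exp (- t * s n)) * f t - f t))\<^sup>2) \<longlonglongrightarrow> 2 * 0 + 2 * 0"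
        by (intro tendsto_intros shift_tendsto damp_tendsto fL \<epsilon>l \<epsilon> sl less_imp_le s)
      then show "(\<lambda>n. 2 * (l2_norm Rplus (\<lambda>t. shift (\<epsilon> n) f t - f t))\<^sup>2
          + 2 * (l2_norm Rplus (\<lambda>t. complex_of_real (exp (- t * s n)) * f t - f t))\<^sup>2) \<longlonglongrightarrow> 0" by simp
      show "eventually (\<lambda>n. (l2_norm Rplus (\<lambda>t. u n t - f t))\<^sup>2
        \<le> 2 * (l2_norm Rplus (\<lambda>t. shift (\<epsilon> n) f t - f t))\<^sup>2
          + 2 * (l2_norm Rplus (\<lambda>t. complex_of_real (exp (- t * s n)) * f t - f t))\<^sup>2) sequentially"
      proof (intro always_eventually allI)
        fix n
        have dL: "(\<lambda>t. shift (\<epsilon> n) f t - f t) \<in> L2 Rplus" by (rule L2_diff[OF SL fL])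
        have "(\<lambda>t. u n t - f t) = (\<lambda>t. complex_of_real (exp (- t * s n)) * (shift (\<epsilon> n) f t - f t)
            + (complex_of_real (exp (- t * s n)) * f t - f t))"
          by (simp add: u_def algebra_simps)
        then have "(l2_norm Rplus (\<lambda>t. u n t - f t))\<^sup>2
            \<le> 2 * (l2_norm Rplus (\<lambda>t. complex_of_real (exp (- t * s n)) * (shift (\<epsilon> n) f t - f t)))\<^sup>2
            + 2 * (l2_norm Rplus (\<lambda>t. complex_of_real (exp (- t * s n)) * f t - f t))\<^sup>2"
          by (simp only:) (intro l2_norm_add_squared_le damp dL L2_diff fL)
        moreover have "(l2_norm Rplus (\<lambda>t. complex_of_real (exp (- t * s n)) * (shift (\<epsilon> n) f t - f t)))\<^sup>2
            \<le> (l2_norm Rplus (\<lambda>t. shift (\<epsilon> n) f t - f t))\<^sup>2"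
          by (intro power_mono damp dL l2_norm_nonneg)
        ultimately show "(l2_norm Rplus (\<lambda>t. u n t - f t))\<^sup>2
          \<le> 2 * (l2_norm Rplus (\<lambda>t. shift (\<epsilon> n) f t - f t))\<^sup>2
            + 2 * (l2_norm Rplus (\<lambda>t. complex_of_real (exp (- t * s n)) * f t - f t))\<^sup>2" by linarith
      qed
    qed
    then show "(\<lambda>n. l2_norm Rplus (\<lambda>t. u n t - f t)) \<longlonglongrightarrow> 0" by (rule l2_norm_tendsto_0I)
  qed
qed

text \<open>
  Damped shifts of \<open>f\<close> approximate \<open>f\<close> in the form norm: their weighted transforms converge
  pointwise, with norms that exceed that of the limit by a null sequence at most. Each damped shift is integrable and vanishes near the
  origin, where the form is continuous in \<open>L\<^sup>1\<close>, so test functions approximate it.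
\<close>

lemma C0_infinity_core:
  assumes f: "f \<in> Dom" and e: "0 < e"
  shows "\<exists>\<phi>\<in>C0_infinity_Rplus. (l2_norm Rplus (\<lambda>t. \<phi> t - f t))\<^sup>2 < e \<and>
    (l2_norm lborel (W (\<lambda>t. \<phi> t - f t)))\<^sup>2 < e"
proof -
  have fL: "f \<in> L2 Rplus" and fW: "W f \<in> L2 lborel" using f Dom_L2 Dom_W by blast+
  obtain u where u: "\<And>n::nat. u n \<in> Dom" and ui: "\<And>n. integrable Rplus (u n)"
    and u0: "\<And>n t. 0 < t \<Longrightarrow> t < 1 / real (Suc n) \<Longrightarrow> u n t = 0"
    and ul: "(\<lambda>n. l2_norm Rplus (\<lambda>t. u n t - f t)) \<longlonglongrightarrow> 0"
    and uW: "\<And>n. (l2_norm lborel (W (u n)))\<^sup>2 \<le> (l2_norm lborel (W f))\<^sup>2 + 1 / real (Suc n)"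
    by (rule damped_shifts[OF f]) (rule that)
  have uL: "u n \<in> L2 Rplus" for n using u Dom_L2 by blast
  have "(\<lambda>n. (l2_norm Rplus (\<lambda>t. u n t - f t))\<^sup>2) \<longlonglongrightarrow> 0\<^sup>2" by (intro tendsto_intros ul)
  from order_tendstoD(2)[OF this, of "e / 4"] have "eventually (\<lambda>n. (l2_norm Rplus (\<lambda>t. u n t - f t))\<^sup>2 < e / 4) sequentially"
    using e by simp
  then obtain N where N: "\<And>n. n \<ge> N \<Longrightarrow> (l2_norm Rplus (\<lambda>t. u n t - f t))\<^sup>2 < e / 4"
    unfolding eventually_sequentially by blast
  have "\<exists>n\<ge>N. (l2_norm lborel (\<lambda>\<xi>. W (u n) \<xi> - W f \<xi>))\<^sup>2 < e / 4"
  proof (rule L2_close_of_pointwise_and_norm[OF Dom_W[OF u] fW _ _ uW])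
    show "AE \<xi> in lborel. (\<lambda>n. W (u n) \<xi>) \<longlonglongrightarrow> W f \<xi>" by (intro AE_I2 W_tendsto uL fL ul)
    show "(\<lambda>n. 1 / real (Suc n)) \<longlonglongrightarrow> 0" using LIMSEQ_inverse_real_of_nat by (simp add: inverse_eq_divide)
  qed (use e in simp)
  then obtain n where n: "n \<ge> N" "(l2_norm lborel (\<lambda>\<xi>. W (u n) \<xi> - W f \<xi>))\<^sup>2 < e / 4" by blast
  define \<epsilon> where "\<epsilon> = 1 / real (Suc n)"
  have \<epsilon>: "0 < \<epsilon>" by (simp add: \<epsilon>_def)
  define c where "c = (LINT \<xi>|lborel. weight \<xi> * exp (- (2 * (\<epsilon> / 2) * \<xi>)))"
  have c: "0 \<le> c" unfolding c_def by (intro integral_nonneg_AE AE_I2) (simp add: weight_nonneg)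
  define d where "d = min (e / 4) (sqrt (e / (4 * (c + 1))))"
  have d: "0 < d" using e c by (simp add: d_def)
  obtain \<phi> where \<phi>: "\<phi> \<in> C0_infinity_Rplus" "\<And>x. x < \<epsilon> / 2 \<Longrightarrow> \<phi> x = 0"
      "(l2_norm Rplus (\<lambda>x. u n x - \<phi> x))\<^sup>2 < d" "(LINT x|Rplus. cmod (u n x - \<phi> x)) < d"
    using test_function_approximation_Rplus[OF uL less_imp_le[OF \<epsilon>] _ d, of n] u0[of _ n] ui[of n]
    unfolding \<epsilon>_def by blast
  have \<phi>L: "\<phi> \<in> L2 Rplus" "integrable Rplus \<phi>" "\<phi> \<in> Dom"
    using C0_infinity_Rplus_integrable[OF \<phi>(1)] C0_infinity_subset_Dom \<phi>(1) by auto
  define g where "g = (\<lambda>x. u n x - \<phi> x)"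
  have gL: "g \<in> L2 Rplus" unfolding g_def by (rule L2_diff[OF uL \<phi>L(1)])
  have gi: "integrable Rplus g" unfolding g_def by (rule Bochner_Integration.integrable_diff[OF ui \<phi>L(2)])
  have g0: "g t = 0" if "0 < t" "t < \<epsilon> / 2" for t
  proof -
    have "t < \<epsilon>" using that by linarith
    then have "t < 1 / real (Suc n)" by (simp only: \<epsilon>_def)
    then have "u n t = 0" by (rule u0[OF that(1)])
    then show ?thesis using \<phi>(2)[OF that(2)] by (simp add: g_def)
  qed
  have \<epsilon>2: "0 < \<epsilon> / 2" using \<epsilon> by simp
  have "(l2_norm lborel (W g))\<^sup>2 \<le> c * (LINT x|Rplus. cmod (g x))\<^sup>2"
    unfolding c_def by (rule L1_away_from_0_Dom(2)[OF gL gi \<epsilon>2 g0])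
  also have "\<dots> \<le> c * (sqrt (e / (4 * (c + 1))))\<^sup>2"
    using \<phi>(4) c by (intro mult_left_mono power_mono) (auto simp: g_def d_def)
  also have "\<dots> = c * (e / (4 * (c + 1)))" using e c by simp
  also have "\<dots> < e / 4" using e c by (simp add: field_simps)
  finally have gW: "(l2_norm lborel (W g))\<^sup>2 < e / 4" .
  have gD: "g \<in> Dom" by (rule L1_away_from_0_Dom(1)[OF gL gi \<epsilon>2 g0])
  have g2: "(l2_norm Rplus g)\<^sup>2 < e / 4" using \<phi>(3) by (simp add: g_def d_def)
  define h where "h = (\<lambda>t. f t - u n t)"
  have hL: "h \<in> L2 Rplus" unfolding h_def by (rule L2_diff[OF fL uL])
  have hD: "h \<in> Dom" unfolding h_def by (rule l2_subspace_diff[OF l2_subspace_Dom f u])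
  have h2: "(l2_norm Rplus h)\<^sup>2 < e / 4" using N[OF n(1)] by (simp add: h_def l2_norm_sub_commute)
  have hW: "(l2_norm lborel (W h))\<^sup>2 < e / 4"
    using n(2) by (simp add: h_def W_diff[OF fL uL] l2_norm_sub_commute[of lborel "W f"])
  have gh: "(\<lambda>t. f t - \<phi> t) = (\<lambda>t. g t + h t)" by (simp add: g_def h_def)
  have "(l2_norm Rplus (\<lambda>t. f t - \<phi> t))\<^sup>2 < e"
    unfolding gh using l2_norm_add_squared_le[OF gL hL] g2 h2 by linarith
  moreover have "(l2_norm lborel (W (\<lambda>t. f t - \<phi> t)))\<^sup>2 < e"
    unfolding gh W_add[OF gL hL] using l2_norm_add_squared_le[OF Dom_W[OF gD] Dom_W[OF hD]] gW hW by linarith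
  moreover have "l2_norm Rplus (\<lambda>t. \<phi> t - f t) = l2_norm Rplus (\<lambda>t. f t - \<phi> t)"
    by (rule l2_norm_sub_commute)
  moreover have "l2_norm lborel (W (\<lambda>t. \<phi> t - f t)) = l2_norm lborel (W (\<lambda>t. f t - \<phi> t))"
    unfolding W_diff[OF fL \<phi>L(1)] W_diff[OF \<phi>L(1) fL] by (rule l2_norm_sub_commute)
  ultimately show ?thesis by (intro bexI[OF _ \<phi>(1)] conjI) simp_all
qed

end

section \<open>The Hankel operator\<close>

context quasi_carleman begin

abbreviation K :: "(real \<Rightarrow> complex) \<Rightarrow> complex" where
  "K \<equiv> hankel_form (qc_kernel r q \<alpha>)"

lemma form_converges_K_imp_Q:
  assumes "form_converges Rplus C0_infinity_Rplus K u f"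
  shows "form_converges Rplus Dom Q u f"
proof -
  have u: "u n \<in> C0_infinity_Rplus" for n using assms by (simp add: form_converges_def)
  have "K (\<lambda>x. u m x - u n x) = Q (\<lambda>x. u m x - u n x)" for m n
    by (intro hankel_form_eq_laplace_form l2_subspace_diff[OF l2_subspace_C0_infinity] u)
  moreover have "u n \<in> Dom" for n using u C0_infinity_subset_Dom by blast
  ultimately show ?thesis using assms by (simp add: form_converges_def)
qed

lemma nonneg_form_K: "nonneg_form Rplus C0_infinity_Rplus K"
  by (rule nonneg_form_subspace[OF l2_subspace_C0_infinity C0_infinity_subset_Dom])
     (rule hankel_form_eq_laplace_form(2))

text \<open>
  The form is continuous with respect to its own seminorm, by the Cauchy-Schwarz inequality.
\<close>

lemma Q_tendsto:
  assumes u: "\<And>n. u n \<in> Dom" and f: "f \<in> Dom" and lim: "(\<lambda>n. Q (\<lambda>x. u n x - f x)) \<longlonglongrightarrow> 0"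
  shows "(\<lambda>n. Q (u n)) \<longlonglongrightarrow> Q f"
proof -
  have d: "(\<lambda>x. u n x - f x) \<in> Dom" for n by (rule l2_subspace_diff[OF l2_subspace_Dom u f])
  have ReQ: "(\<lambda>n. Re (B (\<lambda>x. u n x - f x) (\<lambda>x. u n x - f x)) * Re (B f f)) \<longlonglongrightarrow> Re 0 * Re (B f f)"
    using lim unfolding Q_eq_B by (intro tendsto_intros)
  have "(\<lambda>n. (cmod (B (\<lambda>x. u n x - f x) f))\<^sup>2) \<longlonglongrightarrow> 0"
  proof (rule tendsto_sandwich[OF _ _ tendsto_const])
    show "(\<lambda>n. Re (B (\<lambda>x. u n x - f x) (\<lambda>x. u n x - f x)) * Re (B f f)) \<longlonglongrightarrow> 0" using ReQ by simp
  qed (use semi_inner_Cauchy_Schwarz[OF semi_inner_B d f] in auto)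
  then have l: "(\<lambda>n. B (\<lambda>x. u n x - f x) f) \<longlonglongrightarrow> 0" by (simp add: tendsto_norm_zero_iff)
  have Qu: "Q (u n) = Q f + B (\<lambda>x. u n x - f x) f + cnj (B (\<lambda>x. u n x - f x) f) + Q (\<lambda>x. u n x - f x)" for n
    using sesquilinear_expand[OF semi_inner_sesquilinear[OF semi_inner_B] l2_subspace_Dom f d, of 1 n]
      semi_inner_hermitian[OF semi_inner_B d f] by (simp add: Q_eq_B)
  have "(\<lambda>n. Q f + B (\<lambda>x. u n x - f x) f + cnj (B (\<lambda>x. u n x - f x) f) + Q (\<lambda>x. u n x - f x)) \<longlonglongrightarrow> Q f + 0 + cnj 0 + 0"
    by (intro tendsto_intros l lim)
  then show ?thesis unfolding Qu by simp
qed

lemma K_tendsto: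
  assumes conv: "form_converges Rplus C0_infinity_Rplus K u f"
  shows "(\<lambda>n. K (u n)) \<longlonglongrightarrow> Q f"
proof -
  note c = form_converges_Dom[OF form_converges_K_imp_Q[OF conv]]
  have u: "u n \<in> C0_infinity_Rplus" for n using conv by (simp add: form_converges_def)
  have "u n \<in> Dom" for n using u C0_infinity_subset_Dom by blast
  from Q_tendsto[OF this c] show ?thesis
    using hankel_form_eq_laplace_form(2)[OF u] by simp
qed

lemma closable_form_K: "closable_form Rplus C0_infinity_Rplus K"
  unfolding closable_form_def
proof (intro conjI allI impI nonneg_form_K)
  fix u assume "form_converges Rplus C0_infinity_Rplus K u (\<lambda>x. 0)"
  then have "(\<lambda>n. K (u n)) \<longlonglongrightarrow> Q (\<lambda>x. 0)" by (rule K_tendsto)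
  also have "Q (\<lambda>x. 0) = 0" by (simp add: laplace_form_eq W_def laplace_def l2_norm_def)
  finally show "(\<lambda>n. K (u n)) \<longlonglongrightarrow> 0" .
qed

lemma Dom_imp_form_converges_K:
  assumes f: "f \<in> Dom" shows "\<exists>u. form_converges Rplus C0_infinity_Rplus K u f"
proof -
  have "\<exists>\<phi>\<in>C0_infinity_Rplus. (l2_norm Rplus (\<lambda>t. \<phi> t - f t))\<^sup>2 < 1 / real (Suc n) \<and>
    (l2_norm lborel (W (\<lambda>t. \<phi> t - f t)))\<^sup>2 < 1 / real (Suc n)" for n
    by (rule C0_infinity_core[OF f]) simp
  then obtain u where u: "\<And>n. u n \<in> C0_infinity_Rplus"
    and u2: "\<And>n. (l2_norm Rplus (\<lambda>t. u n t - f t))\<^sup>2 < 1 / real (Suc n)"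
    and uW: "\<And>n. (l2_norm lborel (W (\<lambda>t. u n t - f t)))\<^sup>2 < 1 / real (Suc n)"
    by metis
  have inv: "(\<lambda>n. 1 / real (Suc n)) \<longlonglongrightarrow> 0" using LIMSEQ_inverse_real_of_nat by (simp add: inverse_eq_divide)
  have fL: "f \<in> L2 Rplus" using f by (rule Dom_L2)
  have uL: "u n \<in> L2 Rplus" and uD: "u n \<in> Dom" for n
    using u C0_infinity_subset_Dom Dom_L2 by blast+
  have dD: "(\<lambda>t. u n t - f t) \<in> Dom" for n by (rule l2_subspace_diff[OF l2_subspace_Dom uD f])
  have "(\<lambda>n. (l2_norm Rplus (\<lambda>t. u n t - f t))\<^sup>2) \<longlonglongrightarrow> 0"
  proof (rule tendsto_sandwich[OF _ _ tendsto_const inv])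
    show "eventually (\<lambda>n. (l2_norm Rplus (\<lambda>t. u n t - f t))\<^sup>2 \<le> 1 / real (Suc n)) sequentially"
      by (intro always_eventually allI less_imp_le u2)
  qed simp
  then have lim: "(\<lambda>n. l2_norm Rplus (\<lambda>t. u n t - f t)) \<longlonglongrightarrow> 0" by (rule l2_norm_tendsto_0I)
  have "\<exists>N. \<forall>m\<ge>N. \<forall>n\<ge>N. cmod (K (\<lambda>x. u m x - u n x)) < e" if e: "0 < e" for e
  proof -
    have "0 < e / (4 * C)" using e C_pos by simp
    then have "eventually (\<lambda>n. 1 / real (Suc n) < e / (4 * C)) sequentially"
      by (rule order_tendstoD(2)[OF inv])
    then obtain N where N: "\<And>n. n \<ge> N \<Longrightarrow> 1 / real (Suc n) < e / (4 * C)"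
      unfolding eventually_sequentially by blast
    show ?thesis
    proof (intro exI[of _ N] allI impI)
      fix m n assume mn: "N \<le> m" "N \<le> n"
      have KQ: "K (\<lambda>x. u m x - u n x) = Q (\<lambda>x. u m x - u n x)"
        by (intro hankel_form_eq_laplace_form l2_subspace_diff[OF l2_subspace_C0_infinity] u)
      have 1: "cmod (K (\<lambda>x. u m x - u n x)) = C * (l2_norm lborel (W (\<lambda>x. u m x - u n x)))\<^sup>2"
        unfolding KQ laplace_form_eq norm_of_real using C_pos by simp
      have "(\<lambda>x. u m x - u n x) = (\<lambda>x. (u m x - f x) + (- 1) * (u n x - f x))" by simp
      then have "W (\<lambda>x. u m x - u n x) = (\<lambda>\<xi>. W (\<lambda>x. u m x - f x) \<xi> + (- 1) * W (\<lambda>x. u n x - f x) \<xi>)"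
        by (simp only: W_add[OF Dom_L2[OF dD] L2_cmult[OF Dom_L2[OF dD]]] W_mult[OF Dom_L2[OF dD]])
      then have "(l2_norm lborel (W (\<lambda>x. u m x - u n x)))\<^sup>2
          \<le> 2 * (l2_norm lborel (W (\<lambda>x. u m x - f x)))\<^sup>2 + 2 * (l2_norm lborel (\<lambda>\<xi>. (- 1) * W (\<lambda>x. u n x - f x) \<xi>))\<^sup>2"
        by (simp only:) (intro l2_norm_add_squared_le L2_cmult Dom_W dD)
      also have "l2_norm lborel (\<lambda>\<xi>. (- 1) * W (\<lambda>x. u n x - f x) \<xi>) = l2_norm lborel (W (\<lambda>x. u n x - f x))"
        by (simp add: l2_norm_def)
      also have "2 * (l2_norm lborel (W (\<lambda>x. u m x - f x)))\<^sup>2 + 2 * (l2_norm lborel (W (\<lambda>x. u n x - f x)))\<^sup>2 < e / C"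
      proof -
        have "e / C = 4 * (e / (4 * C))" by simp
        then show ?thesis
          using less_trans[OF uW N[OF mn(1)]] less_trans[OF uW N[OF mn(2)]] by linarith
      qed
      finally show "cmod (K (\<lambda>x. u m x - u n x)) < e"
        unfolding 1 using C_pos by (simp add: field_simps)
    qed
  qed
  then have "form_converges Rplus C0_infinity_Rplus K u f"
    unfolding form_converges_def using u fL lim by blast
  then show ?thesis by (rule exI[where x = u])
qed

lemma is_form_closure_K: "is_form_closure Rplus C0_infinity_Rplus K Dom Q"
  unfolding is_form_closure_def
proof (intro conjI allI impI closable_form_K K_tendsto set_eqI iffI)
  fix f assume "f \<in> Dom"
  then show "f \<in> {f. \<exists>u. form_converges Rplus C0_infinity_Rplus K u f}"
    using Dom_imp_form_converges_K by blast
next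
  fix f assume "f \<in> {f. \<exists>u. form_converges Rplus C0_infinity_Rplus K u f}"
  then show "f \<in> Dom" using form_converges_Dom(1)[OF form_converges_K_imp_Q] by blast
qed

lemma l2_dense_Dom: "l2_dense Rplus Dom"
  using l2_dense_C0_infinity C0_infinity_subset_Dom Dom_L2 unfolding l2_dense_def by blast

text \<open>
  If \<open>A u = 0\<close>, then \<open>Q u = 0\<close>, so the Laplace transform of \<open>u\<close> vanishes almost everywhere on
  \<open>(\<alpha>, \<infinity>)\<close>, which determines \<open>u\<close>.
\<close>

lemma hankel_operator_strictly_positive: "l2_strictly_positive Rplus (qc_hankel_operator r q \<alpha>)"
proof -
  have op: "u \<in> Dom" "w \<in> L2 Rplus" "Q u = l2_inner Rplus w u"
    if "(u, w) \<in> qc_hankel_operator r q \<alpha>" for u w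
    using that form_operator_iff[OF semi_inner_B, of Q u w] unfolding qc_hankel_operator_def
    by (auto simp: Q_eq_B)
  have pos: "l2_inner Rplus w u \<in> \<real> \<and> 0 \<le> Re (l2_inner Rplus w u)"
    if "(u, w) \<in> qc_hankel_operator r q \<alpha>" for u w
    using semi_inner_real[OF semi_inner_B op(1)[OF that]] semi_inner_nonneg[OF semi_inner_B op(1)[OF that]]
      op(3)[OF that] by (simp add: Q_eq_B)
  have inj: "AE x in Rplus. u x = 0"
    if uw: "(u, w) \<in> qc_hankel_operator r q \<alpha>" and w: "AE x in Rplus. w x = 0" for u w
  proof -
    note uw = op[OF uw]
    have "Q u = l2_inner Rplus (\<lambda>x. 0) u"
      unfolding uw(3) by (rule l2_inner_cong_AE[OF uw(2) l2_subspace_zero[OF l2_subspace_L2] Dom_L2[OF uw(1)] Dom_L2[OF uw(1)] w]) simp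
    then have "l2_norm lborel (W u) = 0" using C_pos by (simp add: laplace_form_eq l2_inner_def)
    then have "AE \<xi> in lborel. W u \<xi> = 0" by (rule l2_norm_eq_0_imp_AE[OF Dom_W[OF uw(1)]])
    then have "AE \<xi> in lborel. \<alpha> < \<xi> \<longrightarrow> laplace u \<xi> = 0"
      by eventually_elim (force simp: W_def dest: weight_pos)
    then show ?thesis by (rule laplace_injective[OF Dom_L2[OF uw(1)] \<alpha>_nonneg])
  qed
  show ?thesis unfolding l2_strictly_positive_def using pos inj by blast
qed

lemma hankel_operator_self_adjoint: "l2_self_adjoint Rplus (qc_hankel_operator r q \<alpha>)"
  unfolding qc_hankel_operator_def
  by (rule form_operator_self_adjoint[OF closed_form_Dom l2_dense_Dom])

end

theorem theorem1p1:
  fixes r q \<alpha> :: real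
  assumes "0 \<le> r"
    and "(0 < \<alpha> \<and> 1 \<le> q) \<or> (\<alpha> = 0 \<and> 0 < q)"
  shows "(\<forall>f\<in>C0_infinity_Rplus.
            integrable (Rplus \<Otimes>\<^sub>M Rplus) (hankel_integrand (qc_kernel r q \<alpha>) f) \<and>
            integrable lborel (laplace_integrand r q \<alpha> f) \<and>
            hankel_form (qc_kernel r q \<alpha>) f = laplace_form r q \<alpha> f) \<and>
         closable_form Rplus C0_infinity_Rplus (hankel_form (qc_kernel r q \<alpha>)) \<and>
         is_form_closure Rplus C0_infinity_Rplus (hankel_form (qc_kernel r q \<alpha>))
           (laplace_form_domain r q \<alpha>) (laplace_form r q \<alpha>) \<and>
         closed_form Rplus (laplace_form_domain r q \<alpha>) (laplace_form r q \<alpha>) \<and>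
         l2_self_adjoint Rplus (qc_hankel_operator r q \<alpha>) \<and>
         l2_strictly_positive Rplus (qc_hankel_operator r q \<alpha>)"
proof -
  interpret quasi_carleman r q \<alpha> by unfold_locales (use assms in auto)
  have "integrable lborel (laplace_integrand r q \<alpha> f)" if "f \<in> C0_infinity_Rplus" for f
    using that C0_infinity_subset_Dom by (auto simp: laplace_form_domain_def)
  then show ?thesis
    by (intro conjI ballI hankel_form_eq_laplace_form closable_form_K is_form_closure_K closed_form_Dom
        hankel_operator_self_adjoint hankel_operator_strictly_positive)
qed

end
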